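(* Let $\mathcal{A}$ be a central hyperplane arrangement in $\mathbb{C}^\ell$, and let $U^\chi$ be a regular, $r$-fold cyclic cover of $U=\mathbb{P}M(\mathcal{A})$, given by a surjective homomorphism $\chi\colon\pi_1(U)\to\mathbb{Z}_r$. Then there exist infinitely many multiplicity vectors $m$ on $\mathcal{A}$ for which the covering projection $F(\mathcal{A},m)\to U$ factors through $U^\chi\to U$. Moreover, for any prime $p$ not dividing $r$, we may choose $m$ so that the degree of $Q(\mathcal{A},m)$ is not divisible by $p$.
   Context: For a central arrangement $\mathcal{A}$ in $\mathbb{C}^\ell$ with linear forms $f_H$, $\ker f_H=H$, $M(\mathcal{A})=\mathbb{C}^\ell\setminus\bigcup_{H\in\mathcal{A}}H$ and $U=\mathbb{P}M(\mathcal{A})$ is its image in $\mathbb{P}^{\ell-1}$. A multiplicity vector is $m=(m_H)_{H\in\mathcal{A}}$ with positive integer entries and $\gcd(m_H)=1$; set $Q(\mathcal{A},m)=\prod_H f_H^{m_H}$, of degree $N=\sum_H m_H$, and let $F(\mathcal{A},m)=\{z\in\mathbb{C}^\ell:Q(\mathcal{A},m)(z)=1\}$ be the Milnor fiber. The projection $z\mapsto[z]$ gives a regular $\mathbb{Z}_N$-cover $F(\mathcal{A},m)\to U$ (quotient by the action of $N$-th roots of unity). $U^\chi\to U$ is the connected regular cover corresponding to $\ker\chi$. Factoring means there is a map $F(\mathcal{A},m)\to U^\chi$ whose composite with $U^\chi\to U$ is the given cover.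
   Formalization: The arrangement is assumed nonempty (otherwise no multiplicity vector has gcd 1), and "infinitely many" is claimed only for at least two hyperplanes, since for one hyperplane gcd 1 forces m = (1); the statement about p is kept for every nonempty arrangement. *)

theory Defs
  imports "HOL-Analysis.Analysis" "HOL-Algebra.Elementary_Groups"
    "HOL-Computational_Algebra.Primes"
begin

section \<open>Complex projective space\<close>

text \<open>For \<open>CARD('n) = l\<close>, the type \<open>'n cproj\<close> is the projective space of dimension \<open>l - 1\<close>:
  its points are the complex lines through the origin of \<open>complex ^ 'n\<close>.\<close>

typedef ('n::finite) cproj =
  "{L :: (complex ^ 'n) set. \<exists>z. z \<noteq> 0 \<and> L = vec.span {z}}"
proof -
  have "(axis undefined 1 :: complex ^ 'n) \<noteq> 0"
    by (simp add: axis_eq_0_iff)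
  then show ?thesis by blast
qed

text \<open>\<open>proj_point z\<close> is the point \<open>[z]\<close>; it is meaningful for \<open>z \<noteq> 0\<close> only.\<close>

definition proj_point :: "complex ^ 'n \<Rightarrow> ('n::finite) cproj"
  where "proj_point z = Abs_cproj (vec.span {z})"

text \<open>Quotient topology of the punctured space \<open>- {0}\<close> (which is open, so that its relatively
  open subsets are the open sets contained in it).\<close>

instantiation cproj :: (finite) topological_space
begin

definition open_cproj :: "'a cproj set \<Rightarrow> bool"
  where "open_cproj S \<longleftrightarrow> open {z. z \<noteq> 0 \<and> proj_point z \<in> S}"

instance
proof
  have "{z::complex ^ 'a. z \<noteq> 0 \<and> proj_point z \<in> UNIV} = - {0}" by auto
  then show "open (UNIV :: 'a cproj set)"
    unfolding open_cproj_def by (simp only:) (rule open_Compl, simp)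
next
  fix S T :: "'a cproj set"
  assume "open S" "open T"
  moreover have "{z. z \<noteq> 0 \<and> proj_point z \<in> S \<inter> T} =
      {z. z \<noteq> 0 \<and> proj_point z \<in> S} \<inter> {z. z \<noteq> 0 \<and> proj_point z \<in> T}" by auto
  ultimately show "open (S \<inter> T)"
    unfolding open_cproj_def by (simp only:) (rule open_Int)
next
  fix K :: "'a cproj set set"
  assume "\<forall>S\<in>K. open S"
  moreover have "{z. z \<noteq> 0 \<and> proj_point z \<in> \<Union>K} =
      (\<Union>S\<in>K. {z. z \<noteq> 0 \<and> proj_point z \<in> S})" by auto
  ultimately show "open (\<Union>K)"
    unfolding open_cproj_def by (simp only:) (rule open_UN, simp)
qed

end

section \<open>The fundamental group and covers\<close>

definition loops_at :: "'a::topological_space set \<Rightarrow> 'a \<Rightarrow> (real \<Rightarrow> 'a) set"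
  where "loops_at S a =
    {g. path g \<and> path_image g \<subseteq> S \<and> pathstart g = a \<and> pathfinish g = a}"

definition loop_class :: "'a::topological_space set \<Rightarrow> (real \<Rightarrow> 'a) \<Rightarrow> (real \<Rightarrow> 'a) set"
  where "loop_class S g = {h. homotopic_paths S g h}"

text \<open>The union in the multiplication is over representatives; since concatenation respects
  homotopy, it is the class of the concatenation of any two of them.\<close>

definition fundamental_group ::
    "'a::topological_space set \<Rightarrow> 'a \<Rightarrow> (real \<Rightarrow> 'a) set monoid"
  where "fundamental_group S a =
    \<lparr>carrier = loop_class S ` loops_at S a,
     monoid.mult = (\<lambda>X Y. \<Union>g\<in>X. \<Union>h\<in>Y. loop_class S (g +++ h)),
     one = loop_class S (\<lambda>t. a)\<rparr>"

text \<open>\<open>is_cover_for U a K E p\<close>: the map \<open>p : E \<rightarrow> U\<close> is a connected cover corresponding to the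
  subgroup \<open>K\<close> of \<open>fundamental_group U a\<close>, that is, the image of the fundamental group of \<open>E\<close>
  under \<open>p\<close> is \<open>K\<close>.\<close>

definition is_cover_for :: "'b::topological_space set \<Rightarrow> 'b \<Rightarrow> (real \<Rightarrow> 'b) set set \<Rightarrow>
    'a::topological_space set \<Rightarrow> ('a \<Rightarrow> 'b) \<Rightarrow> bool"
  where "is_cover_for U a K E p \<longleftrightarrow>
    covering_space E p U \<and> connected E \<and>
    (\<exists>e\<in>E. p e = a \<and> (\<lambda>g. loop_class U (p \<circ> g)) ` loops_at E e = K)"

definition factors_through :: "'a::topological_space set \<Rightarrow> ('a \<Rightarrow> 'c) \<Rightarrow>
    'b::topological_space set \<Rightarrow> ('b \<Rightarrow> 'c) \<Rightarrow> bool"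
  where "factors_through F q E p \<longleftrightarrow>
    (\<exists>g. continuous_on F g \<and> g ` F \<subseteq> E \<and> (\<forall>z\<in>F. p (g z) = q z))"

section \<open>Arrangements and Milnor fibers\<close>

definition central_arrangement :: "(complex ^ 'n) set set \<Rightarrow> bool"
  where "central_arrangement A \<longleftrightarrow>
    finite A \<and> (\<forall>H\<in>A. vec.subspace H \<and> vec.dim H + 1 = CARD('n))"

definition defining_forms ::
    "(complex ^ 'n) set set \<Rightarrow> ((complex ^ 'n) set \<Rightarrow> complex ^ 'n \<Rightarrow> complex) \<Rightarrow> bool"
  where "defining_forms A f \<longleftrightarrow>
    (\<forall>H\<in>A. Vector_Spaces.linear (*s) (*) (f H) \<and> {z. f H z = 0} = H)"

definition arr_complement :: "(complex ^ 'n) set set \<Rightarrow> (complex ^ 'n) set"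
  where "arr_complement A = UNIV - \<Union>A"

definition proj_complement :: "(complex ^ 'n) set set \<Rightarrow> 'n cproj set"
  where "proj_complement A = proj_point ` arr_complement A"

text \<open>Multiplicity vectors are extensional functions (with value \<open>undefined\<close> outside \<open>A\<close>), so that
  distinct functions are distinct vectors.\<close>

definition multiplicity_vectors :: "(complex ^ 'n) set set \<Rightarrow> ((complex ^ 'n) set \<Rightarrow> nat) set"
  where "multiplicity_vectors A = {m \<in> A \<rightarrow>\<^sub>E {0<..}. Gcd (m ` A) = 1}"

definition Q_poly :: "(complex ^ 'n) set set \<Rightarrow> ((complex ^ 'n) set \<Rightarrow> complex ^ 'n \<Rightarrow> complex) \<Rightarrow>
    ((complex ^ 'n) set \<Rightarrow> nat) \<Rightarrow> complex ^ 'n \<Rightarrow> complex"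
  where "Q_poly A f m z = (\<Prod>H\<in>A. f H z ^ m H)"

text \<open>The degree of \<open>Q_poly A f m\<close>, a product of \<open>m H\<close>-th powers of nonzero linear forms.\<close>

definition Q_degree :: "(complex ^ 'n) set set \<Rightarrow> ((complex ^ 'n) set \<Rightarrow> nat) \<Rightarrow> nat"
  where "Q_degree A m = (\<Sum>H\<in>A. m H)"

definition milnor_fiber :: "(complex ^ 'n) set set \<Rightarrow>
    ((complex ^ 'n) set \<Rightarrow> complex ^ 'n \<Rightarrow> complex) \<Rightarrow>
    ((complex ^ 'n) set \<Rightarrow> nat) \<Rightarrow> (complex ^ 'n) set"
  where "milnor_fiber A f m = {z. Q_poly A f m z = 1}"

end

theory Submission
  imports Defs "HOL-Complex_Analysis.Complex_Analysis" "HOL-Number_Theory.Cong"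
begin

text \<open>Pull \<open>\<chi>\<close> back to the complement \<open>M\<close> of the arrangement, an open subset of a vector space. There
  it has the form \<open>\<Sum>\<^sub>H a\<^sub>H wind\<^sub>H mod r\<close>, where \<open>wind\<^sub>H\<close> is the winding number of \<open>f\<^sub>H\<close> along a loop
  and \<open>a\<^sub>H\<close> is the value on a meridian of \<open>H\<close>: after division by this expression the character is
  trivial on meridians, and a character trivial on meridians is trivial. For the latter, cone a path
  from generic points, which reduces the claim to boundaries of real triangles with edges in \<open>M\<close>.
  Subdivide a triangle until it meets at most one hyperplane. If it meets none, its boundary is
  contractible in \<open>M\<close>; if it meets one, shrinking towards the intersection point turns its boundary
  into a meridian or the inverse of one.

  Let \<open>m\<close> be congruent to \<open>a\<close> modulo \<open>r\<close>. Along a loop in the Milnor fiber \<open>Q = \<Prod>\<^sub>H f\<^sub>H ^ m\<^sub>H\<close> is constant,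
  so \<open>\<Sum>\<^sub>H m\<^sub>H wind\<^sub>H = 0\<close> and the loop lifts to the cover. Since \<open>\<chi>\<close> is surjective, the \<open>a\<^sub>H\<close> and \<open>r\<close> have
  no common divisor, which leaves enough freedom to make the entries of \<open>m\<close> coprime and their sum
  prime to \<open>p\<close>.\<close>

section \<open>Lifting in covering spaces\<close>

text \<open>A real segment has dimension one and a complex hyperplane real codimension two, so
  segments from a generic point avoid the arrangement, while a triangle with edges in
  \<open>M\<close> meets each hyperplane at most once. The obstacle is that several hyperplanes may
  pass through the same point of a triangle; then no subdivision inside its plane separates them.
  The new vertex is therefore allowed to leave the plane: two distinct forms are independent, so a
  displacement in \<open>complex ^ 'n\<close> can prescribe their values separately, and it is
  chosen such that no face of the cone meets both hyperplanes. Projectivization enters through one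
  loop: the circle in the complex line of \<open>base\<close> dies in projective space and winds
  once around every hyperplane, so the sum of the values \<open>a H\<close> is 0 modulo
  \<open>r\<close>. With two or more hyperplanes, varying a single entry of \<open>m\<close>
  achieves everything. With one hyperplane the gcd condition leaves only the entry 1; the relation
  then forces \<open>r = 1\<close>, and the claim on infinitely many vectors is restricted to at
  least two hyperplanes.\<close>

text \<open>The lifting theorems of the library require normed vector spaces, which neither the cover nor its
  base is here.\<close>

lemma covering_sheet:
  assumes "covering_space E p S" "e \<in> E"
  obtains W u q where "p e \<in> W" "openin (top_of_set S) W" "e \<in> u" "openin (top_of_set E) u"
    "homeomorphism u W p q"
  using covering_space_local_homeomorphism[OF assms] by metis

lemma continuous_near:
  fixes T :: "'a::metric_space set"
  assumes "continuous_on T g" "g ` T \<subseteq> S" "openin (top_of_set S) W" "x \<in> T" "g x \<in> W"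
  obtains d where "d > 0" "\<And>t. t \<in> T \<Longrightarrow> dist t x < d \<Longrightarrow> g t \<in> W"
proof -
  have "openin (top_of_set T) (T \<inter> g -` W)"
    using continuous_openin_preimage[of T g S W] assms by auto
  then obtain d where "d > 0" "\<And>t. t \<in> T \<Longrightarrow> dist t x < d \<Longrightarrow> t \<in> T \<inter> g -` W"
    using assms(4,5) unfolding openin_euclidean_subtopology_iff by (metis IntI vimageI)
  then show ?thesis using that by blast
qed

text \<open>The truth value of \<open>g1 t = g2 t\<close> is locally constant: near a point each
  lift stays in one sheet, a common sheet forces equality because \<open>p\<close> is injective on
  it, and different sheets are disjoint.\<close>

lemma covering_lifts_agree:
  fixes E :: "'a::topological_space set" and S :: "'b::topological_space set"
    and T :: "'c::topological_space set"
  assumes cov: "covering_space E p S" and T: "connected T" "a \<in> T" "x \<in> T"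
    and g1: "continuous_on T g1" "g1 ` T \<subseteq> E" and g2: "continuous_on T g2" "g2 ` T \<subseteq> E"
    and eq: "\<And>t. t \<in> T \<Longrightarrow> p (g1 t) = p (g2 t)" and a: "g1 a = g2 a"
  shows "g1 x = g2 x"
proof -
  have "\<forall>z\<in>T. eventually (\<lambda>t. (g1 z = g2 z) = (g1 t = g2 t)) (at z within T)"
  proof
    fix z assume z: "z \<in> T"
    have "p (g1 z) \<in> S" using z g1(2) cov covering_space_imp_surjective by blast
    then obtain W v where W: "p (g1 z) \<in> W" and v: "\<Union>v = E \<inter> p -` W"
      "\<forall>u\<in>v. openin (top_of_set E) u" "pairwise disjnt v"
      "\<forall>u\<in>v. \<exists>q. homeomorphism u W p q"
      using cov unfolding covering_space_def by meson
    have "g1 z \<in> \<Union>v" "g2 z \<in> \<Union>v" using z g1(2) g2(2) W eq[OF z] v(1) by auto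
    then obtain u1 u2 where u: "u1 \<in> v" "u2 \<in> v" "g1 z \<in> u1" "g2 z \<in> u2" by blast
    have inj: "s = t" if "s \<in> u" "t \<in> u" "p s = p t" "u \<in> v" for s t u
      using v(4) that by (metis homeomorphism_apply1)
    have o: "openin (top_of_set T) (T \<inter> g1 -` u1)" "openin (top_of_set T) (T \<inter> g2 -` u2)"
      using continuous_openin_preimage[OF g1(1), of E u1] continuous_openin_preimage[OF g2(1), of E u2]
        g1(2) g2(2) u v(2) by auto
    have "openin (top_of_set T) ((T \<inter> g1 -` u1) \<inter> (T \<inter> g2 -` u2))"
      using o by blast
    then obtain O' where O': "open O'" "(T \<inter> g1 -` u1) \<inter> (T \<inter> g2 -` u2) = T \<inter> O'"
      by (auto simp: openin_open)
    have "z \<in> O'" using O' u z by blast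
    moreover have "(g1 z = g2 z) = (g1 t = g2 t)" if t: "t \<in> O'" "t \<in> T" for t
    proof -
      have t': "g1 t \<in> u1" "g2 t \<in> u2" using O' t by auto
      show ?thesis
      proof (cases "u1 = u2")
        case True
        then show ?thesis using inj t' u eq[OF z] eq[OF t(2)] by metis
      next
        case False
        then have "u1 \<inter> u2 = {}" using v(3) u by (auto simp: pairwise_def disjnt_def)
        then show ?thesis using t' u by (metis disjoint_iff)
      qed
    qed
    ultimately show "eventually (\<lambda>t. (g1 z = g2 z) = (g1 t = g2 t)) (at z within T)"
      using O'(1) unfolding eventually_at_topological by blast
  qed
  from connected_local_const[OF T this] show ?thesis using a by simp
qed

lemma covering_path_lift:
  fixes E :: "'a::topological_space set" and S :: "'b::topological_space set"
  assumes cov: "covering_space E p S" and g: "path g" "path_image g \<subseteq> S"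
    and e: "e \<in> E" "p e = pathstart g"
  obtains h where "path h" "path_image h \<subseteq> E" "pathstart h = e" "\<And>t. t \<in> {0..1} \<Longrightarrow> p (h t) = g t"
proof -
  \<comment> \<open>Lifts from every point over \<open>g a\<close> are demanded, so that a lift over
    \<open>{b..c}\<close> can start where one over \<open>{a..b}\<close> ends. The guard is there
    because the local step of \<open>Bolzano\<close> also offers intervals that leave
    \<open>{0..1}\<close>.\<close>
  define P where "P a b \<longleftrightarrow> (0 \<le> a \<and> b \<le> 1 \<longrightarrow> (\<forall>e\<in>E. p e = g a \<longrightarrow>
     (\<exists>h. continuous_on {a..b} h \<and> h ` {a..b} \<subseteq> E \<and> h a = e \<and> (\<forall>t\<in>{a..b}. p (h t) = g t))))"
    for a b
  have "(0::real) \<le> 1" by simp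
  then have "P 0 1"
  proof (induction rule: Bolzano)
    case (trans a b c)
    show ?case unfolding P_def
    proof clarify
      fix e assume g: "0 \<le> a" "c \<le> 1" "e \<in> E" "p e = g a"
      obtain h where h: "continuous_on {a..b} h" "h ` {a..b} \<subseteq> E" "h a = e" "\<forall>t\<in>{a..b}. p (h t) = g t"
        using trans(1) trans(4) g unfolding P_def by auto
      have "h b \<in> E" "p (h b) = g b" using h trans by auto
      then obtain k where k: "continuous_on {b..c} k" "k ` {b..c} \<subseteq> E" "k b = h b"
          "\<forall>t\<in>{b..c}. p (k t) = g t"
        using trans g unfolding P_def by auto
      let ?m = "\<lambda>t. if t \<le> b then h t else k t"
      have s: "{t \<in> {a..c}. t \<le> b} = {a..b}" "{t \<in> {a..c}. b \<le> t} = {b..c}" using trans by auto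
      have "continuous_on {a..c} ?m"
        by (rule continuous_on_cases_le) (use h k s in auto)
      moreover have "?m ` {a..c} \<subseteq> E" using h(2) k(2) trans by (auto simp: image_subset_iff)
      moreover have "?m a = e" using trans h by simp
      moreover have "\<forall>t\<in>{a..c}. p (?m t) = g t" using h(4) k(4) by auto
      ultimately show "\<exists>h. continuous_on {a..c} h \<and> h ` {a..c} \<subseteq> E \<and> h a = e \<and> (\<forall>t\<in>{a..c}. p (h t) = g t)"
        by blast
    qed
  next
    case (local x)
    then have "g x \<in> S" using g(2) by (auto simp: path_image_def)
    then obtain W v where W: "g x \<in> W" "openin (top_of_set S) W" and v: "\<Union>v = E \<inter> p -` W"
      "\<forall>u\<in>v. openin (top_of_set E) u" "pairwise disjnt v"
      "\<forall>u\<in>v. \<exists>q. homeomorphism u W p q"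
      using cov unfolding covering_space_def by meson
    obtain d where d: "d > 0" "\<And>t. t \<in> {0..1} \<Longrightarrow> dist t x < d \<Longrightarrow> g t \<in> W"
      by (rule continuous_near[of "{0..1}" g S W x]) (use g W local in \<open>auto simp: path_def path_image_def\<close>)
    have "P a b" if ab: "a \<le> x" "x \<le> b" "b - a < d" for a b
      unfolding P_def
    proof clarify
      fix e assume e: "0 \<le> a" "b \<le> 1" "e \<in> E" "p e = g a"
      have gW: "g t \<in> W" if "t \<in> {a..b}" for t
        using d(2)[of t] that ab e by (auto simp: dist_real_def)
      then have "e \<in> \<Union>v" using e v(1) ab by auto
      then obtain u q where u: "u \<in> v" "e \<in> u" "homeomorphism u W p q" using v(4) by blast
      have cq: "continuous_on W q" and qW: "q ` W = u" using u(3) homeomorphism_def by blast+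
      have "continuous_on {a..b} (q \<circ> g)"
        by (intro continuous_on_compose continuous_on_subset[OF cq])
           (use g(1) gW e in \<open>auto simp: path_def elim!: continuous_on_subset\<close>)
      moreover have "(q \<circ> g) ` {a..b} \<subseteq> E" using gW qW u v(1) by fastforce
      moreover have "(q \<circ> g) a = e" using e u homeomorphism_apply1 by fastforce
      moreover have "\<forall>t\<in>{a..b}. p ((q \<circ> g) t) = g t"
        using gW homeomorphism_apply2[OF u(3)] by auto
      ultimately show "\<exists>h. continuous_on {a..b} h \<and> h ` {a..b} \<subseteq> E \<and> h a = e \<and> (\<forall>t\<in>{a..b}. p (h t) = g t)"
        by blast
    qed
    then show ?case using d(1) by blast
  qed
  then obtain h where "continuous_on {0..1} h" "h ` {0..1} \<subseteq> E" "h 0 = e" "\<forall>t\<in>{0..1}. p (h t) = g t"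
    using e unfolding P_def pathstart_def by auto
  then show ?thesis using that unfolding path_def path_image_def pathstart_def by blast
qed

text \<open>Homotopy lifting over a thin strip around \<open>s0\<close>. The width \<open>d\<close>
  may shrink at each gluing in the \<open>t\<close> direction; the two lifts agree on the seam
  because the strip is connected in the \<open>s\<close> direction and both continue
  \<open>g0\<close>.\<close>

lemma covering_tube_lift:
  fixes E :: "'a::topological_space set" and S :: "'b::topological_space set"
    and H :: "real \<times> real \<Rightarrow> 'b"
  assumes cov: "covering_space E p S" and H: "continuous_on ({0..1} \<times> {0..1}) H" "H ` ({0..1} \<times> {0..1}) \<subseteq> S"
    and s0: "s0 \<in> {0..1}" and g0: "path g0" "path_image g0 \<subseteq> E" "\<And>t. t \<in> {0..1} \<Longrightarrow> p (g0 t) = H (s0, t)"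
  obtains d k where "d > 0" "continuous_on ((ball s0 d \<inter> {0..1}) \<times> {0..1}) k"
    "k ` ((ball s0 d \<inter> {0..1}) \<times> {0..1}) \<subseteq> E"
    "\<And>z. z \<in> (ball s0 d \<inter> {0..1}) \<times> {0..1} \<Longrightarrow> p (k z) = H z"
    "\<And>t. t \<in> {0..1} \<Longrightarrow> k (s0, t) = g0 t"
proof -
  let ?B = "\<lambda>d::real. ball s0 d \<inter> {0..1}"
  define L where "L d k a b \<longleftrightarrow> continuous_on (?B d \<times> {a..b}) k \<and> k ` (?B d \<times> {a..b}) \<subseteq> E \<and>
     (\<forall>z \<in> ?B d \<times> {a..b}. p (k z) = H z) \<and> (\<forall>t\<in>{a..b}. k (s0, t) = g0 t)" for d k a b
  define P where "P a b \<longleftrightarrow> (0 \<le> a \<and> b \<le> 1 \<longrightarrow> (\<exists>d>0. \<exists>k. L d k a b))" for a b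
  have L_mono: "L d' k a b" if "L d k a b" "d' \<le> d" for d d' k a b
  proof -
    have "?B d' \<subseteq> ?B d" using that(2) by auto
    then show ?thesis using that(1) unfolding L_def
      by (meson Sigma_mono continuous_on_subset image_mono order_refl subset_iff subset_trans)
  qed
  have "(0::real) \<le> 1" by simp
  then have "P 0 1"
  proof (induction rule: Bolzano)
    case (trans a b c)
    show ?case unfolding P_def
    proof clarify
      assume ac: "0 \<le> a" "c \<le> 1"
      obtain d1 k1 where k1: "d1 > 0" "L d1 k1 a b" using trans ac unfolding P_def by auto
      obtain d2 k2 where k2: "d2 > 0" "L d2 k2 b c" using trans ac unfolding P_def by auto
      define d where "d = min d1 d2"
      have d: "d > 0" "L d k1 a b" "L d k2 b c" using k1 k2 L_mono unfolding d_def by auto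
      have agree: "k1 (s, b) = k2 (s, b)" if s: "s \<in> ?B d" for s
      proof (rule covering_lifts_agree[OF cov, of "?B d" s0 s "\<lambda>s. k1 (s,b)" "\<lambda>s. k2 (s,b)"])
        show "connected (?B d)" by (intro convex_connected convex_Int) auto
        show "s0 \<in> ?B d" using s0 d(1) by auto
        show "s \<in> ?B d" by fact
        show "continuous_on (?B d) (\<lambda>s. k1 (s, b))"
          by (rule continuous_on_compose2[of "?B d \<times> {a..b}" k1])
             (use d(2) trans in \<open>auto simp: L_def intro!: continuous_intros\<close>)
        show "continuous_on (?B d) (\<lambda>s. k2 (s, b))"
          by (rule continuous_on_compose2[of "?B d \<times> {b..c}" k2])
             (use d(3) trans in \<open>auto simp: L_def intro!: continuous_intros\<close>)
      qed (use d(2,3) trans s0 in \<open>auto simp: L_def image_subset_iff\<close>)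
      let ?m = "\<lambda>z. if snd z \<le> b then k1 z else k2 z"
      have s: "{z \<in> ?B d \<times> {a..c}. snd z \<le> b} = ?B d \<times> {a..b}"
        "{z \<in> ?B d \<times> {a..c}. b \<le> snd z} = ?B d \<times> {b..c}" using trans by auto
      have "continuous_on (?B d \<times> {a..c}) ?m"
        by (rule continuous_on_cases_le, unfold s)
           (use d(2,3) agree in \<open>auto simp: L_def intro!: continuous_intros\<close>)
      moreover have "k1 z \<in> E" if "z \<in> ?B d \<times> {a..b}" for z using d(2) that unfolding L_def by blast
      moreover have "k2 z \<in> E" if "z \<in> ?B d \<times> {b..c}" for z using d(3) that unfolding L_def by blast
      moreover have "p (k1 z) = H z" if "z \<in> ?B d \<times> {a..b}" for z using d(2) that unfolding L_def by blast
      moreover have "p (k2 z) = H z" if "z \<in> ?B d \<times> {b..c}" for z using d(3) that unfolding L_def by blast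
      moreover have "k1 (s0, t) = g0 t" if "t \<in> {a..b}" for t using d(2) that unfolding L_def by blast
      moreover have "k2 (s0, t) = g0 t" if "t \<in> {b..c}" for t using d(3) that unfolding L_def by blast
      ultimately have "L d ?m a c" unfolding L_def by auto
      then show "\<exists>d>0. \<exists>k. L d k a c" using d(1) by blast
    qed
  next
    case (local x)
    have gx: "g0 x \<in> E" using local g0(2) by (auto simp: path_image_def)
    obtain W u q where W: "p (g0 x) \<in> W" "openin (top_of_set S) W" "g0 x \<in> u" "openin (top_of_set E) u"
      "homeomorphism u W p q" using covering_sheet[OF cov gx] .
    have x: "x \<in> {0..1}" using local by simp
    obtain d1 where d1: "d1 > 0" "\<And>t. t \<in> {0..1} \<Longrightarrow> dist t x < d1 \<Longrightarrow> g0 t \<in> u"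
      by (rule continuous_near[of "{0..1}" g0 E u x]) (use g0(1,2) W x in \<open>auto simp: path_def path_image_def\<close>)
    have "H (s0, x) \<in> W" using W(1) g0(3)[OF x] by simp
    then obtain d2 where d2: "d2 > 0" "\<And>z. z \<in> {0..1} \<times> {0..1} \<Longrightarrow> dist z (s0, x) < d2 \<Longrightarrow> H z \<in> W"
      using continuous_near[OF H W(2), of "(s0, x)"] s0 x by blast
    \<comment> \<open>Half of \<open>d2\<close>, since the distance in the product is bounded by the
      sum of the two coordinate distances.\<close>
    define d where "d = min d1 (d2/2)"
    have d: "d > 0" using d1 d2 by (simp add: d_def)
    have "P a b" if ab: "a \<le> x" "x \<le> b" "b - a < d" for a b
      unfolding P_def
    proof clarify
      assume e: "0 \<le> a" "b \<le> 1"
      have HW: "H z \<in> W" if z: "z \<in> ?B d \<times> {a..b}" for z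
      proof (rule d2(2))
        show "z \<in> {0..1} \<times> {0..1}" using z e by auto
        obtain s t where st: "z = (s,t)" by (cases z)
        have "dist z (s0,x) \<le> dist s s0 + dist t x" unfolding st dist_Pair_Pair
          by (metis sqrt_sum_squares_le_sum zero_le_dist)
        also have "\<dots> < d2/2 + d2/2"
        proof (intro add_strict_mono)
          show "dist s s0 < d2/2" using z st d_def by (auto simp: dist_commute)
          have "a \<le> t" "t \<le> b" "b - a < d2/2" using z st ab d_def by auto
          then show "dist t x < d2/2" using ab unfolding dist_real_def abs_less_iff by linarith
        qed
        finally show "dist z (s0,x) < d2" by simp
      qed
      have gu: "g0 t \<in> u" if "t \<in> {a..b}" for t
        using d1(2)[of t] that ab e d_def by (auto simp: dist_real_def)
      have cq: "continuous_on W q" and qW: "q ` W = u" using W(5) homeomorphism_def by blast+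
      have "continuous_on (?B d \<times> {a..b}) (q \<circ> H)"
        by (intro continuous_on_compose continuous_on_subset[OF cq])
           (use H(1) HW e in \<open>auto elim!: continuous_on_subset\<close>)
      moreover have "q w \<in> E" if "w \<in> W" for w using qW W(4) that openin_imp_subset by blast
      moreover have "p (q w) = w" if "w \<in> W" for w using homeomorphism_apply2[OF W(5)] that by simp
      moreover have "q (H (s0, t)) = g0 t" if "t \<in> {a..b}" for t
        using gu[OF that] homeomorphism_apply1[OF W(5)] g0(3)[of t] that e by (metis atLeastAtMost_iff order_trans)
      ultimately have "L d (q \<circ> H) a b" using HW unfolding L_def by auto
      then show "\<exists>d>0. \<exists>k. L d k a b" using d by blast
    qed
    then show ?case using d(1) by blast
  qed
  then obtain d k where "d > 0" "L d k 0 1" unfolding P_def by auto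
  then show ?thesis using that unfolding L_def by blast
qed

text \<open>Each path \<open>H (s, t)\<close> with fixed \<open>s\<close> is lifted separately, and
  the end points of these lifts are shown to be locally constant in \<open>s\<close>. A strip lift
  around \<open>s0\<close> is constant on the sides \<open>t = 0\<close> and \<open>t = 1\<close>,
  where \<open>H\<close> is constant, and by uniqueness of lifts it ends where the separate lifts
  end.\<close>

lemma covering_monodromy:
  fixes E :: "'a::topological_space set" and S :: "'b::topological_space set"
  assumes cov: "covering_space E p S" and hom: "homotopic_paths S g1 g2"
    and h1: "path h1" "path_image h1 \<subseteq> E" "\<And>t. t \<in> {0..1} \<Longrightarrow> p (h1 t) = g1 t"
    and h2: "path h2" "path_image h2 \<subseteq> E" "\<And>t. t \<in> {0..1} \<Longrightarrow> p (h2 t) = g2 t"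
    and start: "pathstart h1 = pathstart h2"
  shows "pathfinish h1 = pathfinish h2"
proof -
  define e where "e = pathstart h1"
  have eE: "e \<in> E" using h1(2) e_def by auto
  obtain H :: "real \<times> real \<Rightarrow> 'b" where H: "continuous_on ({0..1} \<times> {0..1}) H" "H \<in> {0..1} \<times> {0..1} \<rightarrow> S"
    and H0: "\<forall>x\<in>{0..1}. H (0, x) = g1 x" and H1: "\<forall>x\<in>{0..1}. H (1, x) = g2 x"
    and He: "\<forall>s\<in>{0..1}. pathstart (H \<circ> Pair s) = pathstart g1 \<and> pathfinish (H \<circ> Pair s) = pathfinish g1"
    using hom unfolding homotopic_paths by blast
  have HS: "H ` ({0..1} \<times> {0..1}) \<subseteq> S" using H(2) by blast
  have Hs: "H (s, 0) = pathstart g1" and Hf: "H (s, 1) = pathfinish g1" if "s \<in> {0..1}" for s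
    using He that by (auto simp: pathstart_def pathfinish_def)
  have pe: "p e = pathstart g1" using h1(3)[of 0] e_def by (simp add: pathstart_def)
  have "\<exists>h. path h \<and> path_image h \<subseteq> E \<and> pathstart h = e \<and> (\<forall>t\<in>{0..1}. p (h t) = H (s, t))"
    if s: "s \<in> {0..1}" for s
  proof -
    have "path (\<lambda>t. H (s, t))" unfolding path_def
      by (rule continuous_on_compose2[OF H(1)]) (use s in \<open>auto intro!: continuous_intros\<close>)
    moreover have "path_image (\<lambda>t. H (s, t)) \<subseteq> S" using HS s by (auto simp: path_image_def)
    moreover have "p e = pathstart (\<lambda>t. H (s, t))" using pe Hs s by (simp add: pathstart_def)
    ultimately obtain h where "path h" "path_image h \<subseteq> E" "pathstart h = e"
      "\<And>t. t \<in> {0..1} \<Longrightarrow> p (h t) = H (s, t)"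
      using covering_path_lift[OF cov _ _ eE, of "\<lambda>t. H (s, t)"] by blast
    then show ?thesis by blast
  qed
  then have "\<forall>s\<in>{0..1}. \<exists>h. path h \<and> path_image h \<subseteq> E \<and> pathstart h = e \<and> (\<forall>t\<in>{0..1}. p (h t) = H (s, t))"
    by blast
  from bchoice[OF this] obtain l where l: "\<And>s. s \<in> {0..1} \<Longrightarrow> path (l s)" "\<And>s. s \<in> {0..1} \<Longrightarrow> path_image (l s) \<subseteq> E"
    "\<And>s. s \<in> {0..1} \<Longrightarrow> pathstart (l s) = e" "\<And>s t. s \<in> {0..1} \<Longrightarrow> t \<in> {0..1} \<Longrightarrow> p (l s t) = H (s, t)"
    by blast
  have path_unique: "pathfinish h = pathfinish k" if
    "path h" "path_image h \<subseteq> E" "path k" "path_image k \<subseteq> E" "pathstart h = pathstart k"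
    "\<And>t. t \<in> {0..1} \<Longrightarrow> p (h t) = p (k t)" for h k :: "real \<Rightarrow> 'a"
    unfolding pathfinish_def
    by (rule covering_lifts_agree[OF cov, of "{0..1}" 0 1])
       (use that in \<open>auto simp: path_def path_image_def pathstart_def\<close>)
  have "\<forall>s0\<in>{0..1}. eventually (\<lambda>s. pathfinish (l s0) = pathfinish (l s)) (at s0 within {0..1})"
  proof
    fix s0 :: real assume s0: "s0 \<in> {0..1}"
    obtain d k where d: "d > 0" and k: "continuous_on ((ball s0 d \<inter> {0..1}) \<times> {0..1}) k"
      "k ` ((ball s0 d \<inter> {0..1}) \<times> {0..1}) \<subseteq> E"
      "\<And>z. z \<in> (ball s0 d \<inter> {0..1}) \<times> {0..1} \<Longrightarrow> p (k z) = H z"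
      "\<And>t. t \<in> {0..1} \<Longrightarrow> k (s0, t) = l s0 t"
      using covering_tube_lift[OF cov H(1) HS s0, of "l s0"] l[OF s0] by metis
    let ?B = "ball s0 d \<inter> {0..1}"
    have const: "k (s, t) = k (s0, t)" if s: "s \<in> ?B" and t: "t \<in> {0..1}"
      and c: "\<And>s. s \<in> {0..1} \<Longrightarrow> H (s, t) = H (s0, t)" for s t
    proof (rule covering_lifts_agree[OF cov, of ?B s0 s "\<lambda>s. k (s,t)" "\<lambda>s. k (s0,t)"])
      show "connected ?B" by (intro convex_connected convex_Int) auto
      show "continuous_on ?B (\<lambda>s. k (s, t))"
        by (rule continuous_on_compose2[OF k(1)]) (use t in \<open>auto intro!: continuous_intros\<close>)
      show "p (k (r, t)) = p (k (s0, t))" if "r \<in> ?B" for r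
        using k(3)[of "(r,t)"] k(3)[of "(s0,t)"] c[of r] that t s0 d by auto
    qed (use s s0 d t k(2) in auto)
    have "pathfinish (l s0) = pathfinish (l s)" if s: "s \<in> ?B" for s
    proof -
      have "k (s, 0) = e" using const[OF s, of 0] Hs k(4)[of 0] l(3)[OF s0] s0 by (auto simp: pathstart_def)
      then have "pathfinish (l s) = pathfinish (\<lambda>t. k (s, t))"
      proof (intro path_unique)
        show "path (\<lambda>t. k (s, t))" unfolding path_def
          by (rule continuous_on_compose2[OF k(1)]) (use s in \<open>auto intro!: continuous_intros\<close>)
        show "path_image (\<lambda>t. k (s, t)) \<subseteq> E" using k(2) s by (auto simp: path_image_def)
        show "p (l s t) = p (k (s, t))" if "t \<in> {0..1}" for t
          using l(4)[of s t] k(3)[of "(s,t)"] s that by auto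
      qed (use s l in \<open>auto simp: pathstart_def\<close>)
      also have "\<dots> = k (s, 1)" by (simp add: pathfinish_def)
      also have "\<dots> = k (s0, 1)" using const[OF s, of 1] Hf s0 by auto
      also have "\<dots> = pathfinish (l s0)" using k(4)[of 1] by (simp add: pathfinish_def)
      finally show ?thesis by simp
    qed
    then show "eventually (\<lambda>s. pathfinish (l s0) = pathfinish (l s)) (at s0 within {0..1})"
      unfolding eventually_at using d by (auto simp: dist_commute)
  qed
  from connected_local_const[OF _ _ _ this, of 0 1] have "pathfinish (l 0) = pathfinish (l 1)" by simp
  moreover have "pathfinish (l 0) = pathfinish h1"
    by (rule path_unique) (use l h1 H0 e_def in auto)
  moreover have "pathfinish (l 1) = pathfinish h2"
    by (rule path_unique) (use l h2 H1 e_def start in auto)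
  ultimately show ?thesis by simp
qed

section \<open>Triangles around the origin\<close>

text \<open>Turns visibility into a condition on a quotient: to avoid the closed slit is an open
  condition, which suits the Baire category theorem.\<close>

lemma zero_in_segment_iff:
  fixes a b :: complex
  assumes "b \<noteq> 0"
  shows "0 \<in> closed_segment a b \<longleftrightarrow> a / b \<in> \<real>\<^sub>\<le>\<^sub>0"
proof
  assume "0 \<in> closed_segment a b"
  then obtain u where u: "0 \<le> u" "u \<le> 1" "0 = (1 - u) *\<^sub>R a + u *\<^sub>R b"
    by (auto simp: closed_segment_def)
  then have "u \<noteq> 1" using assms by auto
  with u have "a = complex_of_real (- (u / (1 - u))) * b"
    by (simp add: scaleR_conv_of_real divide_simps) (simp add: algebra_simps add_eq_0_iff)
  then have "a / b = complex_of_real (- (u / (1 - u)))" using assms by simp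
  moreover have "- (u / (1 - u)) \<le> 0" using u by auto
  ultimately show "a / b \<in> \<real>\<^sub>\<le>\<^sub>0" using nonpos_Reals_of_real_iff by metis
next
  assume "a / b \<in> \<real>\<^sub>\<le>\<^sub>0"
  then obtain s where s: "a / b = complex_of_real s" "s \<le> 0" by (auto elim: nonpos_Reals_cases)
  then have a: "a = s *\<^sub>R b" using assms by (simp add: scaleR_conv_of_real field_simps)
  \<comment> \<open>The solution of \<open>(1 - u) * s + u = 0\<close>.\<close>
  define u where "u = -s / (1 - s)"
  have "(1 - u) * s + u = 0" "0 \<le> u" "u \<le> 1" using s(2) by (auto simp: u_def field_simps)
  then have "0 = (1 - u) *\<^sub>R a + u *\<^sub>R b"
    unfolding a by (metis scaleR_add_left scaleR_scaleR scaleR_zero_left)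
  then show "0 \<in> closed_segment a b" using \<open>0 \<le> u\<close> \<open>u \<le> 1\<close> by (auto simp: closed_segment_def)
qed

lemma zero_in_segment_combination:
  fixes a b :: "'a::real_vector"
  assumes "\<alpha> \<ge> 0" "\<beta> \<ge> 0" "\<alpha> + \<beta> > 0" "\<alpha> *\<^sub>R a + \<beta> *\<^sub>R b = 0"
  shows "0 \<in> closed_segment a b"
proof -
  have "(1 - \<beta> / (\<alpha> + \<beta>)) *\<^sub>R a + (\<beta> / (\<alpha> + \<beta>)) *\<^sub>R b = (1 / (\<alpha> + \<beta>)) *\<^sub>R (\<alpha> *\<^sub>R a + \<beta> *\<^sub>R b)"
    using assms(3) by (simp add: scaleR_add_right field_simps)
  also have "\<dots> = 0" using assms(4) by simp
  finally show ?thesis using assms unfolding closed_segment_def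
    by (intro CollectI exI[of _ "\<beta> / (\<alpha> + \<beta>)"]) auto
qed

text \<open>Models the values of one form at the vertices of a triangle with edges in
  \<open>M\<close>. Only real convex combinations occur, so barycentric coordinates of the zero take
  the place of planar geometry.\<close>

locale open_triple =
  fixes a b c :: "'a::real_vector"
  assumes ab: "0 \<notin> closed_segment a b" and bc: "0 \<notin> closed_segment b c"
    and ca: "0 \<notin> closed_segment c a"
begin

lemma zero_combination_pos:
  assumes "\<alpha> \<ge> 0" "\<beta> \<ge> 0" "\<gamma> \<ge> 0" "\<alpha> + \<beta> + \<gamma> > 0" "\<alpha> *\<^sub>R a + \<beta> *\<^sub>R b + \<gamma> *\<^sub>R c = 0"
  shows "\<alpha> > 0" "\<beta> > 0" "\<gamma> > 0"
proof -
  have "\<gamma> \<noteq> 0" using zero_in_segment_combination[of \<alpha> \<beta> a b] assms ab by auto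
  moreover have "\<alpha> \<noteq> 0" using zero_in_segment_combination[of \<beta> \<gamma> b c] assms bc by auto
  moreover have "\<beta> \<noteq> 0" using zero_in_segment_combination[of \<gamma> \<alpha> c a] assms ca by (auto simp: add.commute)
  ultimately show "\<alpha> > 0" "\<beta> > 0" "\<gamma> > 0" using assms by auto
qed

text \<open>Subtract from the second combination the largest multiple \<open>k\<close> of the first
  that leaves nonnegative coefficients. One coefficient is then 0, which is possible only if all
  are. So a form has at most one zero in a triangle with edges in \<open>M\<close>.\<close>

lemma zero_combination_unique:
  assumes 1: "\<alpha> \<ge> 0" "\<beta> \<ge> 0" "\<gamma> \<ge> 0" "\<alpha> + \<beta> + \<gamma> = 1" "\<alpha> *\<^sub>R a + \<beta> *\<^sub>R b + \<gamma> *\<^sub>R c = 0"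
    and 2: "\<alpha>' \<ge> 0" "\<beta>' \<ge> 0" "\<gamma>' \<ge> 0" "\<alpha>' + \<beta>' + \<gamma>' = 1" "\<alpha>' *\<^sub>R a + \<beta>' *\<^sub>R b + \<gamma>' *\<^sub>R c = 0"
  shows "\<alpha> = \<alpha>' \<and> \<beta> = \<beta>' \<and> \<gamma> = \<gamma>'"
proof -
  have p: "\<alpha> > 0" "\<beta> > 0" "\<gamma> > 0" using zero_combination_pos[of \<alpha> \<beta> \<gamma>] 1 by auto
  define k where "k = min (\<alpha>' / \<alpha>) (min (\<beta>' / \<beta>) (\<gamma>' / \<gamma>))"
  have k: "k \<le> \<alpha>' / \<alpha>" "k \<le> \<beta>' / \<beta>" "k \<le> \<gamma>' / \<gamma>" by (auto simp: k_def)
  then have nn: "\<alpha>' - k * \<alpha> \<ge> 0" "\<beta>' - k * \<beta> \<ge> 0" "\<gamma>' - k * \<gamma> \<ge> 0"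
    using p by (auto simp: field_simps)
  have z: "\<alpha>' - k * \<alpha> = 0 \<or> \<beta>' - k * \<beta> = 0 \<or> \<gamma>' - k * \<gamma> = 0"
    using p unfolding k_def min_def by auto
  have "(\<alpha>' - k * \<alpha>) *\<^sub>R a + (\<beta>' - k * \<beta>) *\<^sub>R b + (\<gamma>' - k * \<gamma>) *\<^sub>R c =
    (\<alpha>' *\<^sub>R a + \<beta>' *\<^sub>R b + \<gamma>' *\<^sub>R c) - k *\<^sub>R (\<alpha> *\<^sub>R a + \<beta> *\<^sub>R b + \<gamma> *\<^sub>R c)"
    by (simp add: scaleR_diff_left scaleR_add_right algebra_simps)
  also have "\<dots> = 0" using 1 2 by simp
  finally have "\<not> (\<alpha>' - k * \<alpha>) + (\<beta>' - k * \<beta>) + (\<gamma>' - k * \<gamma>) > 0"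
    using zero_combination_pos[OF nn] z by fastforce
  with nn have e: "\<alpha>' - k * \<alpha> = 0" "\<beta>' - k * \<beta> = 0" "\<gamma>' - k * \<gamma> = 0" by linarith+
  then have "k * (\<alpha> + \<beta> + \<gamma>) = 1" using 2(4) by (simp add: algebra_simps)
  then have "k = 1" using 1(4) by simp
  then show ?thesis using e by simp
qed

text \<open>The point \<open>c\<close> lies in the sector opposite to \<open>a\<close> and
  \<open>b\<close>, and so does \<open>- s *\<^sub>R (a + b)\<close>; a cone vertex with this value
  keeps the origin out of the face over \<open>b\<close> and \<open>c\<close>, and by symmetry out
  of that over \<open>a\<close> and \<open>c\<close>. In the proof, eliminating \<open>c\<close>
  leaves \<open>x *\<^sub>R a = y *\<^sub>R b\<close> with \<open>x \<ge> 0\<close>, which puts the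
  origin on a side of the triple whatever the sign of \<open>y\<close>.\<close>

lemma zero_not_in_hull_reflected:
  assumes p: "\<alpha> > 0" "\<beta> > 0" "\<gamma> > 0" and z: "\<alpha> *\<^sub>R a + \<beta> *\<^sub>R b + \<gamma> *\<^sub>R c = 0" and s: "s > 0"
  shows "0 \<notin> convex hull {- s *\<^sub>R (a + b), b, c}"
proof
  assume "0 \<in> convex hull {- s *\<^sub>R (a + b), b, c}"
  then obtain l m n where lmn: "l \<ge> 0" "m \<ge> 0" "n \<ge> 0" "l + m + n = 1"
    "l *\<^sub>R (- s *\<^sub>R (a + b)) + m *\<^sub>R b + n *\<^sub>R c = 0"
    unfolding convex_hull_3 by auto
  define x y where "x = l * s * \<gamma> + n * \<alpha>" and "y = m * \<gamma> - l * s * \<gamma> - n * \<beta>"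
  have gc: "\<gamma> *\<^sub>R c = - (\<alpha> *\<^sub>R a + \<beta> *\<^sub>R b)" using z by (metis add.commute add_eq_0_iff)
  have "\<gamma> *\<^sub>R (l *\<^sub>R (- s *\<^sub>R (a + b)) + m *\<^sub>R b + n *\<^sub>R c) =
      (- l * s * \<gamma>) *\<^sub>R a + (m * \<gamma> - l * s * \<gamma>) *\<^sub>R b + n *\<^sub>R (\<gamma> *\<^sub>R c)"
    by (simp add: scaleR_add_right scaleR_diff_left algebra_simps)
  then have "(- l * s * \<gamma>) *\<^sub>R a + (m * \<gamma> - l * s * \<gamma>) *\<^sub>R b + n *\<^sub>R (\<gamma> *\<^sub>R c) = 0"
    using lmn(5) by simp
  then have xy: "x *\<^sub>R a = y *\<^sub>R b"
    unfolding gc x_def y_def by (simp add: scaleR_add_right scaleR_add_left scaleR_diff_left algebra_simps)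
  have x0: "x \<ge> 0" using p s lmn by (simp add: x_def)
  show False
  proof (cases "x = 0")
    case True
    have "l * s * \<gamma> \<ge> 0" "n * \<alpha> \<ge> 0" using p s lmn by auto
    with True have "l * s * \<gamma> = 0" "n * \<alpha> = 0" unfolding x_def by linarith+
    then have "l = 0" "n = 0" using p s by auto
    then have "b = 0" using lmn by simp
    then show False using ab by auto
  next
    case False
    with x0 have x: "x > 0" by simp
    show False
    proof (cases "y \<le> 0")
      case True
      have "x *\<^sub>R a + (- y) *\<^sub>R b = 0" using xy by simp
      then show False using zero_in_segment_combination[of x "- y" a b] True x ab by auto
    next
      case False
      have "a = (1 / x) *\<^sub>R (x *\<^sub>R a)" using x by simp
      then have "a = (y / x) *\<^sub>R b" using xy by simp
      then have "(\<alpha> * (y / x) + \<beta>) *\<^sub>R b + \<gamma> *\<^sub>R c = 0" using z by (simp add: scaleR_add_left)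
      moreover have "\<alpha> * (y / x) > 0" using False x p by simp
      ultimately show False
        using zero_in_segment_combination[of "\<alpha> * (y / x) + \<beta>" \<gamma> b c] bc p by auto
    qed
  qed
qed

end

text \<open>The coefficients are the barycentric coordinates of the zeros of two forms in one
  triangle; \<open>p\<close> and \<open>p'\<close> are the values of the forms at the midpoint of
  these zeros. If both zeros lay in the face over the first two vertices, with weights
  \<open>l\<close> and \<open>l'\<close> at the midpoint, adding the third coordinates would give
  \<open>l + l' = 2\<close>. Then both weights are 1, and both zeros equal the midpoint.\<close>

lemma midpoint_separates:
  assumes 1: "open_triple a b c" "\<alpha> \<ge> 0" "\<beta> \<ge> 0" "\<gamma> \<ge> 0" "\<alpha> + \<beta> + \<gamma> = 1"
      "\<alpha> *\<^sub>R a + \<beta> *\<^sub>R b + \<gamma> *\<^sub>R c = 0"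
    and 2: "open_triple a' b' c'" "\<alpha>' \<ge> 0" "\<beta>' \<ge> 0" "\<gamma>' \<ge> 0" "\<alpha>' + \<beta>' + \<gamma>' = 1"
      "\<alpha>' *\<^sub>R a' + \<beta>' *\<^sub>R b' + \<gamma>' *\<^sub>R c' = 0"
    and ne: "\<not> (\<alpha> = \<alpha>' \<and> \<beta> = \<beta>' \<and> \<gamma> = \<gamma>')"
    and p: "p = ((\<alpha> + \<alpha>') / 2) *\<^sub>R a + ((\<beta> + \<beta>') / 2) *\<^sub>R b + ((\<gamma> + \<gamma>') / 2) *\<^sub>R c"
    and p': "p' = ((\<alpha> + \<alpha>') / 2) *\<^sub>R a' + ((\<beta> + \<beta>') / 2) *\<^sub>R b' + ((\<gamma> + \<gamma>') / 2) *\<^sub>R c'"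
    and h1: "0 \<in> convex hull {p, a, b}" and h2: "0 \<in> convex hull {p', a', b'}"
  shows False
proof -
  have key: "\<exists>l m n. l \<ge> 0 \<and> m \<ge> 0 \<and> n \<ge> 0 \<and> l + m + n = 1 \<and>
      u = l * ((\<alpha> + \<alpha>') / 2) + m \<and> v = l * ((\<beta> + \<beta>') / 2) + n \<and> w = l * ((\<gamma> + \<gamma>') / 2)"
    if h: "0 \<in> convex hull {q, x, y}" and t: "open_triple x y z" "u \<ge> 0" "v \<ge> 0" "w \<ge> 0" "u + v + w = 1"
        "u *\<^sub>R x + v *\<^sub>R y + w *\<^sub>R z = 0"
      and q: "q = ((\<alpha> + \<alpha>') / 2) *\<^sub>R x + ((\<beta> + \<beta>') / 2) *\<^sub>R y + ((\<gamma> + \<gamma>') / 2) *\<^sub>R z"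
    for q x y z :: "'c::real_vector" and u v w
  proof -
    obtain l m n where lmn: "l \<ge> 0" "m \<ge> 0" "n \<ge> 0" "l + m + n = 1" "l *\<^sub>R q + m *\<^sub>R x + n *\<^sub>R y = 0"
      using h unfolding convex_hull_3 by auto
    define A B C where "A = l * ((\<alpha> + \<alpha>') / 2) + m" and "B = l * ((\<beta> + \<beta>') / 2) + n"
      and "C = l * ((\<gamma> + \<gamma>') / 2)"
    have "A + B + C = l * ((\<alpha> + \<beta> + \<gamma> + (\<alpha>' + \<beta>' + \<gamma>')) / 2) + m + n"
      by (simp add: A_def B_def C_def algebra_simps add_divide_distrib)
    also have "\<dots> = 1" using 1(5) 2(5) lmn(4) by simp
    finally have s: "A + B + C = 1" .
    have nn: "A \<ge> 0" "B \<ge> 0" "C \<ge> 0" using lmn 1 2 by (auto simp: A_def B_def C_def)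
    have "A *\<^sub>R x + B *\<^sub>R y + C *\<^sub>R z = l *\<^sub>R q + m *\<^sub>R x + n *\<^sub>R y"
      unfolding A_def B_def C_def q by (simp add: scaleR_add_right scaleR_add_left algebra_simps)
    also have "\<dots> = 0" by (rule lmn)
    finally have "u = A \<and> v = B \<and> w = C"
      using open_triple.zero_combination_unique[OF t nn s] by simp
    then show ?thesis using lmn unfolding A_def B_def C_def by blast
  qed
  from key[OF h1 1 p] obtain l m n where l: "l \<ge> 0" "m \<ge> 0" "n \<ge> 0" "l + m + n = 1"
      "\<alpha> = l * ((\<alpha> + \<alpha>') / 2) + m" "\<beta> = l * ((\<beta> + \<beta>') / 2) + n" "\<gamma> = l * ((\<gamma> + \<gamma>') / 2)" by blast
  from key[OF h2 2 p'] obtain l' m' n' where l': "l' \<ge> 0" "m' \<ge> 0" "n' \<ge> 0" "l' + m' + n' = 1"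
      "\<alpha>' = l' * ((\<alpha> + \<alpha>') / 2) + m'" "\<beta>' = l' * ((\<beta> + \<beta>') / 2) + n'" "\<gamma>' = l' * ((\<gamma> + \<gamma>') / 2)" by blast
  have "\<gamma> > 0" "\<gamma>' > 0" using open_triple.zero_combination_pos[OF 1(1-4)] open_triple.zero_combination_pos[OF 2(1-4)] 1 2 by auto
  moreover have "(\<gamma> + \<gamma>') = ((l + l') / 2) * (\<gamma> + \<gamma>')"
    using l(7) l'(7) by (simp add: algebra_simps add_divide_distrib)
  ultimately have "(l + l') / 2 = 1" by (metis add_pos_pos less_irrefl mult_cancel_right2)
  then have "l + l' = 2" by simp
  then have "l = 1" "l' = 1" using l(1-4) l'(1-4) by linarith+
  then have "m = 0" "n = 0" "m' = 0" "n' = 0" using l(1-4) l'(1-4) by linarith+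
  then show False using l l' \<open>l = 1\<close> \<open>l' = 1\<close> ne by auto
qed

text \<open>Moving one vertex moves a convex combination by at most the same distance, and the
  compact hull has positive distance from the origin.\<close>

lemma zero_not_in_hull_near:
  fixes p a b :: "'a::euclidean_space"
  assumes "0 \<notin> convex hull {p, a, b}"
  obtains d where "d > 0" "\<And>q. dist q p < d \<Longrightarrow> 0 \<notin> convex hull {q, a, b}"
proof -
  have "closed (convex hull {p, a, b})"
    by (intro compact_imp_closed compact_convex_hull finite_imp_compact) auto
  then obtain d where d: "d > 0" "\<And>x. x \<in> convex hull {p, a, b} \<Longrightarrow> d \<le> dist 0 x"
    using separate_point_closed assms by meson
  have "0 \<notin> convex hull {q, a, b}" if q: "dist q p < d" for q
  proof
    assume "0 \<in> convex hull {q, a, b}"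
    then obtain l m n where lmn: "l \<ge> 0" "m \<ge> 0" "n \<ge> 0" "l + m + n = 1" "l *\<^sub>R q + m *\<^sub>R a + n *\<^sub>R b = 0"
      unfolding convex_hull_3 by auto
    have "l *\<^sub>R p + m *\<^sub>R a + n *\<^sub>R b \<in> convex hull {p, a, b}"
      using lmn unfolding convex_hull_3 by auto
    then have "d \<le> norm (l *\<^sub>R p + m *\<^sub>R a + n *\<^sub>R b)" using d(2) by force
    also have "l *\<^sub>R p + m *\<^sub>R a + n *\<^sub>R b = l *\<^sub>R (p - q)"
      using lmn(5) by (simp add: scaleR_diff_right algebra_simps)
    also have "norm \<dots> \<le> 1 * dist q p"
      using lmn by (simp add: dist_norm norm_minus_commute mult_left_le_one_le)
    finally show False using q by simp
  qed
  then show ?thesis using that d(1) by blast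
qed

section \<open>Characters on paths in the complement of an arrangement\<close>

lemma vector_smult_of_real: "complex_of_real r *s (x :: complex ^ 'n) = r *\<^sub>R x"
  by (simp add: vec_eq_iff) (simp add: scaleR_conv_of_real)

lemma continuous_on_vector_smult [continuous_intros]:
  fixes w :: "_ \<Rightarrow> complex"
  shows "continuous_on S w \<Longrightarrow> continuous_on S v \<Longrightarrow> continuous_on S (\<lambda>t. w t *s v t)"
  unfolding vector_scalar_mult_def by (intro continuous_intros)

lemma norm_vector_smult: "norm (c *s x :: complex ^ 'n) = norm c * norm x"
  by (simp add: norm_vec_def norm_mult L2_set_right_distrib)

section \<open>Generic points and connectedness in complements of hyperplanes\<close>

locale hyperplane_forms =
  fixes A :: "'i set" and f :: "'i \<Rightarrow> complex ^ 'n \<Rightarrow> complex" and v0 :: "complex ^ 'n"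
  assumes fin: "finite A"
    and f_add: "K \<in> A \<Longrightarrow> f K (x + y) = f K x + f K y"
    and f_smult: "K \<in> A \<Longrightarrow> f K (c *s x) = c * f K x"
    and f_indep: "H \<in> A \<Longrightarrow> K \<in> A \<Longrightarrow> H \<noteq> K \<Longrightarrow> \<exists>d. f H d = 0 \<and> f K d \<noteq> 0"
    and v0: "K \<in> A \<Longrightarrow> f K v0 \<noteq> 0"
begin

definition M :: "(complex ^ 'n) set"
  where "M = {z. \<forall>K\<in>A. f K z \<noteq> 0}"

lemma f_scaleR: "K \<in> A \<Longrightarrow> f K (r *\<^sub>R x) = r *\<^sub>R f K x"
  using f_smult[of K "complex_of_real r" x] by (simp add: vector_smult_of_real scaleR_conv_of_real)

lemma f_linear: "K \<in> A \<Longrightarrow> linear (f K)"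
  by (intro linearI) (auto simp: f_add f_scaleR)

lemma f_continuous: "K \<in> A \<Longrightarrow> continuous_on S (f K)"
  using f_linear linear_continuous_on linear_conv_bounded_linear by blast

lemma v0_in_M: "v0 \<in> M"
  using v0 by (simp add: M_def)

lemma open_M: "open M"
proof -
  have "M = (\<Inter>K\<in>A. f K -` (- {0}))" by (auto simp: M_def)
  moreover have "open (f K -` (- {0}))" if "K \<in> A" for K
    using f_continuous[OF that, of UNIV] by (intro open_vimage) auto
  ultimately show ?thesis using fin by auto
qed

lemma f_segment: "K \<in> A \<Longrightarrow> f K ` closed_segment x y = closed_segment (f K x) (f K y)"
  by (simp add: closed_segment_linear_image f_linear)

lemma f_hull: "K \<in> A \<Longrightarrow> f K ` (convex hull {x, y, z}) = convex hull {f K x, f K y, f K z}"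
  using convex_hull_linear_image[OF f_linear, of K "{x, y, z}"] by simp

lemma segment_in_M: "closed_segment x y \<subseteq> M \<longleftrightarrow> (\<forall>K\<in>A. 0 \<notin> closed_segment (f K x) (f K y))"
proof -
  have "closed_segment x y \<subseteq> M \<longleftrightarrow> (\<forall>K\<in>A. 0 \<notin> f K ` closed_segment x y)"
    unfolding M_def by (auto simp: image_iff)
  then show ?thesis using f_segment by auto
qed

lemma hull_in_M: "convex hull {x, y, z} \<subseteq> M \<longleftrightarrow> (\<forall>K\<in>A. 0 \<notin> convex hull {f K x, f K y, f K z})"
proof -
  have "convex hull {x, y, z} \<subseteq> M \<longleftrightarrow> (\<forall>K\<in>A. 0 \<notin> f K ` (convex hull {x, y, z}))"
    unfolding M_def by (auto simp: image_iff)
  then show ?thesis using f_hull by auto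
qed

text \<open>For one pair \<open>K\<close>, \<open>x\<close> the points of \<open>V\<close> whose
  segment to \<open>x\<close> avoids the zeros of \<open>f K\<close> are open and dense in
  \<open>V\<close>, so finitely many pairs can be treated at once. The subspace \<open>V\<close> is
  the whole space when visibility in \<open>M\<close> is at stake, and a hyperplane when its generic
  part is to be connected.\<close>

lemma generic_point:
  assumes V: "vec.subspace V" "closed V" and B: "B \<subseteq> A" and X: "finite X" "X \<subseteq> V"
    and nz: "\<And>x K. x \<in> X \<Longrightarrow> K \<in> B \<Longrightarrow> f K x \<noteq> 0" and p: "p \<in> V" and e: "e > 0"
  obtains z where "z \<in> V" "dist z p < e" "\<And>x K. x \<in> X \<Longrightarrow> K \<in> B \<Longrightarrow> 0 \<notin> closed_segment (f K z) (f K x)"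
proof -
  define G where "G = (\<lambda>(K, x). {z \<in> V. f K z / f K x \<notin> \<real>\<^sub>\<le>\<^sub>0}) ` (B \<times> X)"
  have "V \<subseteq> closure (\<Inter>G)"
  proof (rule Baire[OF V(2)])
    show "countable G" unfolding G_def using fin B X(1)
      by (intro countable_finite finite_imageI finite_cartesian_product) (auto intro: finite_subset)
    fix T assume "T \<in> G"
    then obtain K x where K: "K \<in> B" "x \<in> X" and T: "T = {z \<in> V. f K z / f K x \<notin> \<real>\<^sub>\<le>\<^sub>0}"
      by (auto simp: G_def)
    have KA: "K \<in> A" using K B by auto
    have "continuous_on V (\<lambda>z. f K z / f K x)"
      using nz K by (intro continuous_intros f_continuous KA) auto
    then have "openin (top_of_set V) (V \<inter> (\<lambda>z. f K z / f K x) -` (- \<real>\<^sub>\<le>\<^sub>0))"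
      by (intro continuous_openin_preimage_gen) auto
    moreover have "T = V \<inter> (\<lambda>z. f K z / f K x) -` (- \<real>\<^sub>\<le>\<^sub>0)" unfolding T by auto
    ultimately have "openin (top_of_set V) T" by simp
    moreover have "V \<subseteq> closure T"
    proof
      fix z assume z: "z \<in> V"
      show "z \<in> closure T" unfolding closure_approachable
      proof clarify
        fix e :: real assume e: "e > 0"
        show "\<exists>y\<in>T. dist y z < e"
        proof (cases "f K z / f K x \<in> \<real>\<^sub>\<le>\<^sub>0")
          case False
          then show ?thesis using z e T by (intro bexI[of _ z]) auto
        next
          case True
          define d where "d = e / (2 * (norm x + 1))"
          have d: "d > 0" using e by (simp add: d_def add_nonneg_pos)
          \<comment> \<open>This shift adds \<open>\<i> * of_real d\<close> to the quotient, a
            nonpositive real number, and so moves it off the slit.\<close>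
          define y where "y = z + (\<i> * of_real d) *s x"
          have "y \<in> V" unfolding y_def using z X K V(1)
            by (intro vec.subspace_add vec.subspace_scale) auto
          moreover have "f K y / f K x = f K z / f K x + \<i> * of_real d"
            using nz[OF K(2,1)] by (simp add: y_def f_add f_smult KA add_divide_distrib)
          then have "f K y / f K x \<notin> \<real>\<^sub>\<le>\<^sub>0"
            using True d by (auto simp: complex_nonpos_Reals_iff)
          ultimately have "y \<in> T" by (simp add: T)
          moreover have "dist y z < e"
          proof -
            have "dist y z = d * norm x"
              using d by (simp add: y_def dist_norm norm_vector_smult norm_mult)
            also have "\<dots> \<le> d * (norm x + 1)" using d by simp
            also have "\<dots> = e / 2"
              unfolding d_def by (simp add: field_simps add_nonneg_eq_0_iff)
            finally show ?thesis using e by simp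
          qed
          ultimately show ?thesis by blast
        qed
      qed
    qed
    ultimately show "openin (top_of_set V) T \<and> V \<subseteq> closure T" by blast
  qed
  then have "p \<in> closure (V \<inter> \<Inter>G)"
  \<comment> \<open>The intersection of the empty family is \<open>UNIV\<close> and not
    \<open>V\<close>.\<close>
  proof (cases "G = {}")
    case True
    then show ?thesis using p closure_subset by fastforce
  next
    case False
    then have "V \<inter> \<Inter>G = \<Inter>G" by (auto simp: G_def)
    then show ?thesis using p \<open>V \<subseteq> closure (\<Inter>G)\<close> by auto
  qed
  then obtain z where z: "z \<in> V" "z \<in> \<Inter>G" "dist z p < e"
    using e unfolding closure_approachable by blast
  have "0 \<notin> closed_segment (f K z) (f K x)" if "x \<in> X" "K \<in> B" for x K
  proof -
    have "f K z / f K x \<notin> \<real>\<^sub>\<le>\<^sub>0" using z(2) that by (auto simp: G_def)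
    then show ?thesis using zero_in_segment_iff nz that by blast
  qed
  then show ?thesis using z that by blast
qed

text \<open>Allows any desired cone vertex \<open>p\<close> to be replaced by a nearby point from
  which all of \<open>X\<close> is visible within \<open>M\<close>.\<close>

lemma visible_point:
  assumes X: "finite X" "X \<subseteq> M" "X \<noteq> {}" and e: "e > 0"
  obtains z where "z \<in> M" "dist z p < e" "\<And>x. x \<in> X \<Longrightarrow> closed_segment x z \<subseteq> M"
proof -
  obtain z where z: "dist z p < e" "\<And>x K. x \<in> X \<Longrightarrow> K \<in> A \<Longrightarrow> 0 \<notin> closed_segment (f K z) (f K x)"
    by (rule generic_point[of UNIV A X p e]) (use X e in \<open>auto simp: M_def vec.subspace_UNIV\<close>)
  have s: "closed_segment x z \<subseteq> M" if "x \<in> X" for x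
    using z(2)[OF that] unfolding segment_in_M by (metis closed_segment_commute)
  then have "z \<in> M" using X(3) by fastforce
  then show ?thesis using z(1) s that by blast
qed

text \<open>Two segments through a generic third point join any two points. With a hyperplane as
  \<open>V\<close>, this makes all meridians of that hyperplane comparable.\<close>

lemma path_connected_forms:
  assumes V: "vec.subspace V" "closed V" and B: "B \<subseteq> A"
  shows "path_connected {z \<in> V. \<forall>K\<in>B. f K z \<noteq> 0}" (is "path_connected ?C")
proof -
  have conv: "convex V"
    using V(1) vec.subspace_add vec.subspace_scale unfolding convex_def by (metis vector_smult_of_real)
  show ?thesis unfolding path_connected_def
  proof clarify
    fix x y assume x: "x \<in> V" "\<forall>K\<in>B. f K x \<noteq> 0" and y: "y \<in> V" "\<forall>K\<in>B. f K y \<noteq> 0"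
    obtain z where z: "z \<in> V" "\<And>w K. w \<in> {x, y} \<Longrightarrow> K \<in> B \<Longrightarrow> 0 \<notin> closed_segment (f K z) (f K w)"
      by (rule generic_point[OF V B, of "{x, y}" x 1]) (use x y in auto)
    have seg: "closed_segment z w \<subseteq> ?C" if "w \<in> {x, y}" for w
    proof -
      have "closed_segment z w \<subseteq> V" using conv z(1) that x(1) y(1) by (intro closed_segment_subset) auto
      moreover have "f K u \<noteq> 0" if "u \<in> closed_segment z w" "K \<in> B" for u K
        using z(2)[OF \<open>w \<in> {x, y}\<close> \<open>K \<in> B\<close>] f_segment[of K z w] that B by (metis image_eqI subsetD)
      ultimately show ?thesis by blast
    qed
    show "\<exists>g. path g \<and> path_image g \<subseteq> ?C \<and> pathstart g = x \<and> pathfinish g = y"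
      using seg[of x] seg[of y]
      by (intro exI[of _ "linepath x z +++ linepath z y"])
         (auto simp: path_image_join closed_segment_commute)
  qed
qed

lemma path_connected_M: "path_connected M"
  using path_connected_forms[of UNIV A] by (simp add: M_def vec.subspace_UNIV)

end

text \<open>A character of the fundamental groupoid of \<open>M\<close>, on paths instead of homotopy classes.\<close>

locale path_character = hyperplane_forms A f v0
  for A :: "'i set" and f :: "'i \<Rightarrow> complex ^ 'n \<Rightarrow> complex" and v0 :: "complex ^ 'n" +
  fixes \<Phi> :: "(real \<Rightarrow> complex ^ 'n) \<Rightarrow> complex"
  assumes \<Phi>_join: "path g \<Longrightarrow> path_image g \<subseteq> M \<Longrightarrow> path h \<Longrightarrow> path_image h \<subseteq> M \<Longrightarrow>
      pathfinish g = pathstart h \<Longrightarrow> \<Phi> (g +++ h) = \<Phi> g * \<Phi> h"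
    and \<Phi>_homotopic: "homotopic_paths M g h \<Longrightarrow> \<Phi> g = \<Phi> h"
    and \<Phi>_nonzero: "path g \<Longrightarrow> path_image g \<subseteq> M \<Longrightarrow> \<Phi> g \<noteq> 0"
begin

lemma \<Phi>_const: "x \<in> M \<Longrightarrow> \<Phi> (linepath x x) = 1"
proof -
  assume x: "x \<in> M"
  have "homotopic_paths M (linepath x x +++ linepath x x) (linepath x x)"
    using homotopic_paths_rid[of "linepath x x" M] x by simp
  then have "\<Phi> (linepath x x) * \<Phi> (linepath x x) = \<Phi> (linepath x x)"
    using \<Phi>_join[of "linepath x x" "linepath x x"] \<Phi>_homotopic x by simp
  then show ?thesis using \<Phi>_nonzero[of "linepath x x"] x by simp
qed

lemma \<Phi>_reverse:
  assumes "path g" "path_image g \<subseteq> M"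
  shows "\<Phi> g * \<Phi> (reversepath g) = 1"
proof -
  have "\<Phi> (g +++ reversepath g) = \<Phi> (linepath (pathstart g) (pathstart g))"
    by (intro \<Phi>_homotopic homotopic_paths_rinv assms)
  also have "\<dots> = 1" using assms by (intro \<Phi>_const) auto
  finally show ?thesis using \<Phi>_join[of g "reversepath g"] assms by simp
qed

lemma \<Phi>_convex_loop:
  assumes "convex C" "C \<subseteq> M" "path g" "path_image g \<subseteq> C" "pathfinish g = pathstart g"
  shows "\<Phi> g = 1"
proof -
  have "closed_segment (g t) (linepath (pathstart g) (pathstart g) t) \<subseteq> M" if "t \<in> {0..1}" for t
  proof -
    have "g t \<in> C" "pathstart g \<in> C"
      using assms(4) that pathstart_in_path_image[of g] by (auto simp: path_image_def)
    then show ?thesis using assms(1,2) by (metis closed_segment_subset linepath_refl subset_trans)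
  qed
  then have "homotopic_paths M g (linepath (pathstart g) (pathstart g))"
    using assms by (intro homotopic_paths_linear) auto
  then show ?thesis using \<Phi>_homotopic \<Phi>_const assms by (metis pathstart_in_path_image subsetD)
qed

text \<open>The two ways around the unit square from \<open>(0,0)\<close> to \<open>(1,1)\<close>
  have equal values. Both contain the track of the base point as a factor; it cancels because the
  values are nonzero and commute.\<close>

lemma \<Phi>_homotopic_loops:
  assumes "homotopic_loops M g h"
  shows "\<Phi> g = \<Phi> h"
proof -
  obtain F :: "real \<times> real \<Rightarrow> complex ^ 'n" where F: "continuous_on ({0..1} \<times> {0..1}) F"
      "F \<in> {0..1} \<times> {0..1} \<rightarrow> M"
    and F0: "\<forall>x\<in>{0..1}. F (0, x) = g x" and F1: "\<forall>x\<in>{0..1}. F (1, x) = h x"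
    and Fe: "\<forall>s\<in>{0..1}. pathfinish (F \<circ> Pair s) = pathstart (F \<circ> Pair s)"
    using assms unfolding homotopic_loops by blast
  define Q where "Q = {0..1::real} \<times> {0..1::real}"
  have cQ: "convex Q" unfolding Q_def by (intro convex_Times) auto
  have corner: "(0,0) \<in> Q" "(0,1) \<in> Q" "(1,0) \<in> Q" "(1,1) \<in> Q" by (auto simp: Q_def)
  define l where "l = (\<lambda>a b. linepath a (b::real \<times> real))"
  have lQ: "path (l a b)" "path_image (l a b) \<subseteq> Q" if "a \<in> Q" "b \<in> Q" for a b
    using closed_segment_subset[OF that cQ] by (simp_all add: l_def)
  have l_ends: "pathstart (l a b) = a" "pathfinish (l a b) = b" for a b by (simp_all add: l_def)
  have Fl: "path (F \<circ> l a b)" "path_image (F \<circ> l a b) \<subseteq> M" if "a \<in> Q" "b \<in> Q" for a b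
  proof -
    show "path (F \<circ> l a b)"
      using lQ[OF that] F(1) unfolding Q_def by (meson continuous_on_subset path_continuous_image)
    show "path_image (F \<circ> l a b) \<subseteq> M"
      using lQ[OF that] F(2) unfolding path_image_compose Q_def by blast
  qed
  have "homotopic_paths Q (l (0,0) (0,1) +++ l (0,1) (1,1)) (l (0,0) (1,0) +++ l (1,0) (1,1))"
  proof (rule homotopic_paths_linear)
    fix t :: real assume t: "t \<in> {0..1}"
    have "path_image (l (0,0) (0,1) +++ l (0,1) (1,1)) \<subseteq> Q" "path_image (l (0,0) (1,0) +++ l (1,0) (1,1)) \<subseteq> Q"
      by (intro subset_path_image_join lQ corner)+
    then show "closed_segment ((l (0,0) (0,1) +++ l (0,1) (1,1)) t) ((l (0,0) (1,0) +++ l (1,0) (1,1)) t) \<subseteq> Q"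
      using t by (intro closed_segment_subset cQ) (auto simp: path_image_def)
  qed (auto simp: l_def)
  then have "homotopic_paths M (F \<circ> (l (0,0) (0,1) +++ l (0,1) (1,1))) (F \<circ> (l (0,0) (1,0) +++ l (1,0) (1,1)))"
    using F unfolding Q_def by (rule homotopic_paths_continuous_image)
  then have "\<Phi> ((F \<circ> l (0,0) (0,1)) +++ (F \<circ> l (0,1) (1,1))) = \<Phi> ((F \<circ> l (0,0) (1,0)) +++ (F \<circ> l (1,0) (1,1)))"
    using \<Phi>_homotopic by (simp add: path_compose_join)
  moreover have "\<Phi> ((F \<circ> l a b) +++ (F \<circ> l b c)) = \<Phi> (F \<circ> l a b) * \<Phi> (F \<circ> l b c)"
    if "a \<in> Q" "b \<in> Q" "c \<in> Q" for a b c
    by (intro \<Phi>_join Fl that) (simp add: pathfinish_compose pathstart_compose l_ends)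
  ultimately have eq: "\<Phi> (F \<circ> l (0,0) (0,1)) * \<Phi> (F \<circ> l (0,1) (1,1)) = \<Phi> (F \<circ> l (0,0) (1,0)) * \<Phi> (F \<circ> l (1,0) (1,1))"
    by (simp only: corner)
  have l_eq: "l (a, b) (c, d) t = ((1 - t) * a + t * c, (1 - t) * b + t * d)" for a b c d t
    by (simp add: l_def linepath_def)
  have congr: "\<Phi> (F \<circ> l a b) = \<Phi> q" if "a \<in> Q" "b \<in> Q" "\<And>t. t \<in> {0..1} \<Longrightarrow> F (l a b t) = q t" for a b q
    by (rule \<Phi>_homotopic[OF homotopic_paths_eq[OF Fl[OF that(1,2)]]]) (use that(3) in simp)
  have "\<Phi> (F \<circ> l (0,0) (0,1)) = \<Phi> g"
    by (rule congr) (use F0 corner in \<open>simp_all add: l_eq\<close>)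
  moreover have "\<Phi> (F \<circ> l (1,0) (1,1)) = \<Phi> h"
    by (rule congr) (use F1 corner in \<open>simp_all add: l_eq\<close>)
  moreover have "\<Phi> (F \<circ> l (0,1) (1,1)) = \<Phi> (F \<circ> l (0,0) (1,0))"
    by (rule congr) (use Fe corner in \<open>simp_all add: l_eq pathfinish_def pathstart_def\<close>)
  moreover have "\<Phi> (F \<circ> l (0,0) (1,0)) \<noteq> 0"
    by (intro \<Phi>_nonzero Fl corner)
  ultimately show ?thesis using eq by simp
qed

end

section \<open>Triangle paths and their winding numbers\<close>

definition triangle_path :: "'a::real_normed_vector \<Rightarrow> 'a \<Rightarrow> 'a \<Rightarrow> real \<Rightarrow> 'a"
  where "triangle_path x y z = linepath x y +++ linepath y z +++ linepath z x"

lemma triangle_path_simps [simp]: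
  "pathstart (triangle_path x y z) = x" "pathfinish (triangle_path x y z) = x"
  by (simp_all add: triangle_path_def)

lemma path_triangle_path [simp]: "path (triangle_path x y z)"
  by (simp add: triangle_path_def)

lemma path_image_triangle_path:
  "path_image (triangle_path x y z) = closed_segment x y \<union> closed_segment y z \<union> closed_segment z x"
  by (auto simp: triangle_path_def path_image_join)

lemma linear_compose_linepath: "linear h \<Longrightarrow> h \<circ> linepath x y = linepath (h x) (h y)"
  by (simp add: fun_eq_iff linepath_def linear_add linear_scale)

lemma linear_compose_triangle_path:
  "linear h \<Longrightarrow> h \<circ> triangle_path x y z = triangle_path (h x) (h y) (h z)"
  by (simp add: triangle_path_def path_compose_join linear_compose_linepath)

lemma winding_number_triangle_path:
  assumes "0 \<in> convex hull {a, b, c}" "open_triple a b c"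
  shows "winding_number (triangle_path a b c) 0 = 1 \<or> winding_number (triangle_path a c b) 0 = 1"
proof -
  interpret open_triple a b c by fact
  have "0 \<in> interior (convex hull {a, b, c})"
    using assms(1) ab bc ca by (simp add: interior_of_triangle)
  then have "winding_number (triangle_path a b c) 0 \<in> {1, -1}"
    unfolding triangle_path_def using winding_number_triangle by simp
  moreover have "winding_number (triangle_path a c b) 0 = - winding_number (triangle_path a b c) 0"
  proof -
    have r: "winding_number (linepath y x) 0 = - winding_number (linepath x y) 0"
      if "0 \<notin> closed_segment x y" for x y :: complex
      using winding_number_reversepath[of "linepath x y" 0] that by simp
    show ?thesis
      using ab bc ca r[OF ab] r[OF bc] r[OF ca]
      by (simp add: triangle_path_def winding_number_join not_in_path_image_join closed_segment_commute)
  qed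
  ultimately show ?thesis by auto
qed

section \<open>Meridians of the hyperplanes\<close>

context hyperplane_forms
begin

text \<open>On the compact set \<open>S\<close> each of the finitely many forms is bounded away from
  0, and on \<open>D\<close> it is bounded, so every sufficiently small \<open>\<eta>\<close> works.
  One \<open>\<eta>\<close> can thus serve all stages of a homotopy.\<close>

lemma small_displacements:
  assumes S: "compact S" and D: "compact D" and B: "B \<subseteq> A"
    and nz: "\<And>q K. q \<in> S \<Longrightarrow> K \<in> B \<Longrightarrow> f K q \<noteq> 0" and e: "e > 0"
  obtains \<eta> where "0 < \<eta>" "\<eta> < e"
    "\<And>q d K. q \<in> S \<Longrightarrow> d \<in> D \<Longrightarrow> K \<in> B \<Longrightarrow> f K (q + \<eta> *\<^sub>R d) \<noteq> 0"
proof -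
  have "\<forall>\<^sub>F \<eta> in at_right 0. \<forall>q\<in>S. \<forall>d\<in>D. f K (q + \<eta> *\<^sub>R d) \<noteq> 0" if K: "K \<in> B" for K
  proof (cases "S = {}")
    case True then show ?thesis by simp
  next
    case False
    have KA: "K \<in> A" using K B by auto
    have "continuous_on S (\<lambda>q. norm (f K q))" by (intro continuous_intros f_continuous KA)
    from continuous_attains_inf[OF S False this] obtain q0
      where q0: "q0 \<in> S" "\<And>q. q \<in> S \<Longrightarrow> norm (f K q0) \<le> norm (f K q)" by blast
    have "bounded (f K ` D)"
      by (intro compact_imp_bounded compact_continuous_image f_continuous KA D)
    then obtain b where b: "b > 0" "\<And>d. d \<in> D \<Longrightarrow> norm (f K d) \<le> b"
      unfolding bounded_pos by auto
    define m where "m = norm (f K q0)"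
    have m: "m > 0" using nz q0 K by (simp add: m_def)
    have "f K (q + \<eta> *\<^sub>R d) \<noteq> 0" if "q \<in> S" "d \<in> D" "0 < \<eta>" "\<eta> < m / b" for q d \<eta>
    proof
      assume "f K (q + \<eta> *\<^sub>R d) = 0"
      then have "f K q = - (\<eta> *\<^sub>R f K d)" by (simp add: f_add f_scaleR KA add_eq_0_iff)
      then have "norm (f K q) = \<eta> * norm (f K d)" using that by simp
      also have "\<dots> \<le> \<eta> * b" using that b by simp
      also have "\<dots> < m" using that b by (simp add: field_simps)
      finally show False using q0(2)[OF that(1)] m_def by simp
    qed
    then show ?thesis unfolding eventually_at_right_field
      using m b by (intro exI[of _ "m / b"]) auto
  qed
  then have "\<forall>\<^sub>F \<eta> in at_right 0. \<forall>K\<in>B. \<forall>q\<in>S. \<forall>d\<in>D. f K (q + \<eta> *\<^sub>R d) \<noteq> 0"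
    using fin B by (intro eventually_ball_finite) (auto intro: finite_subset)
  moreover have "\<forall>\<^sub>F \<eta> in at_right 0. 0 < \<eta> \<and> \<eta> < e"
    using e eventually_at_right_field by blast
  ultimately have "\<forall>\<^sub>F \<eta> in at_right 0. (0 < \<eta> \<and> \<eta> < e) \<and> (\<forall>K\<in>B. \<forall>q\<in>S. \<forall>d\<in>D. f K (q + \<eta> *\<^sub>R d) \<noteq> 0)"
    by (rule eventually_conj[rotated])
  then obtain \<eta> where "0 < \<eta> \<and> \<eta> < e" "\<forall>K\<in>B. \<forall>q\<in>S. \<forall>d\<in>D. f K (q + \<eta> *\<^sub>R d) \<noteq> 0"
    using eventually_happens[OF \<open>\<forall>\<^sub>F \<eta> in at_right 0. (0 < \<eta> \<and> \<eta> < e) \<and> _\<close>] trivial_limit_at_right_real by blast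
  then show ?thesis using that by blast
qed

text \<open>The scaling makes \<open>f H\<close> the coordinate \<open>w\<close> on the disc of
  points \<open>q + w *s transversal H\<close> with \<open>q\<close> on \<open>H\<close>.\<close>

definition transversal :: "'i \<Rightarrow> complex ^ 'n"
  where "transversal H = (1 / f H v0) *s v0"

lemma f_transversal [simp]: "H \<in> A \<Longrightarrow> f H (transversal H) = 1"
  using v0 by (simp add: transversal_def f_smult)

text \<open>A closed disc transverse to \<open>H\<close> that meets the arrangement in its centre
  only.\<close>

definition meridian_disc :: "'i \<Rightarrow> complex ^ 'n \<Rightarrow> real \<Rightarrow> bool"
  where "meridian_disc H q \<delta> \<longleftrightarrow> H \<in> A \<and> 0 < \<delta> \<and> f H q = 0 \<and>
    (\<forall>K\<in>A - {H}. \<forall>w. cmod w \<le> \<delta> \<longrightarrow> f K (q + w *s transversal H) \<noteq> 0)"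

definition meridian :: "'i \<Rightarrow> complex ^ 'n \<Rightarrow> real \<Rightarrow> real \<Rightarrow> complex ^ 'n"
  where "meridian H q \<delta> = (\<lambda>t. q + circlepath 0 \<delta> t *s transversal H)"

lemma meridian_disc_in_M:
  assumes "meridian_disc H q \<delta>" "0 < cmod w" "cmod w \<le> \<delta>"
  shows "q + w *s transversal H \<in> M"
proof -
  have "f K (q + w *s transversal H) \<noteq> 0" if "K \<in> A" for K
  proof (cases "K = H")
    case True
    then show ?thesis using assms by (auto simp: meridian_disc_def f_add f_smult)
  next
    case False
    then show ?thesis using assms that unfolding meridian_disc_def by blast
  qed
  then show ?thesis by (simp add: M_def)
qed

lemma compact_transversal_disc: "compact ((\<lambda>w. w *s transversal H) ` cball 0 1)"
  by (intro compact_continuous_image continuous_intros) auto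

lemma meridian_discI:
  assumes "H \<in> A" "0 < \<delta>" "f H q = 0" "\<And>K. K \<in> A - {H} \<Longrightarrow> f K q \<noteq> 0"
    "\<And>K d. K \<in> A - {H} \<Longrightarrow> d \<in> (\<lambda>w. w *s transversal H) ` cball 0 1 \<Longrightarrow> f K (q + \<delta> *\<^sub>R d) \<noteq> 0"
  shows "meridian_disc H q \<delta>"
  unfolding meridian_disc_def
proof (intro conjI ballI allI impI)
  fix K w assume K: "K \<in> A - {H}" and w: "cmod w \<le> \<delta>"
  have "w *s transversal H = \<delta> *\<^sub>R ((w / of_real \<delta>) *s transversal H)"
    using assms(2) by (simp flip: vector_smult_of_real)
  moreover have "cmod (w / of_real \<delta>) \<le> 1" using w assms(2) by (simp add: norm_divide)
  ultimately show "f K (q + w *s transversal H) \<noteq> 0"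
    using assms(5)[OF K imageI, of "w / of_real \<delta>"] by simp
qed (use assms in auto)

end

context path_character
begin

lemma \<Phi>_disc_homotopic:
  assumes "homotopic_loops C w w'" "\<And>u. u \<in> C \<Longrightarrow> q + (e * u) *s v \<in> M"
  shows "\<Phi> (\<lambda>t. q + (e * w t) *s v) = \<Phi> (\<lambda>t. q + (e * w' t) *s v)"
proof -
  have "homotopic_loops M ((\<lambda>u. q + (e * u) *s v) \<circ> w) ((\<lambda>u. q + (e * u) *s v) \<circ> w')"
    by (rule homotopic_loops_continuous_image[OF assms(1)])
       (use assms(2) in \<open>auto intro!: continuous_intros\<close>)
  then show ?thesis using \<Phi>_homotopic_loops by (simp add: o_def)
qed

lemma \<Phi>_meridian_radius:
  assumes m: "meridian_disc H q \<delta>" and d: "0 < \<delta>'" "\<delta>' \<le> \<delta>"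
  shows "\<Phi> (meridian H q \<delta>') = \<Phi> (meridian H q \<delta>)"
proof -
  let ?C = "{u. 0 < cmod u \<and> cmod u \<le> \<delta>}"
  have "homotopic_loops ?C (circlepath 0 \<delta>') (circlepath 0 \<delta>)"
  proof (rule homotopic_loops_linear)
    fix t :: real assume "t \<in> {0..1}"
    show "closed_segment (circlepath 0 \<delta>' t) (circlepath 0 \<delta> t) \<subseteq> ?C"
    proof
      fix u assume "u \<in> closed_segment (circlepath 0 \<delta>' t) (circlepath 0 \<delta> t)"
      then obtain s where s: "0 \<le> s" "s \<le> 1"
        "u = (1 - s) *\<^sub>R circlepath 0 \<delta>' t + s *\<^sub>R circlepath 0 \<delta> t"
        by (auto simp: closed_segment_def)
      have "u = of_real ((1 - s) * \<delta>' + s * \<delta>) * exp (2 * of_real pi * \<i> * of_real t)"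
        unfolding s(3) circlepath by (simp add: scaleR_conv_of_real algebra_simps)
      then have "cmod u = \<bar>(1 - s) * \<delta>' + s * \<delta>\<bar>" by (simp add: norm_mult del: of_real_add)
      moreover have "s * \<delta>' \<le> s * \<delta>" "(1 - s) * \<delta>' \<le> (1 - s) * \<delta>"
        using s d by (auto intro!: mult_left_mono)
      then have "\<delta>' \<le> (1 - s) * \<delta>' + s * \<delta>" "(1 - s) * \<delta>' + s * \<delta> \<le> \<delta>"
        by (auto simp: left_diff_distrib)
      then have "(1 - s) * \<delta>' + s * \<delta> > 0" "(1 - s) * \<delta>' + s * \<delta> \<le> \<delta>" using d by auto
      ultimately show "u \<in> ?C" by auto
    qed
  qed auto
  from \<Phi>_disc_homotopic[OF this, of q 1 "transversal H"] show ?thesis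
    using meridian_disc_in_M[OF m] by (simp add: meridian_def)
qed

text \<open>The points of \<open>H\<close> on no other hyperplane form a path-connected set, and a
  small circle can be slid along a path in it from \<open>q\<close> to \<open>q'\<close>. The path
  is compact, so a single radius \<open>\<eta>\<close> keeps all the discs away from the other
  hyperplanes. The sliding is a free homotopy.\<close>

lemma meridian_value:
  assumes m: "meridian_disc H q \<delta>" and m': "meridian_disc H q' \<delta>'"
  shows "\<Phi> (meridian H q \<delta>) = \<Phi> (meridian H q' \<delta>')"
proof -
  have H: "H \<in> A" using m by (simp add: meridian_disc_def)
  let ?V = "{z. f H z = 0}"
  let ?C = "{z \<in> ?V. \<forall>K\<in>A - {H}. f K z \<noteq> 0}"
  have "vec.subspace ?V"
    unfolding vec.subspace_def using f_smult[OF H, of 0 0] by (auto simp: f_add f_smult H)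
  moreover have "closed ?V"
    using continuous_closed_vimage[of "{0}" "f H"] f_continuous[OF H, of UNIV]
    by (auto simp: vimage_def continuous_on_eq_continuous_at)
  ultimately have "path_connected ?C" by (intro path_connected_forms) auto
  moreover have "f K q \<noteq> 0" "f K q' \<noteq> 0" if "K \<in> A - {H}" for K
    using m m' that unfolding meridian_disc_def by (auto dest!: bspec[OF _ that] spec[of _ 0])
  then have "q \<in> ?C" "q' \<in> ?C" using m m' by (auto simp: meridian_disc_def)
  ultimately obtain g where g: "path g" "path_image g \<subseteq> ?C" "pathstart g = q" "pathfinish g = q'"
    unfolding path_connected_def by meson
  let ?D = "(\<lambda>w. w *s transversal H) ` cball 0 1"
  have "min \<delta> \<delta>' > 0" using m m' by (simp add: meridian_disc_def)
  then obtain \<eta> where \<eta>: "0 < \<eta>" "\<eta> < min \<delta> \<delta>'"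
    "\<And>z d K. z \<in> path_image g \<Longrightarrow> d \<in> ?D \<Longrightarrow> K \<in> A - {H} \<Longrightarrow> f K (z + \<eta> *\<^sub>R d) \<noteq> 0"
    by (rule small_displacements[OF compact_path_image[OF g(1)] compact_transversal_disc, of "A - {H}", rotated 2])
       (use g(2) in blast)+
  have disc: "meridian_disc H (g s) \<eta>" if "s \<in> {0..1}" for s
  proof -
    have "g s \<in> path_image g" using that by (auto simp: path_image_def)
    then show ?thesis using g(2) \<eta> H by (intro meridian_discI) auto
  qed
  have c1: "continuous_on ({0..1::real} \<times> {0..1::real}) (\<lambda>z. g (fst z))"
    by (rule continuous_on_compose2[OF g(1)[unfolded path_def]]) (auto intro!: continuous_intros)
  have c2: "continuous_on ({0..1::real} \<times> {0..1::real}) (\<lambda>z. circlepath 0 \<eta> (snd z))"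
    unfolding circlepath by (intro continuous_intros)
  have norm_circle: "cmod (circlepath 0 \<eta> t) = \<eta>" for t
    using \<eta>(1) by (simp add: circlepath norm_mult)
  have "homotopic_loops M (meridian H q \<eta>) (meridian H q' \<eta>)"
    unfolding homotopic_loops
  proof (intro exI[of _ "\<lambda>z. g (fst z) + circlepath 0 \<eta> (snd z) *s transversal H"] conjI)
    show "continuous_on ({0..1} \<times> {0..1}) (\<lambda>z. g (fst z) + circlepath 0 \<eta> (snd z) *s transversal H)"
      by (intro continuous_on_add continuous_on_vector_smult c1 c2 continuous_on_const)
    show "(\<lambda>z. g (fst z) + circlepath 0 \<eta> (snd z) *s transversal H) \<in> {0..1} \<times> {0..1} \<rightarrow> M"
    proof
      fix z :: "real \<times> real" assume "z \<in> {0..1} \<times> {0..1}"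
      then have "meridian_disc H (g (fst z)) \<eta>" by (intro disc) auto
      then show "g (fst z) + circlepath 0 \<eta> (snd z) *s transversal H \<in> M"
        by (rule meridian_disc_in_M) (use \<eta>(1) norm_circle in auto)
    qed
    show "\<forall>t\<in>{0..1}. g (fst (0, t)) + circlepath 0 \<eta> (snd (0::real, t)) *s transversal H = meridian H q \<eta> t"
      using g(3) by (simp add: meridian_def pathstart_def)
    show "\<forall>t\<in>{0..1}. g (fst (1, t)) + circlepath 0 \<eta> (snd (1::real, t)) *s transversal H = meridian H q' \<eta> t"
      using g(4) by (simp add: meridian_def pathfinish_def)
    show "\<forall>s\<in>{0..1}. pathfinish ((\<lambda>z. g (fst z) + circlepath 0 \<eta> (snd z) *s transversal H) \<circ> Pair s) =
        pathstart ((\<lambda>z. g (fst z) + circlepath 0 \<eta> (snd z) *s transversal H) \<circ> Pair s)"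
      by (simp add: pathstart_def pathfinish_def circlepath)
  qed
  then have "\<Phi> (meridian H q \<eta>) = \<Phi> (meridian H q' \<eta>)" by (rule \<Phi>_homotopic_loops)
  then show ?thesis
    using \<Phi>_meridian_radius[OF m, of \<eta>] \<Phi>_meridian_radius[OF m', of \<eta>] \<eta> by simp
qed

abbreviation seg :: "complex ^ 'n \<Rightarrow> complex ^ 'n \<Rightarrow> complex"
  where "seg x y \<equiv> \<Phi> (linepath x y)"

lemma seg_inverse:
  assumes "closed_segment x y \<subseteq> M"
  shows "seg x y * seg y x = 1"
  using \<Phi>_reverse[of "linepath x y"] assms by auto

lemma \<Phi>_triangle_path:
  assumes "closed_segment x y \<subseteq> M" "closed_segment y z \<subseteq> M" "closed_segment z x \<subseteq> M"
  shows "\<Phi> (triangle_path x y z) = seg x y * seg y z * seg z x"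
  using assms by (simp add: triangle_path_def \<Phi>_join path_image_join)

end

section \<open>Triangles with edges in the complement\<close>

lemma open_triple_rotate: "open_triple a b c \<Longrightarrow> open_triple b c a"
  by (simp add: open_triple_def)

lemma open_triple_swap: "open_triple a b c \<Longrightarrow> open_triple b a c"
  by (simp add: open_triple_def closed_segment_commute)

context path_character
begin

text \<open>After shrinking by \<open>e\<close> towards the zero \<open>q\<close>, the displacement
  \<open>d t\<close> is exchanged for \<open>w t *s v\<close>, which has the same value under
  \<open>f H\<close>; then \<open>w\<close> is deformed to the unit circle in the punctured plane.
  The shrinking stays inside the triangle, where the other forms have no zeros; in the later stages
  the smallness of \<open>e\<close> keeps them nonzero.\<close>

lemma \<Phi>_triangle_one_zero_oriented:
  assumes H: "H \<in> A" and mer: "\<And>q \<delta>. meridian_disc H q \<delta> \<Longrightarrow> \<Phi> (meridian H q \<delta>) = 1"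
    and edges: "closed_segment x y \<subseteq> M" "closed_segment y z \<subseteq> M" "closed_segment z x \<subseteq> M"
    and zero: "0 \<in> convex hull {f H x, f H y, f H z}"
    and others: "\<And>K. K \<in> A - {H} \<Longrightarrow> 0 \<notin> convex hull {f K x, f K y, f K z}"
    and wn: "winding_number (triangle_path (f H x) (f H y) (f H z)) 0 = 1"
  shows "\<Phi> (triangle_path x y z) = 1"
proof -
  define p where "p = triangle_path x y z"
  define w where "w = f H \<circ> p"
  define v where "v = transversal H"
  have p: "path p" "pathfinish p = pathstart p" "path_image p \<subseteq> M"
    using edges by (auto simp: p_def path_image_triangle_path)
  have w_eq: "w = triangle_path (f H x) (f H y) (f H z)"
    by (simp add: w_def p_def linear_compose_triangle_path f_linear H)
  have w: "path w" "pathfinish w = pathstart w" by (simp_all add: w_eq)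
  have pM: "p t \<in> M" if "t \<in> {0..1}" for t using p(3) that by (auto simp: path_image_def)
  have w0: "w t \<noteq> 0" if "t \<in> {0..1}" for t using pM[OF that] H by (simp add: w_def M_def)
  have hull_p: "p t \<in> convex hull {x, y, z}" if "t \<in> {0..1}" for t
  proof -
    have "p t \<in> closed_segment x y \<union> closed_segment y z \<union> closed_segment z x"
      using that unfolding path_image_triangle_path[symmetric] p_def path_image_def by blast
    moreover have "closed_segment a b \<subseteq> convex hull {x, y, z}" if "a \<in> {x, y, z}" "b \<in> {x, y, z}" for a b
      using that by (intro closed_segment_subset hull_inc convex_convex_hull)
    ultimately show ?thesis by blast
  qed
  obtain q where q: "q \<in> convex hull {x, y, z}" "f H q = 0" using zero f_hull[OF H] by (metis imageE)
  have hull_nz: "f K u \<noteq> 0" if "u \<in> convex hull {x, y, z}" "K \<in> A - {H}" for u K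
    using others[OF that(2)] f_hull[of K x y z] that by (metis DiffD1 image_eqI)
  define d where "d = (\<lambda>t. p t - q)"
  have fd: "f H (d t) = w t" for t using linear_diff[OF f_linear[OF H]] q by (simp add: d_def w_def)
  have cd: "continuous_on {0..1} d" and cw: "continuous_on {0..1} w"
    using p(1) w(1) unfolding d_def path_def by (auto intro!: continuous_intros)
  have "0 \<notin> path_image w" using w0 by (auto simp: path_image_def)
  moreover have "winding_number w 0 = winding_number (circlepath 0 1) 0"
    using wn by (simp add: w_eq winding_number_circlepath_centre)
  ultimately have "homotopic_loops (-{0}) w (circlepath 0 1)"
    using winding_number_homotopic_loops_eq[of w 0 "circlepath 0 1"] w by simp
  then obtain h :: "real \<times> real \<Rightarrow> complex" where h: "continuous_on ({0..1} \<times> {0..1}) h" "h \<in> {0..1} \<times> {0..1} \<rightarrow> -{0}"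
     "\<forall>x\<in>{0..1}. h (0, x) = w x" "\<forall>x\<in>{0..1}. h (1, x) = circlepath 0 1 x"
     "\<forall>t\<in>{0..1}. pathfinish (h \<circ> Pair t) = pathstart (h \<circ> Pair t)"
    unfolding homotopic_loops by blast
  \<comment> \<open>The deformation of \<open>w\<close> has compact image, so that after scaling by
    a small \<open>e\<close> it stays away from the other hyperplanes.\<close>
  define C where "C = h ` ({0..1} \<times> {0..1})"
  have C: "compact C" unfolding C_def by (intro compact_continuous_image h compact_Times) auto
  have C0: "0 \<notin> C" using h(2) by (auto simp: C_def)
  have homC: "homotopic_loops C w (circlepath 0 1)"
    unfolding homotopic_loops C_def using h by (intro exI[of _ h]) auto
  \<comment> \<open>\<open>D2\<close>, \<open>D3\<close> and \<open>D4\<close> collect the unscaled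
    displacements from \<open>q\<close> that occur in the linear homotopy, in the deformation of
    \<open>w\<close> and in the meridian disc, so that one \<open>e\<close> can be chosen for all
    three.\<close>
  define D2 where "D2 = (\<lambda>z. (1 - fst z) *\<^sub>R d (snd z) + fst z *\<^sub>R (w (snd z) *s v)) ` ({0..1} \<times> {0..1})"
  define D3 where "D3 = (\<lambda>u. u *s v) ` C"
  define D4 where "D4 = (\<lambda>u. u *s transversal H) ` cball 0 1"
  have "compact D2"
    unfolding D2_def
    by (intro compact_continuous_image compact_Times continuous_intros
        continuous_on_compose2[OF cd] continuous_on_compose2[OF cw]) auto
  moreover have "compact D3" unfolding D3_def by (intro compact_continuous_image continuous_intros C)
  moreover have "compact D4" unfolding D4_def by (rule compact_transversal_disc)
  ultimately have "compact (D2 \<union> D3 \<union> D4)" by auto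
  then obtain e where e: "0 < e" "e < 1"
    "\<And>u K. u \<in> D2 \<union> D3 \<union> D4 \<Longrightarrow> K \<in> A - {H} \<Longrightarrow> f K (q + e *\<^sub>R u) \<noteq> 0"
    by (rule small_displacements[of "{q}" "D2 \<union> D3 \<union> D4" "A - {H}" 1, rotated 1])
       (use hull_nz q(1) in auto)
  have inM: "u \<in> M" if "f H u \<noteq> 0" "\<And>K. K \<in> A - {H} \<Longrightarrow> f K u \<noteq> 0" for u
    using that by (auto simp: M_def)
  have 1: "homotopic_loops M p (\<lambda>t. q + e *\<^sub>R d t)"
  proof (rule homotopic_loops_linear)
    show "path (\<lambda>t. q + e *\<^sub>R d t)" unfolding path_def by (intro continuous_intros cd)
    fix t :: real assume t: "t \<in> {0..1}"
    show "closed_segment (p t) (q + e *\<^sub>R d t) \<subseteq> M"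
    proof
      fix u assume "u \<in> closed_segment (p t) (q + e *\<^sub>R d t)"
      then obtain s where s: "0 \<le> s" "s \<le> 1" "u = (1 - s) *\<^sub>R p t + s *\<^sub>R (q + e *\<^sub>R d t)"
        by (auto simp: closed_segment_def)
      \<comment> \<open>\<open>u\<close> is the image of \<open>p t\<close> under contraction
        towards \<open>q\<close> by the factor \<open>k\<close>, so \<open>f H u\<close> is
        \<open>k *\<^sub>R w t\<close>.\<close>
      define k where "k = (1 - s) + s * e"
      have u: "u = q + k *\<^sub>R d t" "u = (1 - k) *\<^sub>R q + k *\<^sub>R p t"
        unfolding s(3) k_def d_def by (simp_all add: algebra_simps)
      have "s * e \<le> s * 1" using s e by (intro mult_left_mono) auto
      then have k: "k \<ge> 0" "k \<le> 1" unfolding k_def using s e by auto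
      have "k \<noteq> 0"
      proof
        assume "k = 0"
        then have "s = 1" using s e by (simp add: k_def) (smt (verit) mult_nonneg_nonneg)
        then show False using \<open>k = 0\<close> e by (simp add: k_def)
      qed
      then have "f H u \<noteq> 0" unfolding u(1) using w0[OF t] q(2) by (simp add: f_add f_scaleR H fd)
      moreover have "u \<in> convex hull {x, y, z}"
        unfolding u(2) using hull_p[OF t] q(1) k by (intro convexD) auto
      ultimately show "u \<in> M" using hull_nz by (intro inM) auto
    qed
  qed (use p in \<open>auto simp: d_def pathstart_def pathfinish_def\<close>)
  have 2: "homotopic_loops M (\<lambda>t. q + e *\<^sub>R d t) (\<lambda>t. q + (of_real e * w t) *s v)"
  proof (rule homotopic_loops_linear)
    show "path (\<lambda>t. q + e *\<^sub>R d t)" "path (\<lambda>t. q + (of_real e * w t) *s v)"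
      unfolding path_def by (intro continuous_intros cd cw)+
    fix t :: real assume t: "t \<in> {0..1}"
    show "closed_segment (q + e *\<^sub>R d t) (q + (of_real e * w t) *s v) \<subseteq> M"
    proof
      fix u assume "u \<in> closed_segment (q + e *\<^sub>R d t) (q + (of_real e * w t) *s v)"
      then obtain s where s: "0 \<le> s" "s \<le> 1"
          "u = (1 - s) *\<^sub>R (q + e *\<^sub>R d t) + s *\<^sub>R (q + (of_real e * w t) *s v)"
        by (auto simp: closed_segment_def)
      define u' where "u' = (1 - s) *\<^sub>R d t + s *\<^sub>R (w t *s v)"
      have "(of_real e * w t) *s v = e *\<^sub>R (w t *s v)" by (simp flip: vector_smult_of_real)
      then have u: "u = q + e *\<^sub>R u'" unfolding s(3) u'_def by (simp add: algebra_simps)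
      have "u' \<in> D2" unfolding D2_def u'_def using s t by (intro image_eqI[of _ _ "(s, t)"]) auto
      moreover have "f H u' = (1 - s) *\<^sub>R w t + s *\<^sub>R w t"
        unfolding u'_def by (simp add: f_add f_scaleR f_smult H fd v_def)
      then have "f H u' = w t" by (simp flip: scaleR_add_left)
      then have "f H u \<noteq> 0" unfolding u using w0[OF t] q(2) e by (simp add: f_add f_scaleR H)
      ultimately show "u \<in> M" using e(3) unfolding u by (intro inM) auto
    qed
  qed (use p w in \<open>auto simp: d_def pathstart_def pathfinish_def\<close>)
  have 3: "\<Phi> (\<lambda>t. q + (of_real e * w t) *s v) = \<Phi> (\<lambda>t. q + (of_real e * circlepath 0 1 t) *s v)"
  proof (rule \<Phi>_disc_homotopic[OF homC])
    fix u assume u: "u \<in> C"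
    have eq: "(of_real e * u) *s v = e *\<^sub>R (u *s v)" by (simp flip: vector_smult_of_real)
    have "u *s v \<in> D3" using u by (auto simp: D3_def)
    moreover have "f H (q + (of_real e * u) *s v) \<noteq> 0"
      using u C0 e q(2) by (auto simp: f_add f_smult H v_def)
    ultimately show "q + (of_real e * u) *s v \<in> M"
      using e(3) by (intro inM) (auto simp: eq)
  qed
  have "meridian_disc H q e"
    using H e hull_nz q by (intro meridian_discI) (auto simp: D4_def)
  then have "\<Phi> (meridian H q e) = 1" by (rule mer)
  also have "meridian H q e = (\<lambda>t. q + (of_real e * circlepath 0 1 t) *s v)"
    by (simp add: meridian_def circlepath v_def)
  finally show ?thesis using 1 2 3 \<Phi>_homotopic_loops by (simp add: p_def)
qed

text \<open>A triangle of negative orientation is traversed backwards, which inverts the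
  value.\<close>

lemma \<Phi>_triangle_one_zero:
  assumes H: "H \<in> A" and mer: "\<And>q \<delta>. meridian_disc H q \<delta> \<Longrightarrow> \<Phi> (meridian H q \<delta>) = 1"
    and edges: "closed_segment x y \<subseteq> M" "closed_segment y z \<subseteq> M" "closed_segment z x \<subseteq> M"
    and zero: "0 \<in> convex hull {f H x, f H y, f H z}"
    and others: "\<And>K. K \<in> A - {H} \<Longrightarrow> 0 \<notin> convex hull {f K x, f K y, f K z}"
  shows "seg x y * seg y z * seg z x = 1"
proof -
  have "open_triple (f H x) (f H y) (f H z)"
    using edges H unfolding segment_in_M open_triple_def by auto
  from winding_number_triangle_path[OF zero this] show ?thesis
  proof
    assume "winding_number (triangle_path (f H x) (f H y) (f H z)) 0 = 1"
    then show ?thesis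
      using \<Phi>_triangle_one_zero_oriented[OF H mer edges zero others] \<Phi>_triangle_path[OF edges] by simp
  next
    have edges': "closed_segment x z \<subseteq> M" "closed_segment z y \<subseteq> M" "closed_segment y x \<subseteq> M"
      using edges by (simp_all add: closed_segment_commute)
    assume "winding_number (triangle_path (f H x) (f H z) (f H y)) 0 = 1"
    then have "\<Phi> (triangle_path x z y) = 1"
      using zero others by (intro \<Phi>_triangle_one_zero_oriented[OF H mer edges']) (auto simp: insert_commute)
    then have "seg x z * seg z y * seg y x = 1" using \<Phi>_triangle_path[OF edges'] by simp
    moreover have "(seg x y * seg y z * seg z x) * (seg x z * seg z y * seg y x) =
        (seg x y * seg y x) * (seg y z * seg z y) * (seg z x * seg x z)" by simp
    ultimately show ?thesis using seg_inverse[OF edges(1)] seg_inverse[OF edges(2)] seg_inverse[OF edges(3)] by simp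
  qed
qed

text \<open>Hyperplanes missed by a face of the cone stay missed when the cone vertex moves a
  little; hence a vertex \<open>p0\<close> in special position may be exchanged for a generic
  one.\<close>

lemma faces_near:
  "\<forall>\<^sub>F p in nhds p0. \<forall>K\<in>A. 0 \<notin> convex hull {f K p0, f K x, f K y} \<longrightarrow> 0 \<notin> convex hull {f K p, f K x, f K y}"
proof (rule eventually_ball_finite[OF fin], rule ballI)
  fix K assume K: "K \<in> A"
  show "\<forall>\<^sub>F p in nhds p0. 0 \<notin> convex hull {f K p0, f K x, f K y} \<longrightarrow> 0 \<notin> convex hull {f K p, f K x, f K y}"
  proof (cases "0 \<in> convex hull {f K p0, f K x, f K y}")
    case False
    obtain d where d: "d > 0" "\<And>c. dist c (f K p0) < d \<Longrightarrow> 0 \<notin> convex hull {c, f K x, f K y}"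
      using zero_not_in_hull_near[OF False] by metis
    have "(f K \<longlongrightarrow> f K p0) (nhds p0)"
      using f_continuous[OF K, of UNIV] by (simp add: continuous_on_eq_continuous_at isCont_def tendsto_at_iff_tendsto_nhds)
    from tendstoD[OF this d(1)] show ?thesis by eventually_elim (use d(2) in auto)
  qed simp
qed

text \<open>Induction on the number of hyperplanes met by the triangle. A cone over the three edges
  splits the product into three, the segments to the cone vertex cancelling in pairs; the work lies
  in finding a vertex for which each of the three triangles meets fewer hyperplanes.\<close>

lemma \<Phi>_triangle_trivial:
  assumes mer: "\<And>H q \<delta>. meridian_disc H q \<delta> \<Longrightarrow> \<Phi> (meridian H q \<delta>) = 1"
    and edges: "closed_segment x y \<subseteq> M" "closed_segment y z \<subseteq> M" "closed_segment z x \<subseteq> M"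
  shows "seg x y * seg y z * seg z x = 1"
proof -
  define Z where "Z = (\<lambda>x y z. {K \<in> A. 0 \<in> convex hull {f K x, f K y, f K z}})"
  have finZ: "finite (Z x y z)" for x y z using fin by (simp add: Z_def)
  show ?thesis using edges
  proof (induction "card (Z x y z)" arbitrary: x y z rule: less_induct)
    case less
    note edges = less.prems
    have trip: "open_triple (f K x) (f K y) (f K z)" if "K \<in> A" for K
      using edges that unfolding segment_in_M open_triple_def by auto
    have inM: "x \<in> M" "y \<in> M" "z \<in> M" using edges by auto
    \<comment> \<open>It suffices to name a vertex \<open>p0\<close>, even one whose segments to
      \<open>x\<close>, \<open>y\<close>, \<open>z\<close> leave \<open>M\<close>: a nearby generic
      \<open>p\<close> sees all three and misses what \<open>p0\<close> missed. The hypothesis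
      \<open>other\<close> keeps new hyperplanes out, and the remaining three supply one that is
      lost in each face.\<close>
    have split: ?case if
        other: "\<And>K. K \<in> A \<Longrightarrow> K \<notin> Z x y z \<Longrightarrow> 0 \<notin> convex hull {f K p0, f K x, f K y} \<and>
          0 \<notin> convex hull {f K p0, f K y, f K z} \<and> 0 \<notin> convex hull {f K p0, f K z, f K x}"
      and xy: "\<exists>K\<in>Z x y z. 0 \<notin> convex hull {f K p0, f K x, f K y}"
      and yz: "\<exists>K\<in>Z x y z. 0 \<notin> convex hull {f K p0, f K y, f K z}"
      and zx: "\<exists>K\<in>Z x y z. 0 \<notin> convex hull {f K p0, f K z, f K x}"
    for p0
    proof -
      have "\<forall>\<^sub>F p in nhds p0. \<forall>(a, b) \<in> {(x,y), (y,z), (z,x)}.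
          \<forall>K\<in>A. 0 \<notin> convex hull {f K p0, f K a, f K b} \<longrightarrow> 0 \<notin> convex hull {f K p, f K a, f K b}"
        by (rule eventually_ball_finite) (auto intro: faces_near)
      then obtain e where e: "e > 0" "\<And>p a b K. dist p p0 < e \<Longrightarrow> (a, b) \<in> {(x,y), (y,z), (z,x)} \<Longrightarrow>
          K \<in> A \<Longrightarrow> 0 \<notin> convex hull {f K p0, f K a, f K b} \<Longrightarrow> 0 \<notin> convex hull {f K p, f K a, f K b}"
        unfolding eventually_nhds_metric by blast
      obtain p where p: "p \<in> M" "dist p p0 < e" "\<And>u. u \<in> {x, y, z} \<Longrightarrow> closed_segment u p \<subseteq> M"
        by (rule visible_point[of "{x, y, z}" e p0]) (use inM e(1) in auto)
      have IH: "seg p a * seg a b * seg b p = 1"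
        if ab: "(a, b) \<in> {(x,y), (y,z), (z,x)}" and ex: "\<exists>K\<in>Z x y z. 0 \<notin> convex hull {f K p0, f K a, f K b}"
        for a b
      proof (rule less.hyps)
        obtain K where K: "K \<in> Z x y z" "0 \<notin> convex hull {f K p0, f K a, f K b}" using ex by blast
        then have "K \<notin> Z p a b" using e(2)[OF p(2) ab] by (auto simp: Z_def)
        moreover have "Z p a b \<subseteq> Z x y z"
        proof
          fix L assume L: "L \<in> Z p a b"
          show "L \<in> Z x y z"
          proof (rule ccontr)
            assume "L \<notin> Z x y z"
            then have "0 \<notin> convex hull {f L p0, f L a, f L b}" using other[of L] L ab by (auto simp: Z_def)
            then show False using e(2)[OF p(2) ab, of L] L by (auto simp: Z_def)
          qed
        qed
        ultimately have "Z p a b \<subset> Z x y z" using K by blast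
        then show "card (Z p a b) < card (Z x y z)" using finZ by (intro psubset_card_mono)
        show "closed_segment p a \<subseteq> M" "closed_segment b p \<subseteq> M" "closed_segment a b \<subseteq> M"
          using ab p(3) edges by (auto simp: closed_segment_commute)
      qed
      have t: "seg p x * seg x y * seg y p = 1" "seg p y * seg y z * seg z p = 1" "seg p z * seg z x * seg x p = 1"
        using IH[OF _ xy] IH[OF _ yz] IH[OF _ zx] by auto
      have i: "seg x p * seg p x = 1" "seg y p * seg p y = 1" "seg z p * seg p z = 1"
        using seg_inverse[OF p(3)] by auto
      have "seg x y * seg y z * seg z x * ((seg x p * seg p x) * (seg y p * seg p y) * (seg z p * seg p z)) =
          (seg p x * seg x y * seg y p) * (seg p y * seg y z * seg z p) * (seg p z * seg z x * seg x p)"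
        by (simp add: mult_ac)
      then show ?thesis using t i by simp
    qed
    consider "Z x y z = {}" | H where "Z x y z = {H}" | H1 H2 where "H1 \<in> Z x y z" "H2 \<in> Z x y z" "H1 \<noteq> H2"
      by (metis all_not_in_conv insert_iff subsetI subset_singletonD)
    then show ?case
    proof cases
      case 1
      then have hM: "convex hull {x, y, z} \<subseteq> M" unfolding hull_in_M by (auto simp: Z_def)
      have "closed_segment a b \<subseteq> convex hull {x, y, z}" if "a \<in> {x, y, z}" "b \<in> {x, y, z}" for a b
        using that by (intro closed_segment_subset hull_inc convex_convex_hull)
      then have "\<Phi> (triangle_path x y z) = 1"
        by (intro \<Phi>_convex_loop[OF convex_convex_hull hM]) (auto simp: path_image_triangle_path)
      then show ?thesis using \<Phi>_triangle_path[OF edges] by simp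
    next
      case (2 H)
      then have H: "H \<in> A" "0 \<in> convex hull {f H x, f H y, f H z}"
        "\<And>K. K \<in> A - {H} \<Longrightarrow> 0 \<notin> convex hull {f K x, f K y, f K z}"
        unfolding Z_def by auto
      show ?thesis by (rule \<Phi>_triangle_one_zero[OF H(1) mer edges H(2,3)])
    next
      case (3 H1 H2)
      then have HA: "H1 \<in> A" "H2 \<in> A" by (auto simp: Z_def)
      obtain \<alpha> \<beta> \<gamma> where 1: "\<alpha> \<ge> 0" "\<beta> \<ge> 0" "\<gamma> \<ge> 0" "\<alpha> + \<beta> + \<gamma> = 1"
          "\<alpha> *\<^sub>R f H1 x + \<beta> *\<^sub>R f H1 y + \<gamma> *\<^sub>R f H1 z = 0"
        using 3(1) unfolding Z_def convex_hull_3 by auto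
      obtain \<alpha>' \<beta>' \<gamma>' where 2: "\<alpha>' \<ge> 0" "\<beta>' \<ge> 0" "\<gamma>' \<ge> 0" "\<alpha>' + \<beta>' + \<gamma>' = 1"
          "\<alpha>' *\<^sub>R f H2 x + \<beta>' *\<^sub>R f H2 y + \<gamma>' *\<^sub>R f H2 z = 0"
        using 3(2) unfolding Z_def convex_hull_3 by auto
      \<comment> \<open>A cone vertex inside the triangle has its faces inside the triangle as well,
        so they meet no new hyperplane.\<close>
      have face_hull: "0 \<notin> convex hull {f K p, f K x, f K y} \<and>
          0 \<notin> convex hull {f K p, f K y, f K z} \<and> 0 \<notin> convex hull {f K p, f K z, f K x}"
        if "K \<in> A" "K \<notin> Z x y z" "p \<in> convex hull {x, y, z}" for K p
      proof -
        have "f K p \<in> convex hull {f K x, f K y, f K z}" using that f_hull[of K x y z] by (metis image_eqI)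
        then have "convex hull {f K p, a, b} \<subseteq> convex hull {f K x, f K y, f K z}"
          if "a \<in> {f K x, f K y, f K z}" "b \<in> {f K x, f K y, f K z}" for a b
          using that by (intro hull_minimal convex_convex_hull) (auto intro: hull_inc)
        then show ?thesis using that by (auto simp: Z_def)
      qed
      show ?thesis
      proof (cases "\<alpha> = \<alpha>' \<and> \<beta> = \<beta>' \<and> \<gamma> = \<gamma>'")
        case False
        \<comment> \<open>\<open>p0\<close> is the midpoint of the zeros of \<open>f H1\<close> and \<open>f H2\<close> in the triangle, an extreme point of
          each of the three smaller triangles, so that none of these contains both zeros.\<close>
        define p0 where "p0 = ((\<alpha> + \<alpha>') / 2) *\<^sub>R x + ((\<beta> + \<beta>') / 2) *\<^sub>R y + ((\<gamma> + \<gamma>') / 2) *\<^sub>R z"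
        have fp0: "f K p0 = ((\<alpha> + \<alpha>') / 2) *\<^sub>R f K x + ((\<beta> + \<beta>') / 2) *\<^sub>R f K y + ((\<gamma> + \<gamma>') / 2) *\<^sub>R f K z"
          if "K \<in> A" for K unfolding p0_def by (simp only: f_add[OF that] f_scaleR[OF that])
        note t1 = trip[OF HA(1)] and t2 = trip[OF HA(2)]
        have r1: "\<beta> + \<gamma> + \<alpha> = 1" "\<beta> *\<^sub>R f H1 y + \<gamma> *\<^sub>R f H1 z + \<alpha> *\<^sub>R f H1 x = 0"
          "\<beta>' + \<gamma>' + \<alpha>' = 1" "\<beta>' *\<^sub>R f H2 y + \<gamma>' *\<^sub>R f H2 z + \<alpha>' *\<^sub>R f H2 x = 0"
          using 1(4,5) 2(4,5) by (simp_all add: add_ac)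
        have r2: "\<gamma> + \<alpha> + \<beta> = 1" "\<gamma> *\<^sub>R f H1 z + \<alpha> *\<^sub>R f H1 x + \<beta> *\<^sub>R f H1 y = 0"
          "\<gamma>' + \<alpha>' + \<beta>' = 1" "\<gamma>' *\<^sub>R f H2 z + \<alpha>' *\<^sub>R f H2 x + \<beta>' *\<^sub>R f H2 y = 0"
          using 1(4,5) 2(4,5) by (simp_all add: add_ac)
        have ne: "\<not> (\<beta> = \<beta>' \<and> \<gamma> = \<gamma>' \<and> \<alpha> = \<alpha>')" "\<not> (\<gamma> = \<gamma>' \<and> \<alpha> = \<alpha>' \<and> \<beta> = \<beta>')"
          using False by auto
        have fp0r: "f K p0 = ((\<beta> + \<beta>') / 2) *\<^sub>R f K y + ((\<gamma> + \<gamma>') / 2) *\<^sub>R f K z + ((\<alpha> + \<alpha>') / 2) *\<^sub>R f K x"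
          "f K p0 = ((\<gamma> + \<gamma>') / 2) *\<^sub>R f K z + ((\<alpha> + \<alpha>') / 2) *\<^sub>R f K x + ((\<beta> + \<beta>') / 2) *\<^sub>R f K y"
          if "K \<in> A" for K unfolding fp0[OF that] by (simp_all add: add_ac)
        show ?thesis
        proof (rule split[of p0])
          show "\<exists>K\<in>Z x y z. 0 \<notin> convex hull {f K p0, f K x, f K y}"
            using midpoint_separates[OF t1 1 t2 2 False fp0[OF HA(1)] fp0[OF HA(2)]] 3 by blast
          show "\<exists>K\<in>Z x y z. 0 \<notin> convex hull {f K p0, f K y, f K z}"
            using midpoint_separates[OF open_triple_rotate[OF t1] 1(2,3,1) r1(1,2) open_triple_rotate[OF t2] 2(2,3,1)
                r1(3,4) ne(1) fp0r(1)[OF HA(1)] fp0r(1)[OF HA(2)]] 3 by blast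
          show "\<exists>K\<in>Z x y z. 0 \<notin> convex hull {f K p0, f K z, f K x}"
            using midpoint_separates[OF open_triple_rotate[OF open_triple_rotate[OF t1]] 1(3,1,2) r2(1,2)
                open_triple_rotate[OF open_triple_rotate[OF t2]] 2(3,1,2) r2(3,4) ne(2)
                fp0r(2)[OF HA(1)] fp0r(2)[OF HA(2)]] 3 by blast
          have "(\<alpha> + \<alpha>') / 2 + (\<beta> + \<beta>') / 2 + (\<gamma> + \<gamma>') / 2 = 1" using 1(4) 2(4) by (simp add: field_simps)
          then have "p0 \<in> convex hull {x, y, z}" unfolding p0_def convex_hull_3 using 1 2 by force
          then show "0 \<notin> convex hull {f K p0, f K x, f K y} \<and> 0 \<notin> convex hull {f K p0, f K y, f K z} \<and>
              0 \<notin> convex hull {f K p0, f K z, f K x}" if "K \<in> A" "K \<notin> Z x y z" for K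
            using face_hull that by blast
        qed
      next
        case True
        \<comment> \<open>The zeros coincide at \<open>q\<close>. A small displacement of \<open>q\<close> moves the zero of \<open>f H1\<close> into the face
          over \<open>x y\<close> only and that of \<open>f H2\<close> into the face over \<open>y z\<close> only.\<close>
        define q where "q = \<alpha> *\<^sub>R x + \<beta> *\<^sub>R y + \<gamma> *\<^sub>R z"
        have q: "q \<in> convex hull {x, y, z}" "f H1 q = 0" "f H2 q = 0"
          using 1 2 True HA unfolding q_def convex_hull_3 by (auto simp: f_add f_scaleR)
        obtain d1 where d1: "f H2 d1 = 0" "f H1 d1 \<noteq> 0" using f_indep[of H2 H1] HA 3 by blast
        obtain d2 where d2: "f H1 d2 = 0" "f H2 d2 \<noteq> 0" using f_indep[of H1 H2] HA 3 by blast
        \<comment> \<open>\<open>d1\<close> and \<open>d2\<close> allow \<open>f H1 d\<close> and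
          \<open>f H2 d\<close> to be prescribed independently; the values are those that give
          \<open>p0\<close> the form required by \<open>zero_not_in_hull_reflected\<close>, for the
          edge \<open>x y\<close> and the edge \<open>y z\<close> respectively.\<close>
        define d where "d = (- (f H1 x + f H1 y) / f H1 d1) *s d1 + (- (f H2 y + f H2 z) / f H2 d2) *s d2"
        have fd: "f H1 d = - (f H1 x + f H1 y)" "f H2 d = - (f H2 y + f H2 z)"
          using d1 d2 HA by (simp_all add: d_def f_add f_smult)
        have "\<forall>\<^sub>F p in nhds q. \<forall>(a, b) \<in> {(x,y), (y,z), (z,x)}.
            \<forall>K\<in>A. 0 \<notin> convex hull {f K q, f K a, f K b} \<longrightarrow> 0 \<notin> convex hull {f K p, f K a, f K b}"
          by (rule eventually_ball_finite) (auto intro: faces_near)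
        then obtain e where e: "e > 0" "\<And>p a b K. dist p q < e \<Longrightarrow> (a, b) \<in> {(x,y), (y,z), (z,x)} \<Longrightarrow>
            K \<in> A \<Longrightarrow> 0 \<notin> convex hull {f K q, f K a, f K b} \<Longrightarrow> 0 \<notin> convex hull {f K p, f K a, f K b}"
          unfolding eventually_nhds_metric by blast
        \<comment> \<open>Scales the displacement to norm at most \<open>e / 2\<close>; the
          \<open>+ 1\<close> keeps the denominator positive.\<close>
        define s where "s = (e / 2) / (norm d + 1)"
        have np: "norm d + 1 > 0" by (simp add: add_nonneg_pos)
        have s: "s > 0" using e np by (simp add: s_def)
        define p0 where "p0 = q + s *\<^sub>R d"
        have "dist p0 q = s * norm d" using s by (simp add: p0_def dist_norm)
        also have "\<dots> \<le> s * (norm d + 1)" using s by simp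
        also have "\<dots> = e / 2" using np by (metis less_irrefl nonzero_eq_divide_eq s_def)
        finally have dp: "dist p0 q < e" using e by simp
        have "f H1 p0 = s *\<^sub>R f H1 d" "f H2 p0 = s *\<^sub>R f H2 d"
          using q HA by (simp_all add: p0_def f_add f_scaleR)
        then have fp1: "f H1 p0 = - s *\<^sub>R (f H1 x + f H1 y)" and fp2: "f H2 p0 = - s *\<^sub>R (f H2 y + f H2 z)"
          by (simp_all only: fd scaleR_minus_left scaleR_minus_right)
        note t1 = trip[OF HA(1)] and t2 = trip[OF HA(2)]
        have pos: "\<alpha> > 0" "\<beta> > 0" "\<gamma> > 0" using open_triple.zero_combination_pos[OF t1 1(1-3)] 1 by auto
        note zero2 = 2(5)[folded True[THEN conjunct1] True[THEN conjunct2, THEN conjunct1] True[THEN conjunct2, THEN conjunct2]]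
        show ?thesis
        proof (rule split[of p0])
          have "0 \<notin> convex hull {f H2 p0, f H2 y, f H2 x}"
            using open_triple.zero_not_in_hull_reflected[OF open_triple_swap[OF open_triple_rotate[OF t2]] pos(3,2,1) _ s] zero2
            unfolding fp2 by (simp add: add_ac)
          then show "\<exists>K\<in>Z x y z. 0 \<notin> convex hull {f K p0, f K x, f K y}"
            using 3(2) by (intro bexI[of _ H2]) (simp_all add: insert_commute)
          have "0 \<notin> convex hull {f H1 p0, f H1 y, f H1 z}"
            using open_triple.zero_not_in_hull_reflected[OF t1 pos 1(5) s] unfolding fp1 .
          then show "\<exists>K\<in>Z x y z. 0 \<notin> convex hull {f K p0, f K y, f K z}" using 3(1) by blast
          have "0 \<notin> convex hull {f H1 p0, f H1 x, f H1 z}"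
            using open_triple.zero_not_in_hull_reflected[OF open_triple_swap[OF t1] pos(2,1,3) _ s] 1(5)
            unfolding fp1 by (simp add: add_ac)
          then show "\<exists>K\<in>Z x y z. 0 \<notin> convex hull {f K p0, f K z, f K x}"
            using 3(1) by (intro bexI[of _ H1]) (simp_all add: insert_commute)
          show "0 \<notin> convex hull {f K p0, f K x, f K y} \<and> 0 \<notin> convex hull {f K p0, f K y, f K z} \<and>
              0 \<notin> convex hull {f K p0, f K z, f K x}" if "K \<in> A" "K \<notin> Z x y z" for K
            using face_hull[OF that q(1)] e(2)[OF dp _ that(1)] by blast
        qed
      qed
    qed
  qed
qed

end

section \<open>From triangles to arbitrary loops\<close>

context path_character
begin

text \<open>Short pieces can be replaced by chords inside a ball in \<open>M\<close>. The segment
  between the ends of a long piece may leave \<open>M\<close>, so the value is expressed by a detour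
  through a point \<open>y\<close> visible from both ends.\<close>

lemma \<Phi>_path_via_point:
  assumes mer: "\<And>H q \<delta>. meridian_disc H q \<delta> \<Longrightarrow> \<Phi> (meridian H q \<delta>) = 1"
    and g: "path g" "path_image g \<subseteq> M"
    and y: "closed_segment (pathstart g) y \<subseteq> M" "closed_segment y (pathfinish g) \<subseteq> M"
  shows "\<Phi> g = seg (pathstart g) y * seg y (pathfinish g)"
proof -
  \<comment> \<open>All detour points are allowed, so that two adjacent pieces can use the same
    one.\<close>
  define P where "P a b \<longleftrightarrow> (0 \<le> a \<and> b \<le> 1 \<longrightarrow> (\<forall>y. closed_segment (g a) y \<subseteq> M \<longrightarrow>
      closed_segment y (g b) \<subseteq> M \<longrightarrow> \<Phi> (subpath a b g) = seg (g a) y * seg y (g b)))" for a b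
  have tri: "seg a b * seg b c = seg a c" if "closed_segment a b \<subseteq> M" "closed_segment b c \<subseteq> M" "closed_segment a c \<subseteq> M"
    for a b c
  proof -
    have 1: "seg a b * seg b c * seg c a = 1" and 2: "seg c a * seg a c = 1"
      using \<Phi>_triangle_trivial[OF mer] seg_inverse[of c a] that by (simp_all add: closed_segment_commute)
    have "seg a b * seg b c = seg a b * seg b c * (seg c a * seg a c)" by (simp only: 2 mult_1_right)
    also have "\<dots> = (seg a b * seg b c * seg c a) * seg a c" by (simp only: mult.assoc)
    finally show ?thesis by (simp only: 1 mult_1_left)
  qed
  have gM: "g t \<in> M" if "t \<in> {0..1}" for t using g(2) that by (auto simp: path_image_def)
  have sub: "path (subpath a b g)" "path_image (subpath a b g) \<subseteq> M" if "a \<in> {0..1}" "b \<in> {0..1}" for a b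
    using that g path_image_subpath_subset[of a b g] by auto
  have "(0::real) \<le> 1" by simp
  then have "P 0 1"
  proof (induction rule: Bolzano)
    case (trans a b c)
    show ?case unfolding P_def
    proof clarify
      fix y assume ac: "0 \<le> a" "c \<le> 1" and y: "closed_segment (g a) y \<subseteq> M" "closed_segment y (g c) \<subseteq> M"
      have abc: "a \<in> {0..1}" "b \<in> {0..1}" "c \<in> {0..1}" using ac trans by auto
      have "{g a, g b, g c, y} \<subseteq> M" using y gM abc by auto
      \<comment> \<open>\<open>u\<close> must see \<open>y\<close> as well as the three points of
        the path: the triangle relation is then available on \<open>g a, y, u\<close> and on
        \<open>u, y, g c\<close> to exchange the detour \<open>u\<close> for
        \<open>y\<close>.\<close>
      then obtain u where u: "\<And>x. x \<in> {g a, g b, g c, y} \<Longrightarrow> closed_segment x u \<subseteq> M"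
        using visible_point[of "{g a, g b, g c, y}" 1 0] by (metis finite.emptyI finite.insertI insert_not_empty zero_less_one)
      have u': "closed_segment u x \<subseteq> M" if "x \<in> {g a, g b, g c, y}" for x
        using u[OF that] by (simp add: closed_segment_commute)
      have "\<Phi> (subpath a c g) = \<Phi> (subpath a b g +++ subpath b c g)"
        using \<Phi>_homotopic[OF homotopic_join_subpaths[OF g abc]] by simp
      also have "\<dots> = \<Phi> (subpath a b g) * \<Phi> (subpath b c g)"
        using sub abc by (intro \<Phi>_join) auto
      also have "\<Phi> (subpath a b g) = seg (g a) u * seg u (g b)"
        using trans(1) abc u u' unfolding P_def by auto
      also have "\<Phi> (subpath b c g) = seg (g b) u * seg u (g c)"
        using trans(2) abc u u' unfolding P_def by auto
      also have "seg (g a) u * seg u (g b) * (seg (g b) u * seg u (g c)) =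
          seg (g a) u * seg u (g c) * (seg u (g b) * seg (g b) u)" by simp
      also have "seg u (g b) * seg (g b) u = 1" using u' by (intro seg_inverse) auto
      also have "seg (g a) u = seg (g a) y * seg y u" using tri u y by auto
      also have "seg u (g c) = seg u y * seg y (g c)" using tri u' y by auto
      also have "seg (g a) y * seg y u * (seg u y * seg y (g c)) * 1 =
          seg (g a) y * seg y (g c) * (seg y u * seg u y)" by simp
      also have "seg y u * seg u y = 1" using u by (intro seg_inverse) auto
      finally show "\<Phi> (subpath a c g) = seg (g a) y * seg y (g c)" by simp
    qed
  next
    case (local x)
    then have "g x \<in> M" by (intro gM) auto
    then obtain e where e: "e > 0" "ball (g x) e \<subseteq> M" using open_M by (metis open_contains_ball)
    obtain d where d: "d > 0" "\<And>t. t \<in> {0..1} \<Longrightarrow> dist t x < d \<Longrightarrow> g t \<in> ball (g x) e"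
      using g(1) local e(1) unfolding path_def continuous_on_iff by (metis atLeastAtMost_iff dist_commute mem_ball)
    have "P a b" if ab: "a \<le> x" "x \<le> b" "b - a < d" for a b
      unfolding P_def
    proof clarify
      fix y assume ab': "0 \<le> a" "b \<le> 1" and y: "closed_segment (g a) y \<subseteq> M" "closed_segment y (g b) \<subseteq> M"
      have in_ball: "g t \<in> ball (g x) e" if "t \<in> {a..b}" for t
        using d(2)[of t] that ab ab' by (auto simp: dist_real_def)
      have "path_image (subpath a b g) = g ` {a..b}"
        using ab by (simp add: path_image_subpath)
      then have s: "path_image (subpath a b g) \<subseteq> ball (g x) e" using in_ball by auto
      have l: "closed_segment (g b) (g a) \<subseteq> ball (g x) e"
        using in_ball ab by (intro closed_segment_subset convex_ball) auto
      have abI: "a \<in> {0..1}" "b \<in> {0..1}" using ab ab' by auto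
      have "path_image (subpath a b g +++ linepath (g b) (g a)) \<subseteq> ball (g x) e"
        using s l by (intro subset_path_image_join) auto
      then have "\<Phi> (subpath a b g +++ linepath (g b) (g a)) = 1"
        using sub(1)[OF abI] by (intro \<Phi>_convex_loop[OF convex_ball e(2)]) auto
      moreover have "\<Phi> (subpath a b g +++ linepath (g b) (g a)) = \<Phi> (subpath a b g) * seg (g b) (g a)"
        using sub[OF abI] l e(2) by (intro \<Phi>_join) auto
      ultimately have "\<Phi> (subpath a b g) * (seg (g b) (g a) * seg (g a) (g b)) = seg (g a) (g b)" by simp
      then have "\<Phi> (subpath a b g) = seg (g a) (g b)" using seg_inverse[of "g b" "g a"] l e(2) by simp
      then show "\<Phi> (subpath a b g) = seg (g a) y * seg y (g b)"
        using tri[OF y] l e(2) by (simp add: closed_segment_commute)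
    qed
    then show ?case using d(1) by blast
  qed
  then show ?thesis using y unfolding P_def by (simp add: pathstart_def pathfinish_def)
qed

text \<open>The starting point of a loop can serve as its own detour, and both segments are then
  constant.\<close>

lemma \<Phi>_loop_trivial:
  assumes mer: "\<And>H q \<delta>. meridian_disc H q \<delta> \<Longrightarrow> \<Phi> (meridian H q \<delta>) = 1"
    and g: "path g" "path_image g \<subseteq> M" "pathfinish g = pathstart g"
  shows "\<Phi> g = 1"
proof -
  have "pathstart g \<in> M" using g(2) by auto
  then have "\<Phi> g = seg (pathstart g) (pathstart g) * seg (pathstart g) (pathstart g)"
    using \<Phi>_path_via_point[OF mer g(1,2), of "pathstart g"] g(3) by simp
  then show ?thesis using \<Phi>_const \<open>pathstart g \<in> M\<close> by simp
qed

end

section \<open>Winding numbers of the forms\<close>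

context hyperplane_forms
begin

text \<open>On a path that is not closed this is a complex number, the change of a logarithm of
  \<open>f K\<close> divided by \<open>2 * pi * \<i>\<close>. It is additive there too, so a
  character of paths can be twisted by it.\<close>

definition wind :: "'i \<Rightarrow> (real \<Rightarrow> complex ^ 'n) \<Rightarrow> complex"
  where "wind K g = winding_number (f K \<circ> g) 0"

lemma f_path:
  assumes "K \<in> A" "path g" "path_image g \<subseteq> M"
  shows "path (f K \<circ> g)" "0 \<notin> path_image (f K \<circ> g)"
proof -
  show "path (f K \<circ> g)" using assms f_continuous by (intro path_continuous_image)
  show "0 \<notin> path_image (f K \<circ> g)" using assms by (auto simp: path_image_compose M_def)
qed

lemma wind_join:
  assumes "K \<in> A" "path g" "path_image g \<subseteq> M" "path h" "path_image h \<subseteq> M" "pathfinish g = pathstart h"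
  shows "wind K (g +++ h) = wind K g + wind K h"
  unfolding wind_def path_compose_join
  using assms f_path by (intro winding_number_join) (auto simp: pathfinish_compose pathstart_compose)

lemma wind_reverse:
  assumes "K \<in> A" "path g" "path_image g \<subseteq> M"
  shows "wind K (reversepath g) = - wind K g"
proof -
  have "f K \<circ> reversepath g = reversepath (f K \<circ> g)" by (simp add: reversepath_def fun_eq_iff)
  then show ?thesis unfolding wind_def using winding_number_reversepath[OF f_path[OF assms]] by simp
qed

lemma wind_homotopic:
  assumes "K \<in> A" "homotopic_paths M g h"
  shows "wind K g = wind K h"
  unfolding wind_def
  by (intro winding_number_homotopic_paths homotopic_paths_continuous_image[OF assms(2)] f_continuous assms)
     (use assms in \<open>auto simp: M_def\<close>)

lemma wind_loop_Ints:
  assumes "K \<in> A" "path g" "path_image g \<subseteq> M" "pathfinish g = pathstart g"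
  shows "wind K g \<in> \<int>"
  unfolding wind_def using assms f_path
  by (intro integer_winding_number) (auto simp: pathfinish_compose pathstart_compose)

lemma meridian_path:
  assumes "meridian_disc H q \<delta>"
  shows "path (meridian H q \<delta>)" "path_image (meridian H q \<delta>) \<subseteq> M"
proof -
  have d: "\<delta> > 0" using assms by (simp add: meridian_disc_def)
  show "path (meridian H q \<delta>)"
    unfolding path_def meridian_def circlepath by (intro continuous_intros)
  show "path_image (meridian H q \<delta>) \<subseteq> M"
    using d by (auto simp: path_image_def meridian_def circlepath norm_mult intro!: meridian_disc_in_M[OF assms])
qed

text \<open>Under \<open>f K\<close> the meridian becomes a circle about the origin if
  \<open>K = H\<close>; otherwise it stays in the affine image of a disc, which is convex and misses
  the origin.\<close>

lemma wind_meridian: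
  assumes m: "meridian_disc H q \<delta>" and K: "K \<in> A"
  shows "wind K (meridian H q \<delta>) = (if K = H then 1 else 0)"
proof (cases "K = H")
  case True
  have d: "\<delta> > 0" "f H q = 0" using m by (auto simp: meridian_disc_def)
  have "f H \<circ> meridian H q \<delta> = circlepath 0 \<delta>"
    using K True d by (simp add: fun_eq_iff meridian_def f_add f_smult)
  then show ?thesis using True d by (simp add: wind_def winding_number_circlepath_centre)
next
  case False
  define c where "c = f K (transversal H)"
  have d: "\<delta> > 0" using m by (simp add: meridian_disc_def)
  let ?S = "(+) (f K q) ` (\<lambda>w. w * c) ` cball 0 \<delta>"
  have "winding_number (f K \<circ> meridian H q \<delta>) 0 = 0"
  proof (rule winding_number_zero_outside)
    show "path (f K \<circ> meridian H q \<delta>)" using f_path meridian_path[OF m] K by blast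
    have "linear (\<lambda>w. w * c)" by (intro linearI) (auto simp: algebra_simps)
    then show "convex ?S" by (intro convex_translation convex_linear_image convex_cball)
    show "pathfinish (f K \<circ> meridian H q \<delta>) = pathstart (f K \<circ> meridian H q \<delta>)"
      by (simp add: pathfinish_def pathstart_def meridian_def circlepath)
    show "0 \<notin> ?S"
    proof
      assume "0 \<in> ?S"
      then obtain w where "cmod w \<le> \<delta>" "f K q + w * c = 0" by auto
      then show False using m K False unfolding meridian_disc_def c_def
        by (metis DiffI f_add f_smult singletonD)
    qed
    show "path_image (f K \<circ> meridian H q \<delta>) \<subseteq> ?S"
      using d K by (auto simp: path_image_def meridian_def circlepath f_add f_smult c_def norm_mult intro!: imageI)
  qed
  then show ?thesis using False by (simp add: wind_def)
qed

end

context path_character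
begin

text \<open>\<open>L\<close> is a set containing a logarithm of every value. Choosing the exponents
  in \<open>L\<close> lets them be taken later among the integer multiples of
  \<open>2 * pi * \<i> / r\<close>.\<close>

lemma \<Phi>_loop_winding:
  assumes L: "\<And>g. path g \<Longrightarrow> path_image g \<subseteq> M \<Longrightarrow> \<exists>l\<in>L. \<Phi> g = exp l"
  obtains c where "\<And>H. H \<in> A \<Longrightarrow> c H \<in> L"
    "\<And>g. path g \<Longrightarrow> path_image g \<subseteq> M \<Longrightarrow> pathfinish g = pathstart g \<Longrightarrow> \<Phi> g = exp (\<Sum>H\<in>A. c H * wind H g)"
proof -
  have "\<forall>H\<in>A. \<exists>l\<in>L. \<forall>q \<delta>. meridian_disc H q \<delta> \<longrightarrow> \<Phi> (meridian H q \<delta>) = exp l"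
  proof
    fix H assume "H \<in> A"
    show "\<exists>l\<in>L. \<forall>q \<delta>. meridian_disc H q \<delta> \<longrightarrow> \<Phi> (meridian H q \<delta>) = exp l"
    proof (cases "\<exists>q \<delta>. meridian_disc H q \<delta>")
      case True
      then obtain q \<delta> where m: "meridian_disc H q \<delta>" by blast
      then obtain l where "l \<in> L" "\<Phi> (meridian H q \<delta>) = exp l" using L meridian_path by blast
      then show ?thesis using meridian_value[OF _ m] by metis
    next
      case False
      \<comment> \<open>If \<open>H\<close> has no meridian disc, any element of \<open>L\<close>
        will do; the constant path shows that there is one.\<close>
      then show ?thesis using L[of "linepath v0 v0"] v0_in_M by auto
    qed
  qed
  then obtain c where c: "\<And>H. H \<in> A \<Longrightarrow> c H \<in> L"
    "\<And>H q \<delta>. H \<in> A \<Longrightarrow> meridian_disc H q \<delta> \<Longrightarrow> \<Phi> (meridian H q \<delta>) = exp (c H)" by metis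
  define \<Psi> where "\<Psi> = (\<lambda>g. \<Phi> g * exp (- (\<Sum>H\<in>A. c H * wind H g)))"
  interpret \<Psi>: path_character A f v0 \<Psi>
  proof
    fix g h assume gh: "path g" "path_image g \<subseteq> M" "path h" "path_image h \<subseteq> M" "pathfinish g = pathstart h"
    have "(\<Sum>H\<in>A. c H * wind H (g +++ h)) = (\<Sum>H\<in>A. c H * wind H g) + (\<Sum>H\<in>A. c H * wind H h)"
      using wind_join gh by (simp add: sum.distrib[symmetric] algebra_simps)
    then show "\<Psi> (g +++ h) = \<Psi> g * \<Psi> h"
      using \<Phi>_join[OF gh] by (simp add: \<Psi>_def exp_add exp_minus field_simps)
  next
    fix g h assume gh: "homotopic_paths M g h"
    have "(\<Sum>H\<in>A. c H * wind H g) = (\<Sum>H\<in>A. c H * wind H h)"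
      using wind_homotopic[OF _ gh] by (intro sum.cong) auto
    then show "\<Psi> g = \<Psi> h" using \<Phi>_homotopic[OF gh] by (simp add: \<Psi>_def)
  next
    fix g assume "path g" "path_image g \<subseteq> M"
    then show "\<Psi> g \<noteq> 0" using \<Phi>_nonzero by (simp add: \<Psi>_def)
  qed
  have mer: "\<Psi> (meridian H q \<delta>) = 1" if m: "meridian_disc H q \<delta>" for H q \<delta>
  proof -
    have H: "H \<in> A" using m by (simp add: meridian_disc_def)
    have "(\<Sum>K\<in>A. c K * wind K (meridian H q \<delta>)) = (\<Sum>K\<in>A. if K = H then c K else 0)"
      using wind_meridian[OF m] by (intro sum.cong) auto
    also have "\<dots> = c H" using H fin by simp
    finally show ?thesis using c(2)[OF H m] by (simp add: \<Psi>_def exp_minus)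
  qed
  have "\<Phi> g = exp (\<Sum>H\<in>A. c H * wind H g)"
    if "path g" "path_image g \<subseteq> M" "pathfinish g = pathstart g" for g
    using \<Psi>.\<Phi>_loop_trivial[OF mer that] by (simp add: \<Psi>_def exp_minus field_simps)
  then show ?thesis using c(1) that by blast
qed

end

section \<open>Coprime weights in residue classes\<close>

text \<open>With \<open>k\<close> the product of the primes of \<open>g\<close> that do not divide
  \<open>n\<close>, each prime of \<open>g\<close> divides exactly one of \<open>n\<close> and
  \<open>r * k\<close>.\<close>

lemma coprime_in_progression:
  fixes g n r :: nat
  assumes "g > 0" and gcd: "\<And>l. prime l \<Longrightarrow> l dvd g \<Longrightarrow> l dvd n \<Longrightarrow> \<not> l dvd r"
  obtains k where "coprime (n + r * k) g"
proof -
  define k where "k = \<Prod>{l \<in> prime_factors g. \<not> l dvd n}"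
  have "coprime (n + r * k) g"
  proof (rule ccontr)
    assume "\<not> coprime (n + r * k) g"
    then have "gcd (n + r * k) g \<noteq> 1" by (simp add: coprime_iff_gcd_eq_1)
    then obtain l where l: "prime l" "l dvd gcd (n + r * k) g" using prime_factor_nat by metis
    then have ln: "l dvd n + r * k" "l dvd g" by auto
    have fin: "finite {l \<in> prime_factors g. \<not> l dvd n}" by simp
    show False
    proof (cases "l dvd n")
      case True
      then have "l dvd r * k" using ln(1) by (simp add: dvd_add_right_iff)
      then have "l dvd k" using gcd[OF l(1) ln(2) True] l(1) prime_dvd_mult_iff by blast
      then obtain q where q: "q \<in> prime_factors g" "\<not> q dvd n" "l dvd q"
        using prime_dvd_prod_iff[OF fin l(1), of "\<lambda>x. x"] by (auto simp: k_def)
      then have "l = q" using l(1) by (metis in_prime_factors_imp_prime primes_dvd_imp_eq)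
      then show False using q True by simp
    next
      case False
      then have "l \<in> {l \<in> prime_factors g. \<not> l dvd n}"
        using ln(2) l(1) assms(1) by (simp add: in_prime_factors_iff)
      then have "l dvd k" unfolding k_def using dvd_prodI[OF fin, of l "\<lambda>x. x"] by simp
      then have "l dvd n" using ln(1) by (meson dvd_add_left_iff dvd_mult)
      then show False using False by simp
    qed
  qed
  then show ?thesis using that by blast
qed

definition congruent_weights :: "'i set \<Rightarrow> nat \<Rightarrow> ('i \<Rightarrow> int) \<Rightarrow> ('i \<Rightarrow> nat) set"
  where "congruent_weights A r a =
    {m \<in> A \<rightarrow>\<^sub>E {0<..}. Gcd (m ` A) = 1 \<and> (\<forall>H\<in>A. [int (m H) = a H] (mod int r))}"

text \<open>All entries except that at \<open>h\<close> are fixed, with greatest common divisor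
  \<open>g\<close>, and the entry at \<open>h\<close> is made coprime to \<open>g\<close>. This is
  possible because a prime dividing \<open>g\<close>, \<open>n h\<close> and \<open>r\<close> would
  divide every \<open>a H\<close> and hence, by \<open>unit\<close>, also 1. The parameter
  \<open>t\<close> stays free: it later yields infinitely many vectors and controls the sum modulo
  \<open>p\<close>.\<close>

lemma congruent_weights_family:
  fixes a w :: "'i \<Rightarrow> int"
  assumes A: "finite A" "h \<in> A" "A - {h} \<noteq> {}" and r: "r \<ge> 1"
    and unit: "[(\<Sum>H\<in>A. a H * w H) = 1] (mod int r)"
  shows "\<exists>n g k. g > 0 \<and> (\<forall>H\<in>A - {h}. g dvd n H) \<and> coprime (n h + r * k) g \<and>
    (\<forall>t. (\<lambda>H\<in>A. if H = h then n h + r * k + r * g * t else n H) \<in> congruent_weights A r a)"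
proof -
  \<comment> \<open>The summand \<open>r\<close> makes the entries positive when the residue is
    0.\<close>
  define n where "n = (\<lambda>H. nat (a H mod int r) + r)"
  have n_pos: "n H > 0" for H using r by (simp add: n_def)
  have n_cong: "[int (n H) = a H] (mod int r)" for H using r by (simp add: n_def cong_def)
  define g where "g = Gcd (n ` (A - {h}))"
  have g_dvd: "g dvd n H" if "H \<in> A - {h}" for H using that by (simp add: g_def)
  have g: "g > 0" using A(3) g_dvd n_pos by (metis all_not_in_conv dvd_0_left gr0I less_irrefl)
  have "\<not> l dvd r" if l: "prime l" "l dvd g" "l dvd n h" for l
  proof
    assume lr: "l dvd r"
    have "int l dvd a H" if "H \<in> A" for H
    proof -
      have "l dvd n H" using l g_dvd[of H] that by (cases "H = h") (auto intro: dvd_trans)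
      then have "int l dvd int (n H)" by simp
      moreover have "[int (n H) = a H] (mod int l)" using n_cong lr by (metis cong_dvd_modulus int_dvd_int_iff)
      ultimately show ?thesis using cong_dvd_iff by blast
    qed
    then have "int l dvd (\<Sum>H\<in>A. a H * w H)" by (intro dvd_sum dvd_mult2)
    moreover have "[(\<Sum>H\<in>A. a H * w H) = 1] (mod int l)" using unit lr by (metis cong_dvd_modulus int_dvd_int_iff)
    ultimately have "int l dvd 1" by (simp add: cong_dvd_iff)
    then show False using l(1) by (simp add: prime_nat_iff)
  qed
  then obtain k where k: "coprime (n h + r * k) g" using coprime_in_progression[OF g, of "n h" r] by blast
  have "(\<lambda>H\<in>A. if H = h then n h + r * k + r * g * t else n H) \<in> congruent_weights A r a" for t
  proof -
    define m where "m = (\<lambda>H\<in>A. if H = h then n h + r * k + r * g * t else n H)"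
    have "m ` A = insert (n h + r * k + r * g * t) (n ` (A - {h}))"
      using A by (auto simp: m_def image_iff)
    then have "Gcd (m ` A) = gcd (n h + r * k + r * g * t) g" by (simp add: g_def)
    also have "n h + r * k + r * g * t = r * t * g + (n h + r * k)" by (simp add: algebra_simps)
    also have "gcd \<dots> g = gcd (n h + r * k) g" by (simp only: gcd.commute[of _ g] gcd_add_mult)
    finally have "Gcd (m ` A) = 1" using k by (simp add: coprime_iff_gcd_eq_1)
    moreover have "m \<in> A \<rightarrow>\<^sub>E {0<..}" using n_pos by (auto simp: m_def)
    moreover have "[int (m H) = a H] (mod int r)" if "H \<in> A" for H
    proof (cases "H = h")
      case True
      then have "int (m H) = int (n h) + int r * int (k + g * t)" using that by (simp add: m_def algebra_simps)
      then show ?thesis using n_cong[of h] True by (simp add: cong_def)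
    next
      case False
      then show ?thesis using that n_cong by (simp add: m_def)
    qed
    ultimately show ?thesis by (simp add: congruent_weights_def m_def)
  qed
  then show ?thesis using g g_dvd k by blast
qed

lemma infinite_congruent_weights:
  fixes a w :: "'i \<Rightarrow> int"
  assumes A: "finite A" "card A \<ge> 2" and r: "r \<ge> 1"
    and unit: "[(\<Sum>H\<in>A. a H * w H) = 1] (mod int r)"
  shows "infinite (congruent_weights A r a)"
proof -
  obtain h where h: "h \<in> A" using A by fastforce
  have ne: "A - {h} \<noteq> {}"
  proof
    assume "A - {h} = {}"
    then have "card A \<le> card {h}" by (intro card_mono) auto
    then show False using A(2) by simp
  qed
  obtain n g k where ngk: "g > 0" "\<And>H. H \<in> A - {h} \<Longrightarrow> g dvd n H" "coprime (n h + r * k) g"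
    "\<And>t. (\<lambda>H\<in>A. if H = h then n h + r * k + r * g * t else n H) \<in> congruent_weights A r a"
    using congruent_weights_family[OF A(1) h ne r unit] by blast
  let ?m = "\<lambda>t. (\<lambda>H\<in>A. if H = h then n h + r * k + r * g * t else n H)"
  have "inj ?m"
  proof (rule injI)
    fix s t assume "?m s = ?m t"
    then have "?m s h = ?m t h" by simp
    then show "s = t" using h r ngk(1) by simp
  qed
  then show ?thesis using ngk(4) range_inj_infinite[of ?m] by (meson image_subsetI infinite_super)
qed

text \<open>If \<open>p\<close> divides \<open>g\<close>, it divides the sum of the fixed entries
  but not the entry at \<open>h\<close>. Otherwise the sum moves with \<open>t\<close> in steps of
  \<open>r * g\<close>, prime to \<open>p\<close>, and two consecutive values cannot both be
  divisible. When \<open>A\<close> is a singleton, \<open>zero\<close> and \<open>unit\<close>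
  together force \<open>r = 1\<close>, and the entry 1 works.\<close>

lemma congruent_weights_sum_not_dvd:
  fixes a w :: "'i \<Rightarrow> int"
  assumes A: "finite A" "A \<noteq> {}" and r: "r \<ge> 1"
    and unit: "[(\<Sum>H\<in>A. a H * w H) = 1] (mod int r)" and zero: "[(\<Sum>H\<in>A. a H) = 0] (mod int r)"
    and p: "prime p" "\<not> p dvd r"
  shows "\<exists>m \<in> congruent_weights A r a. \<not> p dvd (\<Sum>H\<in>A. m H)"
proof -
  obtain h where h: "h \<in> A" using A by blast
  show ?thesis
  proof (cases "A - {h} = {}")
    case True
    then have Ah: "A = {h}" using h by auto
    have "[a h * w h = 0 * w h] (mod int r)" using zero Ah by (intro cong_scalar_right) simp
    then have "[1 = 0] (mod int r)" using unit Ah by (simp add: cong_def)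
    then have "r = 1" by (simp add: cong_0_iff)
    then have "(\<lambda>H\<in>A. 1) \<in> congruent_weights A r a" by (simp add: congruent_weights_def Ah)
    moreover have "\<not> p dvd (\<Sum>H\<in>A. (\<lambda>H\<in>A. 1) H)" using Ah p(1) by (simp add: prime_nat_iff)
    ultimately show ?thesis by blast
  next
    case False
    obtain n g k where ngk: "g > 0" "\<And>H. H \<in> A - {h} \<Longrightarrow> g dvd n H" "coprime (n h + r * k) g"
      "\<And>t. (\<lambda>H\<in>A. if H = h then n h + r * k + r * g * t else n H) \<in> congruent_weights A r a"
      using congruent_weights_family[OF A(1) h False r unit] by blast
    let ?m = "\<lambda>t. (\<lambda>H\<in>A. if H = h then n h + r * k + r * g * t else n H)"
    define S where "S = (\<Sum>H\<in>A - {h}. n H)"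
    have S: "(\<Sum>H\<in>A. ?m t H) = (n h + r * k) + r * g * t + S" for t
      using A h by (simp add: sum.remove[of A h] S_def)
    have gS: "g dvd S" using ngk(2) by (auto simp: S_def intro: dvd_sum)
    have "\<exists>t. \<not> p dvd (n h + r * k) + r * g * t + S"
    proof (cases "p dvd g")
      case True
      then have "\<not> p dvd n h + r * k"
        using ngk(3) p(1) by (metis coprime_common_divisor not_prime_unit)
      moreover have "p dvd S" using True gS by (rule dvd_trans)
      ultimately have "\<not> p dvd (n h + r * k) + r * g * 0 + S"
        by (simp add: dvd_add_left_iff)
      then show ?thesis by blast
    next
      case False
      then have "\<not> p dvd r * g" using p by (simp add: prime_dvd_mult_iff)
      then have "\<not> (p dvd (n h + r * k) + r * g * 0 + S \<and> p dvd (n h + r * k) + r * g * 1 + S)"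
        by (metis add.commute add.left_commute dvd_add_right_iff mult.right_neutral mult_zero_right add_0)
      then show ?thesis by blast
    qed
    then show ?thesis using ngk(4) S by metis
  qed
qed

section \<open>Projective complements\<close>

lemma proj_point_eq_iff:
  fixes z w :: "complex ^ 'n"
  assumes "z \<noteq> 0" "w \<noteq> 0"
  shows "proj_point z = proj_point w \<longleftrightarrow> (\<exists>c. c \<noteq> 0 \<and> w = c *s z)"
proof -
  have "proj_point z = proj_point w \<longleftrightarrow> vec.span {z} = vec.span {w}"
    unfolding proj_point_def using assms by (intro Abs_cproj_inject) auto
  also have "\<dots> \<longleftrightarrow> (\<exists>c. c \<noteq> 0 \<and> w = c *s z)"
  proof
    assume "vec.span {z} = vec.span {w}"
    then have "w \<in> vec.span {z}" using vec.span_base[of w "{w}"] by simp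
    then obtain c where "w = c *s z" unfolding vec.span_singleton by auto
    then show "\<exists>c. c \<noteq> 0 \<and> w = c *s z" using assms by auto
  next
    assume "\<exists>c. c \<noteq> 0 \<and> w = c *s z"
    then obtain c where c: "c \<noteq> 0" "w = c *s z" by blast
    then have z: "z = (1 / c) *s w" by (simp add: vec_eq_iff)
    have "(1 / c) *s w \<in> vec.span {w}" "c *s z \<in> vec.span {z}"
      by (intro vec.span_scale vec.span_base; simp)+
    then have "z \<in> vec.span {w}" "w \<in> vec.span {z}" by (simp_all only: z[symmetric] c(2)[symmetric])
    then show "vec.span {z} = vec.span {w}" by (simp add: vec.span_eq)
  qed
  finally show ?thesis .
qed

lemma continuous_on_proj_point:
  fixes S :: "(complex ^ 'n) set"
  assumes "open S" "0 \<notin> S"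
  shows "continuous_on S proj_point"
  unfolding continuous_on_open_vimage[OF assms(1)]
proof (intro allI impI)
  fix B :: "'n cproj set" assume "open B"
  then have "open {z :: complex ^ 'n. z \<noteq> 0 \<and> proj_point z \<in> B}" by (simp add: open_cproj_def)
  moreover have "proj_point -` B \<inter> S = {z. z \<noteq> 0 \<and> proj_point z \<in> B} \<inter> S" using assms(2) by auto
  ultimately show "open (proj_point -` B \<inter> S)" using assms(1) by auto
qed

locale arrangement =
  fixes A :: "(complex ^ 'n) set set" and f :: "(complex ^ 'n) set \<Rightarrow> complex ^ 'n \<Rightarrow> complex"
    and u :: "'n cproj"
  assumes central: "central_arrangement A" and nonempty: "A \<noteq> {}" and forms: "defining_forms A f"
    and u: "u \<in> proj_complement A"
begin

definition H0 :: "(complex ^ 'n) set"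
  where "H0 = (SOME H. H \<in> A)"

text \<open>The section of \<open>proj_point\<close> over \<open>proj_complement A\<close> with values in the affine chart \<open>f H0 z = 1\<close>.\<close>

definition chart :: "'n cproj \<Rightarrow> complex ^ 'n"
  where "chart L = (let z = (SOME z. z \<noteq> 0 \<and> proj_point z = L) in (1 / f H0 z) *s z)"

definition base :: "complex ^ 'n"
  where "base = chart u"

lemma H0: "H0 \<in> A"
  using nonempty by (auto simp: H0_def some_in_eq)

lemma form_hom: "K \<in> A \<Longrightarrow> module_hom (*s) (*) (f K)"
  using forms module_hom_iff_linear unfolding defining_forms_def by blast

lemma form_add: "K \<in> A \<Longrightarrow> f K (x + y) = f K x + f K y"
  using module_hom.add[OF form_hom] .

lemma form_smult: "K \<in> A \<Longrightarrow> f K (c *s x) = c * f K x"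
  using module_hom.scale[OF form_hom] .

lemma form_zero_iff: "K \<in> A \<Longrightarrow> f K z = 0 \<longleftrightarrow> z \<in> K"
  using forms unfolding defining_forms_def by blast

lemma in_complement_iff: "z \<in> arr_complement A \<longleftrightarrow> (\<forall>K\<in>A. f K z \<noteq> 0)"
  by (auto simp: arr_complement_def form_zero_iff)

lemma zero_not_in_complement: "0 \<notin> arr_complement A"
  using form_smult[OF H0, of 0 0] H0 by (auto simp: in_complement_iff)

lemma complement_smult: "z \<in> arr_complement A \<Longrightarrow> c \<noteq> 0 \<Longrightarrow> c *s z \<in> arr_complement A"
  by (simp add: in_complement_iff form_smult)

lemma proj_in_proj_complement:
  assumes "z \<noteq> 0"
  shows "proj_point z \<in> proj_complement A \<longleftrightarrow> z \<in> arr_complement A"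
proof
  assume "proj_point z \<in> proj_complement A"
  then obtain w where w: "w \<in> arr_complement A" "proj_point w = proj_point z"
    by (auto simp: proj_complement_def)
  then have "w \<noteq> 0" using zero_not_in_complement by auto
  then show "z \<in> arr_complement A" using proj_point_eq_iff[of w z] w assms complement_smult by auto
qed (auto simp: proj_complement_def)

lemma chart_proj_point:
  assumes z: "z \<in> arr_complement A"
  shows "chart (proj_point z) = (1 / f H0 z) *s z"
proof -
  have z0: "z \<noteq> 0" using z zero_not_in_complement by auto
  define w where "w = (SOME w. w \<noteq> 0 \<and> proj_point w = proj_point z)"
  have w: "w \<noteq> 0 \<and> proj_point w = proj_point z"
    unfolding w_def by (rule someI_ex) (use z0 in blast)
  then obtain c where c: "c \<noteq> 0" "w = c *s z" using proj_point_eq_iff[of z w] z0 by auto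
  have "chart (proj_point z) = (1 / f H0 w) *s w" by (simp add: chart_def w_def Let_def)
  also have "\<dots> = (1 / f H0 z) *s z" using c by (simp add: form_smult[OF H0])
  finally show ?thesis .
qed

lemma chart_in_complement: "L \<in> proj_complement A \<Longrightarrow> chart L \<in> arr_complement A"
  using chart_proj_point complement_smult in_complement_iff H0 unfolding proj_complement_def by auto

lemma proj_point_chart: "L \<in> proj_complement A \<Longrightarrow> proj_point (chart L) = L"
proof -
  assume "L \<in> proj_complement A"
  then obtain z where z: "z \<in> arr_complement A" "L = proj_point z" by (auto simp: proj_complement_def)
  then have "z \<noteq> 0" "f H0 z \<noteq> 0" using zero_not_in_complement in_complement_iff H0 by auto
  then have "proj_point z = proj_point ((1 / f H0 z) *s z)"
    by (subst proj_point_eq_iff) auto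
  then show ?thesis using z chart_proj_point by metis
qed

lemma base_in_complement: "base \<in> arr_complement A"
  using chart_in_complement u by (simp add: base_def)

lemma proj_point_base: "proj_point base = u"
  using proj_point_chart u by (simp add: base_def)

sublocale hyperplane_forms A f base
proof
  show "finite A" using central by (simp add: central_arrangement_def)
  fix K assume K: "K \<in> A"
  show "f K (x + y) = f K x + f K y" for x y by (rule form_add[OF K])
  show "f K (c *s x) = c * f K x" for c x by (rule form_smult[OF K])
  show "f K base \<noteq> 0" using base_in_complement K by (simp add: in_complement_iff)
next
  fix H K assume HK: "H \<in> A" "K \<in> A" "H \<noteq> K"
  have "\<not> H \<subseteq> K"
  proof
    assume "H \<subseteq> K"
    moreover have "vec.subspace H" "vec.subspace K" "vec.dim K \<le> vec.dim H"
      using HK central unfolding central_arrangement_def by (metis, metis, metis add_right_cancel order_refl)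
    ultimately show False using vec.subspace_dim_equal HK by blast
  qed
  then show "\<exists>d. f H d = 0 \<and> f K d \<noteq> 0" using HK form_zero_iff by blast
qed

lemma M_eq: "M = arr_complement A"
  by (auto simp: M_def in_complement_iff)

lemma continuous_on_M_proj_point: "continuous_on M proj_point"
  using continuous_on_proj_point open_M zero_not_in_complement by (simp add: M_eq)

lemma proj_point_M: "proj_point ` M = proj_complement A"
  by (simp add: M_eq proj_complement_def)

lemma proj_point_in [intro]: "z \<in> M \<Longrightarrow> proj_point z \<in> proj_complement A"
  using proj_point_M by blast

lemma open_proj_complement: "open (proj_complement A)"
proof -
  have "{z. z \<noteq> 0 \<and> proj_point z \<in> proj_complement A} = M"
    using proj_in_proj_complement zero_not_in_complement proj_point_in unfolding M_eq by blast
  then show ?thesis using open_M by (simp add: open_cproj_def)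
qed

text \<open>In the quotient topology openness is tested after pulling back along
  \<open>proj_point\<close>, where the chart becomes division of \<open>z\<close> by
  \<open>f H0 z\<close>.\<close>

lemma continuous_on_chart: "continuous_on (proj_complement A) chart"
  unfolding continuous_on_open_vimage[OF open_proj_complement]
proof (intro allI impI)
  fix B :: "(complex ^ 'n) set" assume B: "open B"
  have "{z. z \<noteq> 0 \<and> proj_point z \<in> chart -` B \<inter> proj_complement A} = (\<lambda>z. (1 / f H0 z) *s z) -` B \<inter> M"
  proof (rule Set.set_eqI)
    fix z :: "complex ^ 'n"
    show "z \<in> {z. z \<noteq> 0 \<and> proj_point z \<in> chart -` B \<inter> proj_complement A} \<longleftrightarrow>
        z \<in> (\<lambda>z. (1 / f H0 z) *s z) -` B \<inter> M"
    proof (cases "z \<in> arr_complement A")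
      case True
      then have "z \<noteq> 0" "proj_point z \<in> proj_complement A"
        using zero_not_in_complement proj_point_in M_eq by auto
      then show ?thesis using True chart_proj_point by (simp add: M_eq)
    next
      case False
      then show ?thesis using proj_in_proj_complement[of z] by (auto simp: M_eq)
    qed
  qed
  moreover have "continuous_on M (\<lambda>z. (1 / f H0 z) *s z)"
    using H0 by (intro continuous_intros f_continuous) (auto simp: M_def)
  then have "open ((\<lambda>z. (1 / f H0 z) *s z) -` B \<inter> M)"
    using B by (simp add: continuous_on_open_vimage[OF open_M])
  ultimately show "open (chart -` B \<inter> proj_complement A)" by (simp add: open_cproj_def)
qed

lemma proj_path:
  assumes "path g" "path_image g \<subseteq> M"
  shows "path (proj_point \<circ> g)" "path_image (proj_point \<circ> g) \<subseteq> proj_complement A"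
proof -
  show "path (proj_point \<circ> g)"
    using assms continuous_on_M_proj_point by (intro path_continuous_image) (auto intro: continuous_on_subset)
  show "path_image (proj_point \<circ> g) \<subseteq> proj_complement A"
    using assms(2) proj_point_M by (auto simp: path_image_compose)
qed

lemma proj_homotopic:
  "homotopic_paths M g h \<Longrightarrow> homotopic_paths (proj_complement A) (proj_point \<circ> g) (proj_point \<circ> h)"
  using homotopic_paths_continuous_image[OF _ continuous_on_M_proj_point] proj_point_M by blast

end

lemma loop_class_eq:
  assumes "homotopic_paths S g h"
  shows "loop_class S g = loop_class S h"
  using assms homotopic_paths_trans homotopic_paths_sym unfolding loop_class_def by blast

lemma loop_class_mult:
  assumes g: "g \<in> loops_at S a" and h: "h \<in> loops_at S a"
  shows "monoid.mult (fundamental_group S a) (loop_class S g) (loop_class S h) = loop_class S (g +++ h)"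
proof -
  have "loop_class S (g' +++ h') = loop_class S (g +++ h)"
    if "g' \<in> loop_class S g" "h' \<in> loop_class S h" for g' h'
  proof (intro loop_class_eq homotopic_paths_join)
    show gg: "homotopic_paths S g' g" and hh: "homotopic_paths S h' h"
      using that homotopic_paths_sym by (auto simp: loop_class_def)
    show "pathfinish g' = pathstart h'"
      using homotopic_paths_imp_pathfinish[OF gg] homotopic_paths_imp_pathstart[OF hh] g h
      by (simp add: loops_at_def)
  qed
  moreover have "g \<in> loop_class S g" "h \<in> loop_class S h"
    using g h by (auto simp: loop_class_def loops_at_def)
  ultimately have "(\<Union>g'\<in>loop_class S g. \<Union>h'\<in>loop_class S h. loop_class S (g' +++ h')) = loop_class S (g +++ h)"
    by blast
  then show ?thesis by (simp add: fundamental_group_def)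
qed

section \<open>Lifting the Milnor fiber\<close>

locale arrangement_cover = arrangement A f u
  for A :: "(complex ^ 'n) set set" and f :: "(complex ^ 'n) set \<Rightarrow> complex ^ 'n \<Rightarrow> complex"
    and u :: "'n cproj" +
  fixes r :: nat and chi :: "(real \<Rightarrow> 'n cproj) set \<Rightarrow> int"
    and E :: "'x::topological_space set" and \<kappa> :: "'x \<Rightarrow> 'n cproj"
  assumes r: "r \<ge> 1"
    and chi: "chi \<in> epi (fundamental_group (proj_complement A) u) (integer_mod_group r)"
    and cover: "is_cover_for (proj_complement A) u
      (kernel (fundamental_group (proj_complement A) u) (integer_mod_group r) chi) E \<kappa>"
begin

section \<open>The character pulled back to loops and paths in the complement\<close>

definition base_loop :: "(real \<Rightarrow> complex ^ 'n) \<Rightarrow> bool"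
  where "base_loop g \<longleftrightarrow> path g \<and> path_image g \<subseteq> M \<and> pathstart g = base \<and> pathfinish g = base"

definition loop_char :: "(real \<Rightarrow> complex ^ 'n) \<Rightarrow> int"
  where "loop_char g = chi (loop_class (proj_complement A) (proj_point \<circ> g))"

lemma base_loop_proj: "base_loop g \<Longrightarrow> proj_point \<circ> g \<in> loops_at (proj_complement A) u"
  using proj_path proj_point_base unfolding base_loop_def loops_at_def
  by (auto simp: pathstart_compose pathfinish_compose)

lemma base_loop_class:
  "base_loop g \<Longrightarrow> loop_class (proj_complement A) (proj_point \<circ> g) \<in> carrier (fundamental_group (proj_complement A) u)"
  using base_loop_proj by (auto simp: fundamental_group_def)

lemma loop_char_range: "base_loop g \<Longrightarrow> loop_char g \<in> {0..<int r}"
  using chi base_loop_class[of g] r unfolding loop_char_def epi_def carrier_integer_mod_group hom_def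
  by (auto simp: carrier_integer_mod_group Pi_iff)

lemma loop_char_join:
  assumes "base_loop g" "base_loop h"
  shows "loop_char (g +++ h) = (loop_char g + loop_char h) mod int r"
proof -
  have "chi \<in> hom (fundamental_group (proj_complement A) u) (integer_mod_group r)"
    using chi by (simp add: epi_def)
  then show ?thesis
    using hom_mult[OF \<open>chi \<in> hom _ _\<close> base_loop_class[OF assms(1)] base_loop_class[OF assms(2)]]
      loop_class_mult[OF base_loop_proj[OF assms(1)] base_loop_proj[OF assms(2)]]
    by (simp add: loop_char_def path_compose_join)
qed

lemma loop_char_homotopic: "homotopic_paths M g h \<Longrightarrow> loop_char g = loop_char h"
  using loop_class_eq[OF proj_homotopic] by (simp add: loop_char_def)

text \<open>The chart is a continuous section that sends \<open>u\<close> to \<open>base\<close>, so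
  every loop at \<open>u\<close> is the projection of a base loop and surjectivity survives the
  pullback.\<close>

lemma loop_char_surj:
  assumes "0 \<le> j" "j < int r"
  obtains g where "base_loop g" "loop_char g = j"
proof -
  have "j \<in> chi ` carrier (fundamental_group (proj_complement A) u)"
    using chi assms unfolding epi_def by (auto simp: carrier_integer_mod_group)
  then obtain g where g: "g \<in> loops_at (proj_complement A) u" "chi (loop_class (proj_complement A) g) = j"
    by (auto simp: fundamental_group_def)
  have g': "path g" "path_image g \<subseteq> proj_complement A" "pathstart g = u" "pathfinish g = u"
    using g by (auto simp: loops_at_def)
  have "base_loop (chart \<circ> g)"
    unfolding base_loop_def
  proof (intro conjI)
    show "path (chart \<circ> g)"
      using g' continuous_on_chart by (intro path_continuous_image) (auto intro: continuous_on_subset)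
    show "path_image (chart \<circ> g) \<subseteq> M"
      using g'(2) chart_in_complement by (auto simp: path_image_compose M_eq)
  qed (use g' in \<open>auto simp: pathstart_compose pathfinish_compose base_def\<close>)
  moreover have "homotopic_paths (proj_complement A) g (proj_point \<circ> (chart \<circ> g))"
  proof (rule homotopic_paths_eq[OF g'(1,2)])
    fix t :: real assume "t \<in> {0..1}"
    then have "g t \<in> proj_complement A" using g'(2) by (auto simp: path_image_def)
    then show "g t = (proj_point \<circ> (chart \<circ> g)) t" by (simp add: proj_point_chart)
  qed
  then have "loop_char (chart \<circ> g) = j" using g(2) loop_class_eq unfolding loop_char_def by metis
  ultimately show ?thesis using that by blast
qed

text \<open>Choosing the constant path at \<open>base\<close> ensures that tethering changes a base
  loop only by a homotopy.\<close>

definition tether :: "complex ^ 'n \<Rightarrow> real \<Rightarrow> complex ^ 'n"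
  where "tether x = (if x = base then linepath base base else
    (SOME g. path g \<and> path_image g \<subseteq> M \<and> pathstart g = base \<and> pathfinish g = x))"

lemma base_M: "base \<in> M"
  by (rule v0_in_M)

lemma tether:
  assumes "x \<in> M"
  shows "path (tether x)" "path_image (tether x) \<subseteq> M" "pathstart (tether x) = base" "pathfinish (tether x) = x"
proof -
  have "\<exists>g. path g \<and> path_image g \<subseteq> M \<and> pathstart g = base \<and> pathfinish g = x"
    using path_connected_M base_M assms unfolding path_connected_def by blast
  from someI_ex[OF this] have "path (tether x) \<and> path_image (tether x) \<subseteq> M \<and> pathstart (tether x) = base \<and> pathfinish (tether x) = x"
    using base_M by (simp add: tether_def)
  then show "path (tether x)" "path_image (tether x) \<subseteq> M" "pathstart (tether x) = base" "pathfinish (tether x) = x"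
    by auto
qed

text \<open>Closing paths up at \<open>base\<close> extends the character from the fundamental group
  to the groupoid.\<close>

definition tethered :: "(real \<Rightarrow> complex ^ 'n) \<Rightarrow> real \<Rightarrow> complex ^ 'n"
  where "tethered g = tether (pathstart g) +++ g +++ reversepath (tether (pathfinish g))"

lemma tethered_base_loop:
  assumes "path g" "path_image g \<subseteq> M"
  shows "base_loop (tethered g)"
proof -
  have "pathstart g \<in> M" "pathfinish g \<in> M" using assms by auto
  then show ?thesis using tether assms by (auto simp: base_loop_def tethered_def path_image_join)
qed

text \<open>Between the two pieces the tether of the common point is run backwards and then
  forwards, and cancels; the rest is reassociation.\<close>

lemma tethered_join:
  assumes g: "path g" "path_image g \<subseteq> M" and h: "path h" "path_image h \<subseteq> M" and gh: "pathfinish g = pathstart h"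
  shows "homotopic_paths M (tethered g +++ tethered h) (tethered (g +++ h))"
proof -
  define a where "a = tether (pathstart g)"
  define b where "b = tether (pathstart h)"
  define c where "c = reversepath (tether (pathfinish h))"
  have ends: "pathstart g \<in> M" "pathstart h \<in> M" "pathfinish h \<in> M" using g h by auto
  have a: "path a" "path_image a \<subseteq> M" "pathfinish a = pathstart g"
    and b: "path b" "path_image b \<subseteq> M" "pathstart b = base" "pathfinish b = pathstart h"
    and c: "path c" "path_image c \<subseteq> M" "pathstart c = pathfinish h"
    using tether ends by (simp_all add: a_def b_def c_def)
  note f = a b c g h gh
  let ?k = "h +++ c"
  have k: "path ?k" "path_image ?k \<subseteq> M" "pathstart ?k = pathstart h"
    using h c by (auto simp: path_image_join)
  have left: "homotopic_paths M (p +++ q) (p +++ q')"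
    if "path p" "path_image p \<subseteq> M" "homotopic_paths M q q'" "pathfinish p = pathstart q" for p q q'
    using that by (intro homotopic_paths_join) auto
  have "homotopic_paths M ((g +++ reversepath b) +++ (b +++ ?k)) (g +++ (reversepath b +++ (b +++ ?k)))"
    using f k by (intro homotopic_paths_sym[OF homotopic_paths_assoc]) (auto simp: path_image_join)
  also have "homotopic_paths M \<dots> (g +++ ((reversepath b +++ b) +++ ?k))"
    using f k by (intro left homotopic_paths_assoc) (auto simp: path_image_join)
  also have "homotopic_paths M \<dots> (g +++ (linepath (pathstart h) (pathstart h) +++ ?k))"
  proof (intro left)
    show "homotopic_paths M ((reversepath b +++ b) +++ ?k) (linepath (pathstart h) (pathstart h) +++ ?k)"
      using f k homotopic_paths_linv[OF b(1,2)] by (intro homotopic_paths_join[of M _ _ ?k ?k]) auto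
  qed (use f in auto)
  also have "homotopic_paths M \<dots> (g +++ ?k)"
    using f k homotopic_paths_lid[OF k(1,2)] by (intro left) auto
  also have "homotopic_paths M \<dots> ((g +++ h) +++ c)"
    using f by (intro homotopic_paths_assoc) auto
  finally have inner: "homotopic_paths M ((g +++ reversepath b) +++ (b +++ ?k)) ((g +++ h) +++ c)" .
  have "homotopic_paths M ((a +++ (g +++ reversepath b)) +++ (b +++ ?k)) (a +++ ((g +++ reversepath b) +++ (b +++ ?k)))"
    using f k by (intro homotopic_paths_sym[OF homotopic_paths_assoc]) (auto simp: path_image_join)
  also have "homotopic_paths M \<dots> (a +++ ((g +++ h) +++ c))"
    using f k inner by (intro left) (auto simp: path_image_join)
  finally show ?thesis using gh by (simp add: tethered_def a_def b_def c_def)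
qed

lemma tethered_homotopic:
  assumes "homotopic_paths M g h"
  shows "homotopic_paths M (tethered g) (tethered h)"
proof -
  have "pathstart g \<in> M" "pathfinish g \<in> M"
    using homotopic_paths_imp_subset[OF assms] by auto
  then show ?thesis
    using tether assms homotopic_paths_imp_pathstart[OF assms] homotopic_paths_imp_pathfinish[OF assms]
    unfolding tethered_def by (auto intro!: homotopic_paths_join)
qed

lemma tethered_homotopic_base:
  assumes "base_loop g"
  shows "homotopic_paths M (tethered g) g"
proof -
  have g: "path g" "path_image g \<subseteq> M" "pathstart g = base" "pathfinish g = base"
    using assms by (auto simp: base_loop_def)
  have t: "tethered g = linepath base base +++ (g +++ linepath base base)"
    using g by (simp add: tethered_def tether_def)
  have "homotopic_paths M (linepath base base +++ (g +++ linepath base base)) (g +++ linepath base base)"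
    using g base_M by (intro homotopic_paths_lid') (auto simp: path_image_join)
  also have "homotopic_paths M \<dots> g" using g by (intro homotopic_paths_rid') auto
  finally show ?thesis by (simp only: t)
qed

text \<open>Embeds the integers modulo \<open>r\<close> as the \<open>r\<close>-th roots of unity,
  since a \<open>path_character\<close> is multiplicative with complex values.\<close>

definition root_exp :: "int \<Rightarrow> complex"
  where "root_exp k = exp (2 * of_real pi * \<i> * of_int k / of_nat r)"

lemma root_exp_eq_iff: "root_exp j = root_exp k \<longleftrightarrow> [j = k] (mod int r)"
proof -
  have r0: "(of_nat r :: complex) \<noteq> 0" using r by simp
  define c where "c = 2 * of_real pi * \<i>"
  have c0: "c \<noteq> 0" by (simp add: c_def)
  have "root_exp j = root_exp k \<longleftrightarrow> (\<exists>n::int. c * of_int j / of_nat r =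
      c * of_int k / of_nat r + (of_int (2 * n) * pi) * (\<i>::complex))"
    unfolding root_exp_def exp_eq c_def ..
  also have "\<dots> \<longleftrightarrow> (\<exists>n::int. c * of_int j / of_nat r = c * of_int (k + n * int r) / of_nat r)"
  proof (intro ex_cong1)
    fix n :: int
    have "c * of_int k / of_nat r + (of_int (2 * n) * pi) * \<i> = c * of_int (k + n * int r) / of_nat r"
      using r0 by (simp add: c_def field_simps)
    then show "(c * of_int j / of_nat r = c * of_int k / of_nat r + (of_int (2 * n) * pi) * \<i>) \<longleftrightarrow>
        (c * of_int j / of_nat r = c * of_int (k + n * int r) / of_nat r)" by simp
  qed
  also have "\<dots> \<longleftrightarrow> (\<exists>n::int. (of_int j :: complex) = of_int (k + n * int r))"
    using r0 c0 by (simp only: divide_cancel_right mult_cancel_left) simp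
  also have "\<dots> \<longleftrightarrow> (\<exists>n::int. j = k + n * int r)" by (simp only: of_int_eq_iff)
  also have "\<dots> \<longleftrightarrow> [j = k] (mod int r)"
    by (metis cong_iff_lin cong_sym mult.commute)
  finally show ?thesis .
qed

lemma root_exp_add: "root_exp (j + k) = root_exp j * root_exp k"
  by (simp add: root_exp_def exp_add[symmetric] add_divide_distrib[symmetric] distrib_left)

definition Phi :: "(real \<Rightarrow> complex ^ 'n) \<Rightarrow> complex"
  where "Phi g = root_exp (loop_char (tethered g))"

sublocale path_character A f base Phi
proof
  fix g h assume gh: "path g" "path_image g \<subseteq> M" "path h" "path_image h \<subseteq> M" "pathfinish g = pathstart h"
  have "loop_char (tethered (g +++ h)) = (loop_char (tethered g) + loop_char (tethered h)) mod int r"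
    using loop_char_homotopic[OF tethered_join[OF gh]] loop_char_join tethered_base_loop gh by simp
  then have "[loop_char (tethered (g +++ h)) = loop_char (tethered g) + loop_char (tethered h)] (mod int r)" by (simp add: cong_def)
  then show "Phi (g +++ h) = Phi g * Phi h"
    unfolding Phi_def root_exp_add[symmetric] root_exp_eq_iff .
next
  fix g h assume "homotopic_paths M g h"
  then show "Phi g = Phi h" using loop_char_homotopic[OF tethered_homotopic] by (simp add: Phi_def)
qed (simp add: Phi_def root_exp_def)

text \<open>The values of \<open>Phi\<close> are \<open>r\<close>-th roots of unity, so the
  exponents at the meridians can be chosen as integers \<open>a H\<close> times
  \<open>2 * pi * \<i> / r\<close>. The function \<open>w\<close> carries the windings as integers,
  because \<open>wind\<close> is complex-valued.\<close>

lemma loop_char_winding: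
  obtains a where "\<And>g w. base_loop g \<Longrightarrow> (\<And>H. H \<in> A \<Longrightarrow> wind H g = of_int (w H)) \<Longrightarrow>
    [loop_char g = (\<Sum>H\<in>A. a H * w H)] (mod int r)"
proof -
  define L where "L = range (\<lambda>k::int. 2 * of_real pi * \<i> * of_int k / (of_nat r :: complex))"
  have L: "\<exists>l\<in>L. Phi g = exp l" for g
    using rangeI[of "\<lambda>k::int. 2 * of_real pi * \<i> * of_int k / (of_nat r :: complex)" "loop_char (tethered g)"]
    by (intro bexI[of _ "2 * of_real pi * \<i> * of_int (loop_char (tethered g)) / of_nat r"])
       (simp_all only: L_def Phi_def root_exp_def)
  obtain c where c: "\<And>H. H \<in> A \<Longrightarrow> c H \<in> L"
    "\<And>g. path g \<Longrightarrow> path_image g \<subseteq> M \<Longrightarrow> pathfinish g = pathstart g \<Longrightarrow> Phi g = exp (\<Sum>H\<in>A. c H * wind H g)"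
    using \<Phi>_loop_winding[of L] L by blast
  have "\<forall>H\<in>A. \<exists>k::int. c H = 2 * of_real pi * \<i> * of_int k / of_nat r" using c(1) unfolding L_def by blast
  then obtain a :: "(complex ^ 'n) set \<Rightarrow> int"
    where a: "\<And>H. H \<in> A \<Longrightarrow> c H = 2 * of_real pi * \<i> * of_int (a H) / of_nat r" by metis
  have "[loop_char g = (\<Sum>H\<in>A. a H * w H)] (mod int r)"
    if g: "base_loop g" and w: "\<And>H. H \<in> A \<Longrightarrow> wind H g = of_int (w H)" for g w
  proof -
    have "(\<Sum>H\<in>A. c H * wind H g) = (\<Sum>H\<in>A. 2 * of_real pi * \<i> / of_nat r * of_int (a H * w H))"
      using a w by (intro sum.cong) auto
    also have "\<dots> = 2 * of_real pi * \<i> * of_int (\<Sum>H\<in>A. a H * w H) / of_nat r"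
      by (simp add: sum_distrib_left sum_divide_distrib)
    finally have "Phi g = root_exp (\<Sum>H\<in>A. a H * w H)"
      using c(2)[of g] g by (simp add: base_loop_def root_exp_def)
    moreover have "Phi g = root_exp (loop_char g)"
      using loop_char_homotopic[OF tethered_homotopic_base[OF g]] by (simp add: Phi_def)
    ultimately show ?thesis using root_exp_eq_iff by simp
  qed
  then show ?thesis using that by blast
qed

lemma base_loop_winding:
  assumes "base_loop g"
  obtains w where "\<And>H. H \<in> A \<Longrightarrow> wind H g = of_int (w H)"
proof -
  have "\<forall>H\<in>A. \<exists>k::int. wind H g = of_int k"
    using wind_loop_Ints assms unfolding base_loop_def Ints_def by fastforce
  then show ?thesis using that by metis
qed

text \<open>The unit circle acting on \<open>base\<close>. Its projection is constant, so its value
  under the character equals its own double and vanishes. Inserted into the winding formula, this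
  loop yields the vanishing of the sum of the \<open>a H\<close> modulo \<open>r\<close>.\<close>

lemma fibre_loop:
  obtains g where "base_loop g" "loop_char g = 0" "\<And>H. H \<in> A \<Longrightarrow> wind H g = 1"
proof -
  define g where "g = (\<lambda>t::real. exp (2 * of_real pi * \<i> * of_real t) *s base)"
  have gM: "g t \<in> M" for t using base_M by (simp add: g_def M_def f_smult)
  have g: "base_loop g"
    unfolding base_loop_def
  proof (intro conjI)
    show "path g" unfolding path_def g_def by (intro continuous_intros)
    show "path_image g \<subseteq> M" using gM by (auto simp: path_image_def)
  qed (auto simp: pathstart_def pathfinish_def g_def)
  have const: "proj_point (g t) = u" for t
  proof -
    have "base \<noteq> 0" "g t \<noteq> 0" using base_M gM[of t] zero_not_in_complement by (auto simp: M_eq)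
    then have "proj_point base = proj_point (g t)"
      by (subst proj_point_eq_iff) (auto simp: g_def)
    then show ?thesis by (simp add: proj_point_base)
  qed
  have "proj_point \<circ> (g +++ g) = proj_point \<circ> g" using const by (auto simp: joinpaths_def fun_eq_iff)
  then have "loop_char (g +++ g) = loop_char g" by (simp add: loop_char_def)
  then have "loop_char g = (loop_char g + loop_char g) mod int r" using loop_char_join[OF g g] by simp
  then have "loop_char g mod int r = 0" by (metis add_diff_cancel_left' diff_self mod_0 mod_diff_left_eq mod_diff_right_eq)
  then have "loop_char g = 0" using loop_char_range[OF g] by simp
  moreover have "wind H g = 1" if H: "H \<in> A" for H
  proof -
    have fb: "f H base \<noteq> 0" using base_M H by (simp add: M_def)
    define p where "p = (\<lambda>t::real. 2 * of_real pi * \<i> * of_real t + Ln (f H base))"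
    have "f H \<circ> g = exp \<circ> p" using fb by (simp add: fun_eq_iff g_def p_def f_smult H exp_add)
    moreover have "path p" unfolding path_def p_def by (intro continuous_intros)
    ultimately show ?thesis
      unfolding wind_def by (simp add: winding_number_compose_exp) (simp add: p_def pathstart_def pathfinish_def)
  qed
  ultimately show ?thesis using that g by blast
qed

end

section \<open>Change of the forms along paths and short segments\<close>

context hyperplane_forms
begin

lemma f_path_end:
  assumes "K \<in> A" "path g" "path_image g \<subseteq> M"
  shows "f K (pathfinish g) = exp (2 * of_real pi * \<i> * wind K g) * f K (pathstart g)"
  using winding_number_exp_2pi[OF f_path[OF assms]] by (simp add: wind_def pathfinish_compose pathstart_compose)

text \<open>Under the condition \<open>near\<close> the quotient of \<open>f K\<close> by its
  initial value stays in the right half-plane, where the principal logarithm is a continuous branch.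
  The formula makes the winding of the segment continuous in its end \<open>z'\<close>.\<close>

lemma wind_linepath:
  assumes K: "K \<in> A" and near: "norm (f K z' - f K z) < norm (f K z)"
  shows "wind K (linepath z z') = Ln (f K z' / f K z) / (2 * of_real pi * \<i>)"
proof -
  define c where "c = f K z"
  have c: "c \<noteq> 0" using near by (auto simp: c_def)
  define q where "q = linepath 1 (f K z' / c)"
  have "norm (f K z' / c - 1) < 1"
  proof -
    have "f K z' / c - 1 = (f K z' - c) / c" using c by (simp add: field_simps)
    then show ?thesis using near c by (simp add: norm_divide c_def)
  qed
  then have "1 \<in> ball (1::complex) 1" "f K z' / c \<in> ball 1 1" by (auto simp: dist_norm norm_minus_commute)
  then have seg: "closed_segment 1 (f K z' / c) \<subseteq> ball 1 1" by (intro closed_segment_subset convex_ball)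
  have q_ball: "q t \<notin> \<real>\<^sub>\<le>\<^sub>0" "q t \<noteq> 0" if "t \<in> {0..1}" for t
  proof -
    have "q t \<in> path_image q" using that by (auto simp: path_image_def)
    then have "norm (1 - q t) < 1" using seg by (auto simp: q_def dist_norm)
    then have "Re (1 - q t) < 1" using complex_Re_le_cmod[of "1 - q t"] by linarith
    then have "Re (q t) > 0" by simp
    then show "q t \<notin> \<real>\<^sub>\<le>\<^sub>0" "q t \<noteq> 0" by (auto simp: complex_nonpos_Reals_iff)
  qed
  define p where "p = (\<lambda>t. Ln (q t) + Ln c)"
  have "path p"
    using q_ball unfolding path_def p_def q_def by (intro continuous_intros) (auto simp: q_def)
  have fq: "f K (linepath z z' t) = c * q t" for t
  proof -
    have "f K (linepath z z' t) = (1 - t) *\<^sub>R c + t *\<^sub>R f K z'"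
      by (simp only: linepath_def f_add[OF K] f_scaleR[OF K] c_def)
    also have "\<dots> = c * q t" using c by (simp add: q_def linepath_def scaleR_conv_of_real field_simps)
    finally show ?thesis .
  qed
  have "wind K (linepath z z') = winding_number (exp \<circ> p) 0"
    unfolding wind_def
    by (rule winding_number_cong) (use q_ball c fq in \<open>auto simp: p_def exp_add\<close>)
  also have "\<dots> = (pathfinish p - pathstart p) / (2 * of_real pi * \<i>)"
    by (rule winding_number_compose_exp) fact
  also have "pathfinish p - pathstart p = Ln (f K z' / f K z)"
    by (simp add: p_def pathfinish_def pathstart_def q_def linepath_def c_def)
  finally show ?thesis .
qed

end

section \<open>Lifts of projected paths to the cover\<close>

context arrangement_cover
begin

abbreviation U :: "'n cproj set"
  where "U \<equiv> proj_complement A"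

definition e0 :: 'x
  where "e0 = (SOME e. e \<in> E \<and> \<kappa> e = u \<and> (\<lambda>g. loop_class U (\<kappa> \<circ> g)) ` loops_at E e =
      kernel (fundamental_group U u) (integer_mod_group r) chi)"

lemma e0: "e0 \<in> E" "\<kappa> e0 = u" "(\<lambda>g. loop_class U (\<kappa> \<circ> g)) ` loops_at E e0 =
    kernel (fundamental_group U u) (integer_mod_group r) chi"
proof -
  have "\<exists>e. e \<in> E \<and> \<kappa> e = u \<and> (\<lambda>g. loop_class U (\<kappa> \<circ> g)) ` loops_at E e =
      kernel (fundamental_group U u) (integer_mod_group r) chi"
    using cover unfolding is_cover_for_def by blast
  from someI_ex[OF this] show "e0 \<in> E" "\<kappa> e0 = u" "(\<lambda>g. loop_class U (\<kappa> \<circ> g)) ` loops_at E e0 =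
      kernel (fundamental_group U u) (integer_mod_group r) chi"
    unfolding e0_def by blast+
qed

lemma cov: "covering_space E \<kappa> U"
  using cover by (simp add: is_cover_for_def)

definition lifts :: "(real \<Rightarrow> complex ^ 'n) \<Rightarrow> (real \<Rightarrow> 'x) \<Rightarrow> bool"
  where "lifts g h \<longleftrightarrow> path h \<and> path_image h \<subseteq> E \<and> pathstart h = e0 \<and> (\<forall>t\<in>{0..1}. \<kappa> (h t) = proj_point (g t))"

definition path_to :: "complex ^ 'n \<Rightarrow> (real \<Rightarrow> complex ^ 'n) \<Rightarrow> bool"
  where "path_to z g \<longleftrightarrow> path g \<and> path_image g \<subseteq> M \<and> pathstart g = base \<and> pathfinish g = z"

lemma lifts_exist:
  assumes "path_to z g"
  obtains h where "lifts g h"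
proof -
  have g: "path g" "path_image g \<subseteq> M" "pathstart g = base" using assms by (auto simp: path_to_def)
  have "\<kappa> e0 = pathstart (proj_point \<circ> g)"
    using g(3) e0(2) proj_point_base by (simp add: pathstart_compose)
  then obtain h where "path h" "path_image h \<subseteq> E" "pathstart h = e0" "\<And>t. t \<in> {0..1} \<Longrightarrow> \<kappa> (h t) = (proj_point \<circ> g) t"
    using covering_path_lift[OF cov proj_path[OF g(1,2)] e0(1)] by blast
  then have "lifts g h" by (simp add: lifts_def)
  then show ?thesis by (rule that)
qed

text \<open>The loop \<open>g1 +++ reversepath g2\<close> projects into the kernel of
  \<open>chi\<close>, so its class comes from a loop \<open>l\<close> of \<open>E\<close> at
  \<open>e0\<close>. The projection of \<open>g1\<close> is therefore homotopic to
  \<open>\<kappa> \<circ> l\<close> followed by the projection of \<open>g2\<close>, and monodromy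
  compares \<open>h1\<close> with \<open>l +++ h2\<close>.\<close>

lemma lifts_same_end:
  assumes g1: "path_to z g1" and g2: "path_to z g2" and X0: "loop_char (g1 +++ reversepath g2) = 0"
    and h: "lifts g1 h1" "lifts g2 h2"
  shows "pathfinish h1 = pathfinish h2"
proof -
  have g: "path g1" "path_image g1 \<subseteq> M" "path g2" "path_image g2 \<subseteq> M" "pathstart g1 = base" "pathstart g2 = base"
    "pathfinish g1 = pathfinish g2" using g1 g2 by (auto simp: path_to_def)
  have loop: "base_loop (g1 +++ reversepath g2)" using g by (auto simp: base_loop_def path_image_join)
  have "loop_class U (proj_point \<circ> (g1 +++ reversepath g2)) \<in> kernel (fundamental_group U u) (integer_mod_group r) chi"
    using base_loop_class[OF loop] X0 by (simp add: kernel_def loop_char_def)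
  then obtain l where l: "l \<in> loops_at E e0"
    "loop_class U (proj_point \<circ> (g1 +++ reversepath g2)) = loop_class U (\<kappa> \<circ> l)"
    unfolding e0(3)[symmetric] by blast
  have lE: "path l" "path_image l \<subseteq> E" "pathstart l = e0" "pathfinish l = e0"
    using l(1) by (auto simp: loops_at_def)
  have k: "path (\<kappa> \<circ> l)" "path_image (\<kappa> \<circ> l) \<subseteq> U"
    using lE covering_space_imp_continuous[OF cov] covering_space_imp_surjective[OF cov]
    by (auto intro!: path_continuous_image intro: continuous_on_subset simp: path_image_compose)
  have "\<kappa> \<circ> l \<in> loop_class U (\<kappa> \<circ> l)" using k by (simp add: loop_class_def)
  then have hom: "homotopic_paths U (proj_point \<circ> (g1 +++ reversepath g2)) (\<kappa> \<circ> l)"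
    using l(2) by (metis loop_class_def mem_Collect_eq)
  have "homotopic_paths M g1 (g1 +++ linepath (pathfinish g1) (pathfinish g1))"
    using g by (intro homotopic_paths_sym[OF homotopic_paths_rid]) auto
  also have "homotopic_paths M \<dots> (g1 +++ (reversepath g2 +++ g2))"
    using g homotopic_paths_sym[OF homotopic_paths_linv[OF g(3,4)]]
    by (intro homotopic_paths_join[of M g1 g1]) auto
  also have "homotopic_paths M \<dots> ((g1 +++ reversepath g2) +++ g2)"
    using g by (intro homotopic_paths_assoc) auto
  finally have "homotopic_paths U (proj_point \<circ> g1) ((proj_point \<circ> (g1 +++ reversepath g2)) +++ (proj_point \<circ> g2))"
    using proj_homotopic path_compose_join by metis
  also have "homotopic_paths U \<dots> ((\<kappa> \<circ> l) +++ (proj_point \<circ> g2))"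
    using hom proj_path[OF g(3,4)] g by (intro homotopic_paths_join) (auto simp: pathfinish_compose pathstart_compose)
  finally have hom': "homotopic_paths U (proj_point \<circ> g1) ((\<kappa> \<circ> l) +++ (proj_point \<circ> g2))" .
  have "pathfinish h1 = pathfinish (l +++ h2)"
  proof (rule covering_monodromy[OF cov hom'])
    show "path h1" "path_image h1 \<subseteq> E" "path (l +++ h2)" "path_image (l +++ h2) \<subseteq> E"
      "pathstart h1 = pathstart (l +++ h2)"
      using h lE by (auto simp: lifts_def path_image_join)
    show "\<kappa> (h1 t) = (proj_point \<circ> g1) t" if "t \<in> {0..1}" for t using h that by (simp add: lifts_def)
    show "\<kappa> ((l +++ h2) t) = ((\<kappa> \<circ> l) +++ (proj_point \<circ> g2)) t" if "t \<in> {0..1}" for t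
      using h(2) that by (auto simp: lifts_def joinpaths_def)
  qed
  then show ?thesis by simp
qed

section \<open>Total winding and the lift of the Milnor fiber\<close>

context
  fixes a :: "(complex ^ 'n) set \<Rightarrow> int" and m :: "(complex ^ 'n) set \<Rightarrow> nat"
  assumes a: "\<And>g w. base_loop g \<Longrightarrow> (\<And>H. H \<in> A \<Longrightarrow> wind H g = of_int (w H)) \<Longrightarrow>
      [loop_char g = (\<Sum>H\<in>A. a H * w H)] (mod int r)"
    and m: "\<And>H. H \<in> A \<Longrightarrow> [int (m H) = a H] (mod int r)"
begin

abbreviation F :: "(complex ^ 'n) set"
  where "F \<equiv> milnor_fiber A f m"

text \<open>The winding of \<open>Q_poly A f m\<close> about 0 along a path in \<open>M\<close>,
  split over its factors; complex-valued and additive on open paths.\<close>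

definition total_wind :: "(real \<Rightarrow> complex ^ 'n) \<Rightarrow> complex"
  where "total_wind g = (\<Sum>H\<in>A. of_nat (m H) * wind H g)"

lemma total_wind_join:
  assumes "path g" "path_image g \<subseteq> M" "path h" "path_image h \<subseteq> M" "pathfinish g = pathstart h"
  shows "total_wind (g +++ h) = total_wind g + total_wind h"
  using wind_join assms by (simp add: total_wind_def sum.distrib[symmetric] distrib_left)

lemma total_wind_reverse:
  assumes "path g" "path_image g \<subseteq> M"
  shows "total_wind (reversepath g) = - total_wind g"
  using wind_reverse assms by (simp add: total_wind_def sum_negf[symmetric])

lemma total_wind_loop:
  assumes g: "base_loop g"
  obtains k where "total_wind g = of_int k" "[loop_char g = k] (mod int r)"
proof -
  obtain w where w: "\<And>H. H \<in> A \<Longrightarrow> wind H g = of_int (w H)" using base_loop_winding[OF g] by blast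
  have "total_wind g = of_int (\<Sum>H\<in>A. int (m H) * w H)" using w by (simp add: total_wind_def)
  moreover have "[(\<Sum>H\<in>A. a H * w H) = (\<Sum>H\<in>A. int (m H) * w H)] (mod int r)"
    using m by (intro cong_sum cong_scalar_right) (auto intro: cong_sym)
  then have "[loop_char g = (\<Sum>H\<in>A. int (m H) * w H)] (mod int r)" using a[OF g w] cong_trans by blast
  ultimately show ?thesis using that by blast
qed

lemma Q_poly_path_end:
  assumes g: "path g" "path_image g \<subseteq> M"
  shows "Q_poly A f m (pathfinish g) = exp (2 * of_real pi * \<i> * total_wind g) * Q_poly A f m (pathstart g)"
proof -
  have "Q_poly A f m (pathfinish g) =
      (\<Prod>H\<in>A. exp (of_nat (m H) * (2 * of_real pi * \<i> * wind H g)) * f H (pathstart g) ^ m H)"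
    unfolding Q_poly_def using f_path_end[OF _ g] 
    by (intro prod.cong) (simp_all add: power_mult_distrib exp_of_nat_mult)
  also have "\<dots> = exp (\<Sum>H\<in>A. of_nat (m H) * (2 * of_real pi * \<i> * wind H g)) * Q_poly A f m (pathstart g)"
    using fin by (simp add: prod.distrib exp_sum Q_poly_def)
  also have "(\<Sum>H\<in>A. of_nat (m H) * (2 * of_real pi * \<i> * wind H g)) = 2 * of_real pi * \<i> * total_wind g"
    unfolding total_wind_def sum_distrib_left by (intro sum.cong) auto
  finally show ?thesis .
qed

lemma total_wind_Ints:
  assumes g: "path g" "path_image g \<subseteq> M" and eq: "Q_poly A f m (pathfinish g) = Q_poly A f m (pathstart g)"
    and nz: "Q_poly A f m (pathstart g) \<noteq> 0"
  shows "total_wind g \<in> \<int>"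
proof -
  have "exp (2 * of_real pi * \<i> * total_wind g) = 1" using Q_poly_path_end[OF g] eq nz by simp
  then show ?thesis by (simp add: exp_eq_1 complex_is_Int_iff)
qed

lemma milnor_fiber_subset:
  assumes pos: "\<And>H. H \<in> A \<Longrightarrow> m H > 0"
  shows "F \<subseteq> M"
proof
  fix z assume z: "z \<in> F"
  have "f H z \<noteq> 0" if H: "H \<in> A" for H
  proof
    assume "f H z = 0"
    then have "f H z ^ m H = 0" using pos[OF H] by simp
    then have "Q_poly A f m z = 0" unfolding Q_poly_def using fin H by (intro prod_zero) auto
    then show False using z by (simp add: milnor_fiber_def)
  qed
  then show "z \<in> M" by (simp add: M_def)
qed

text \<open>Between two points of the fiber the total winding is an integer, although the segment
  may leave the fiber. Along short segments from \<open>z\<close> it is a continuous function of the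
  other end that vanishes at \<open>z\<close>, so it is 0 once its norm is below 1.\<close>

lemma total_wind_small:
  assumes z: "z \<in> F" "z \<in> M"
  obtains d where "d > 0" "ball z d \<subseteq> M" "\<And>z'. z' \<in> F \<Longrightarrow> z' \<in> ball z d \<Longrightarrow> total_wind (linepath z z') = 0"
proof -
  define \<psi> where "\<psi> = (\<lambda>z'. \<Sum>H\<in>A. of_nat (m H) * (Ln (f H z' / f H z) / (2 * of_real pi * \<i>)))"
  have fz: "f H z \<noteq> 0" if "H \<in> A" for H using z that by (simp add: M_def)
  have cf: "isCont (f H) z" if "H \<in> A" for H
    using f_continuous[OF that, of UNIV] by (simp add: continuous_on_eq_continuous_at)
  have "isCont \<psi> z"
    unfolding \<psi>_def using fz cf by (intro continuous_intros) (auto simp: continuous_within)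
  moreover have "\<psi> z = 0" using fz by (simp add: \<psi>_def)
  ultimately obtain d1 where d1: "d1 > 0" "\<And>z'. dist z' z < d1 \<Longrightarrow> norm (\<psi> z') < 1"
    unfolding continuous_at_eps_delta by (metis dist_norm diff_zero zero_less_one)
  have "\<forall>\<^sub>F z' in nhds z. \<forall>H\<in>A. norm (f H z' - f H z) < norm (f H z)"
  proof (rule eventually_ball_finite[OF fin], rule ballI)
    fix H assume H: "H \<in> A"
    have "(f H \<longlongrightarrow> f H z) (nhds z)" using cf[OF H] by (simp add: isCont_def tendsto_at_iff_tendsto_nhds)
    from tendstoD[OF this, of "norm (f H z)"] fz[OF H]
    show "\<forall>\<^sub>F z' in nhds z. norm (f H z' - f H z) < norm (f H z)" by (simp add: dist_norm)
  qed
  then obtain d2 where d2: "d2 > 0" "\<And>z' H. dist z' z < d2 \<Longrightarrow> H \<in> A \<Longrightarrow> norm (f H z' - f H z) < norm (f H z)"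
    unfolding eventually_nhds_metric by blast
  obtain d3 where d3: "d3 > 0" "ball z d3 \<subseteq> M" using open_M z(2) by (metis open_contains_ball)
  define d where "d = min d1 (min d2 d3)"
  have "total_wind (linepath z z') = 0" if z': "z' \<in> F" "z' \<in> ball z d" for z'
  proof -
    have dist: "dist z' z < d1" "dist z' z < d2" "z' \<in> ball z d3" using z'(2) by (auto simp: d_def dist_commute)
    have "total_wind (linepath z z') = \<psi> z'"
      unfolding total_wind_def \<psi>_def using wind_linepath d2(2)[OF dist(2)] by (intro sum.cong) auto
    then have small: "norm (total_wind (linepath z z')) < 1" using d1 dist by simp
    have "path_image (linepath z z') \<subseteq> M"
      using closed_segment_subset[of z "ball z d3" z'] dist(3) d3 by auto
    then have "total_wind (linepath z z') \<in> \<int>"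
      using z(1) z'(1) by (intro total_wind_Ints) (auto simp: milnor_fiber_def)
    then obtain k where "total_wind (linepath z z') = of_int k" by (auto simp: Ints_def)
    then show ?thesis using small by (simp add: norm_of_int)
  qed
  moreover have "d > 0" "ball z d \<subseteq> M" using d1 d2 d3 by (auto simp: d_def)
  ultimately show ?thesis using that by blast
qed

text \<open>Instead of showing that the Milnor fiber is connected, the paths from \<open>base\<close> are
  normalized by their total winding, which serves all of its components at once.\<close>

definition admissible :: "complex \<Rightarrow> complex ^ 'n \<Rightarrow> (real \<Rightarrow> complex ^ 'n) \<Rightarrow> bool"
  where "admissible \<theta> z g \<longleftrightarrow> path_to z g \<and> (\<exists>k::int. total_wind g = \<theta> + of_int (int r * k))"

text \<open>Paths from \<open>base\<close> to points of the fiber have total windings that differ by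
  integers. A base loop whose character value is minus this difference, which surjectivity of
  \<open>chi\<close> provides, corrects it to a multiple of \<open>r\<close>.\<close>

lemma admissible_exists:
  assumes z1: "path_to z1 g1" "z1 \<in> F" and z: "z \<in> F" "z \<in> M"
  obtains g where "admissible (total_wind g1) z g"
proof -
  define g where "g = tether z"
  have g: "path g" "path_image g \<subseteq> M" "pathstart g = base" "pathfinish g = z"
    using tether[OF z(2)] by (simp_all add: g_def)
  have g1: "path g1" "path_image g1 \<subseteq> M" "pathstart g1 = base" "pathfinish g1 = z1"
    using z1 by (simp_all add: path_to_def)
  have "total_wind (reversepath g1 +++ g) \<in> \<int>"
    using g g1 z z1 by (intro total_wind_Ints) (auto simp: path_image_join milnor_fiber_def)
  moreover have "total_wind (reversepath g1 +++ g) = total_wind g - total_wind g1"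
    using g g1 by (simp add: total_wind_join total_wind_reverse)
  ultimately obtain n where n: "total_wind g - total_wind g1 = of_int n" by (auto simp: Ints_def)
  obtain l where l: "base_loop l" "loop_char l = (- n) mod int r"
    using loop_char_surj[of "(- n) mod int r"] r by auto
  obtain j where j: "total_wind l = of_int j" "[loop_char l = j] (mod int r)" using total_wind_loop[OF l(1)] by blast
  have "[j = - n] (mod int r)" using j(2) l(2) by (simp add: cong_def)
  then obtain k where k: "j + n = int r * k" by (metis cong_iff_dvd_diff diff_minus_eq_add dvdE)
  have lp: "path l" "path_image l \<subseteq> M" "pathstart l = base" "pathfinish l = base"
    using l(1) by (auto simp: base_loop_def)
  have "total_wind (l +++ g) = total_wind l + total_wind g" using lp g by (intro total_wind_join) auto
  also have "\<dots> = total_wind g1 + of_int (j + n)" using n j(1) by (simp add: algebra_simps)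
  finally have "total_wind (l +++ g) = total_wind g1 + of_int (int r * k)" by (simp only: k)
  moreover have "path_to z (l +++ g)" using lp g by (auto simp: path_to_def path_image_join)
  ultimately show ?thesis using that unfolding admissible_def by blast
qed

text \<open>Two admissible paths differ by a base loop whose total winding is a multiple of
  \<open>r\<close>, hence by one on which the character vanishes.\<close>

lemma admissible_same_end:
  assumes g: "admissible \<theta> z g1" "admissible \<theta> z g2" and h: "lifts g1 h1" "lifts g2 h2"
  shows "pathfinish h1 = pathfinish h2"
proof (rule lifts_same_end[OF _ _ _ h])
  show p: "path_to z g1" "path_to z g2" using g by (auto simp: admissible_def)
  then have p': "path g1" "path_image g1 \<subseteq> M" "path g2" "path_image g2 \<subseteq> M" "pathstart g1 = base" "pathstart g2 = base"
    "pathfinish g1 = pathfinish g2" by (auto simp: path_to_def)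
  obtain k1 k2 :: int where k: "total_wind g1 = \<theta> + of_int (int r * k1)" "total_wind g2 = \<theta> + of_int (int r * k2)"
    using g by (auto simp: admissible_def)
  have l: "base_loop (g1 +++ reversepath g2)" using p' by (auto simp: base_loop_def path_image_join)
  then obtain j where j: "total_wind (g1 +++ reversepath g2) = of_int j" "[loop_char (g1 +++ reversepath g2) = j] (mod int r)"
    using total_wind_loop by blast
  have "total_wind (g1 +++ reversepath g2) = of_int (int r * k1) - of_int (int r * k2)"
    using p' k by (simp add: total_wind_join total_wind_reverse)
  also have "\<dots> = of_int (int r * (k1 - k2))" by (simp add: algebra_simps)
  finally have "j = int r * (k1 - k2)" using j(1) by (metis of_int_eq_iff)
  then have "loop_char (g1 +++ reversepath g2) mod int r = 0" using j(2) by (simp add: cong_def)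
  then show "loop_char (g1 +++ reversepath g2) = 0" using loop_char_range[OF l] by simp
qed

text \<open>A point \<open>z\<close> is sent to the end of the lift of an admissible path to it.
  Extending this path by a short segment of total winding 0 keeps it admissible, so near
  \<open>z\<close> the map is \<open>q \<circ> proj_point\<close> with \<open>q\<close> inverse to
  \<open>\<kappa>\<close> on a sheet; this gives continuity.\<close>

lemma milnor_fiber_factors:
  assumes pos: "\<And>H. H \<in> A \<Longrightarrow> m H > 0"
  shows "factors_through F proj_point E \<kappa>"
proof (cases "F = {}")
  case True
  then show ?thesis by (simp add: factors_through_def)
next
  case False
  have FM: "F \<subseteq> M" by (rule milnor_fiber_subset[OF pos])
  obtain z1 where z1: "z1 \<in> F" using False by blast
  \<comment> \<open>The reference value is taken from a path to some point of the fiber;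
    \<open>base\<close> may lie outside the fiber, so \<open>\<theta>\<close> need not be an
    integer.\<close>
  define \<theta> where "\<theta> = total_wind (tether z1)"
  have z1M: "z1 \<in> M" using z1 FM by blast
  have pz1: "path_to z1 (tether z1)" using tether[OF z1M] by (simp add: path_to_def)
  have "\<forall>z\<in>F. \<exists>g. admissible \<theta> z g"
    using admissible_exists[OF pz1 z1] FM unfolding \<theta>_def by blast
  then obtain P where P: "\<And>z. z \<in> F \<Longrightarrow> admissible \<theta> z (P z)" by metis
  have "\<forall>z\<in>F. \<exists>h. lifts (P z) h" using P lifts_exist unfolding admissible_def by meson
  then obtain h where h: "\<And>z. z \<in> F \<Longrightarrow> lifts (P z) (h z)" by metis
  define G where "G = (\<lambda>z. pathfinish (h z))"
  have hz: "path (h z)" "path_image (h z) \<subseteq> E" "pathstart (h z) = e0" "\<And>t. t \<in> {0..1} \<Longrightarrow> \<kappa> (h z t) = proj_point (P z t)"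
    if "z \<in> F" for z using h[OF that] by (auto simp: lifts_def)
  have GE: "G z \<in> E" if "z \<in> F" for z using hz(2)[OF that] by (auto simp: G_def)
  have \<kappa>G: "\<kappa> (G z) = proj_point z" if "z \<in> F" for z
    using hz(4)[OF that, of 1] P[OF that] by (simp add: G_def admissible_def path_to_def pathfinish_def)
  have local: "\<exists>d>0. \<exists>q W. continuous_on W q \<and> proj_point ` ball z d \<subseteq> W \<and> ball z d \<subseteq> M \<and> (\<forall>z'\<in>F \<inter> ball z d. G z' = q (proj_point z'))"
    if z: "z \<in> F" for z
  proof -
    obtain W v q where W: "\<kappa> (G z) \<in> W" "openin (top_of_set U) W" "G z \<in> v" "openin (top_of_set E) v"
      "homeomorphism v W \<kappa> q" using covering_sheet[OF cov GE[OF z]] .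
    obtain d1 where d1: "d1 > 0" "ball z d1 \<subseteq> M" "\<And>z'. z' \<in> F \<Longrightarrow> z' \<in> ball z d1 \<Longrightarrow> total_wind (linepath z z') = 0"
      using total_wind_small[OF z] FM z by blast
    have "proj_point ` M \<subseteq> U" "z \<in> M" "proj_point z \<in> W"
      using proj_point_M W(1) \<kappa>G[OF z] z FM by auto
    then obtain d2 where d2: "d2 > 0" "\<And>t. t \<in> M \<Longrightarrow> dist t z < d2 \<Longrightarrow> proj_point t \<in> W"
      using continuous_near[OF continuous_on_M_proj_point _ W(2), of z] by metis
    define d where "d = min d1 d2"
    have dM: "ball z d \<subseteq> M" using d1(2) by (auto simp: d_def)
    have dW: "proj_point ` ball z d \<subseteq> W" using d2(2) dM by (auto simp: d_def dist_commute)
    have cq: "continuous_on W q" and qW: "q ` W = v" using W(5) homeomorphism_def by blast+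
    have vE: "v \<subseteq> E" using W(4) openin_imp_subset by blast
    have "G z' = q (proj_point z')" if z': "z' \<in> F" "z' \<in> ball z d" for z'
    proof -
      let ?l = "linepath z z'"
      have l: "path_image ?l \<subseteq> ball z d" using z'(2) by (simp add: closed_segment_subset d_def d1 d2)
      have Pz: "path (P z)" "path_image (P z) \<subseteq> M" "pathstart (P z) = base" "pathfinish (P z) = z"
        using P[OF z] by (auto simp: admissible_def path_to_def)
      have "path (q \<circ> (proj_point \<circ> ?l))"
      proof (rule path_continuous_image)
        show "path (proj_point \<circ> ?l)" using l dM by (intro proj_path(1)) auto
        show "continuous_on (path_image (proj_point \<circ> ?l)) q"
          using l dW by (intro continuous_on_subset[OF cq]) (auto simp: path_image_compose)
      qed
      moreover have "path_image (q \<circ> (proj_point \<circ> ?l)) \<subseteq> E"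
        using l dW qW vE by (auto simp: path_image_compose)
      moreover have qz: "pathstart (q \<circ> (proj_point \<circ> ?l)) = G z"
        using homeomorphism_apply1[OF W(5,3)] \<kappa>G[OF z] by (simp add: pathstart_compose)
      moreover have "\<kappa> ((h z +++ (q \<circ> (proj_point \<circ> ?l))) t) = proj_point ((P z +++ ?l) t)" if "t \<in> {0..1}" for t
      proof (cases "t \<le> 1/2")
        case True
        then show ?thesis using that hz(4)[OF z, of "2 * t"] by (simp add: joinpaths_def)
      next
        case False
        then have "?l (2 * t - 1) \<in> path_image ?l" using that by (auto simp: path_image_def intro!: imageI)
        then have "proj_point (?l (2 * t - 1)) \<in> W" using l dW by blast
        then show ?thesis using False homeomorphism_apply2[OF W(5)] by (simp add: joinpaths_def)
      qed
      ultimately have "lifts (P z +++ ?l) (h z +++ (q \<circ> (proj_point \<circ> ?l)))"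
        using hz(1-3)[OF z] unfolding lifts_def by (auto simp: path_image_join G_def)
      moreover have "admissible \<theta> z' (P z +++ ?l)"
      proof -
        have lM: "path_image ?l \<subseteq> M" using l dM by blast
        have "total_wind ?l = 0" using d1(3)[OF z'(1)] z'(2) by (simp add: d_def)
        then have "total_wind (P z +++ ?l) = total_wind (P z)"
          using Pz lM total_wind_join[of "P z" ?l] by simp
        then show ?thesis using P[OF z] Pz lM unfolding admissible_def path_to_def
          by (auto simp: path_image_join)
      qed
      ultimately have "G z' = pathfinish (h z +++ (q \<circ> (proj_point \<circ> ?l)))"
        unfolding G_def using admissible_same_end[OF P[OF z'(1)] _ h[OF z'(1)]] by blast
      then show ?thesis by (simp add: pathfinish_compose)
    qed
    moreover have "d > 0" using d1 d2 by (simp add: d_def)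
    ultimately show ?thesis using cq dW dM by (intro exI[of _ d] conjI exI[of _ q] exI[of _ W]) auto
  qed
  have "continuous_on F G"
    unfolding continuous_on_topological
  proof (intro ballI allI impI)
    fix z B assume z: "z \<in> F" and B: "open B" "G z \<in> B"
    obtain d q W where d: "d > 0" "continuous_on W q" "proj_point ` ball z d \<subseteq> W" "ball z d \<subseteq> M"
      "\<And>z'. z' \<in> F \<Longrightarrow> z' \<in> ball z d \<Longrightarrow> G z' = q (proj_point z')" using local[OF z] by blast
    have "continuous_on (ball z d) (q \<circ> proj_point)"
      using d continuous_on_M_proj_point by (intro continuous_on_compose) (auto intro: continuous_on_subset)
    then have "open ((q \<circ> proj_point) -` B \<inter> ball z d)"
      using B(1) continuous_on_open_vimage[OF open_ball] by blast
    moreover have "z \<in> (q \<circ> proj_point) -` B \<inter> ball z d" using B(2) d(1) d(5)[OF z] by simp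
    ultimately show "\<exists>S. open S \<and> z \<in> S \<and> (\<forall>y\<in>F. y \<in> S \<longrightarrow> G y \<in> B)"
      using d(5) by (intro exI[of _ "(q \<circ> proj_point) -` B \<inter> ball z d"]) auto
  qed
  then show ?thesis unfolding factors_through_def using GE \<kappa>G by blast
qed

end

text \<open>The windings \<open>w\<close> of a loop with character value 1 express that the
  \<open>a H\<close> and \<open>r\<close> have no common divisor; the fibre loop, all of whose
  windings are 1, gives the congruence for the sum.\<close>

lemma weights_exist:
  obtains a w :: "(complex ^ 'n) set \<Rightarrow> int" where
    "\<And>m. m \<in> congruent_weights A r a \<Longrightarrow> m \<in> multiplicity_vectors A \<and> factors_through (milnor_fiber A f m) proj_point E \<kappa>"
    "[(\<Sum>H\<in>A. a H) = 0] (mod int r)" "[(\<Sum>H\<in>A. a H * w H) = 1] (mod int r)"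
proof -
  obtain a where a: "\<And>g w. base_loop g \<Longrightarrow> (\<And>H. H \<in> A \<Longrightarrow> wind H g = of_int (w H)) \<Longrightarrow>
      [loop_char g = (\<Sum>H\<in>A. a H * w H)] (mod int r)" using loop_char_winding by blast
  \<comment> \<open>Reduced modulo \<open>r\<close> because for \<open>r = 1\<close> the only value
    of the character is 0.\<close>
  obtain g where g: "base_loop g" "loop_char g = 1 mod int r" using loop_char_surj[of "1 mod int r"] r by auto
  obtain w where w: "\<And>H. H \<in> A \<Longrightarrow> wind H g = of_int (w H)" using base_loop_winding[OF g(1)] by blast
  have 1: "[(\<Sum>H\<in>A. a H * w H) = 1] (mod int r)" using a[OF g(1) w] g(2) by (simp add: cong_def)
  obtain l where l: "base_loop l" "loop_char l = 0" "\<And>H. H \<in> A \<Longrightarrow> wind H l = 1" using fibre_loop by blast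
  have 2: "[(\<Sum>H\<in>A. a H) = 0] (mod int r)" using a[OF l(1), of "\<lambda>_. 1"] l by (simp add: cong_sym_eq)
  have "m \<in> multiplicity_vectors A \<and> factors_through (milnor_fiber A f m) proj_point E \<kappa>"
    if m: "m \<in> congruent_weights A r a" for m
  proof
    show "m \<in> multiplicity_vectors A" using m by (simp add: congruent_weights_def multiplicity_vectors_def)
    show "factors_through (milnor_fiber A f m) proj_point E \<kappa>"
      using m by (intro milnor_fiber_factors[OF a]) (auto simp: congruent_weights_def)
  qed
  then show ?thesis using that 1 2 by blast
qed

end

theorem proposition6p7:
  fixes A :: "(complex ^ 'n) set set"
    and f :: "(complex ^ 'n) set \<Rightarrow> complex ^ 'n \<Rightarrow> complex"
    and u :: "'n cproj"
    and r :: nat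
    and chi :: "(real \<Rightarrow> 'n cproj) set \<Rightarrow> int"
    and E :: "'x::topological_space set"
    and \<kappa> :: "'x \<Rightarrow> 'n cproj"
  assumes "central_arrangement A"
    and "A \<noteq> {}"
    and "defining_forms A f"
    and "u \<in> proj_complement A"
    and "r \<ge> 1"
    and "chi \<in> epi (fundamental_group (proj_complement A) u) (integer_mod_group r)"
    and "is_cover_for (proj_complement A) u
           (kernel (fundamental_group (proj_complement A) u) (integer_mod_group r) chi) E \<kappa>"
  shows "(card A \<ge> 2 \<longrightarrow>
            infinite {m \<in> multiplicity_vectors A.
              factors_through (milnor_fiber A f m) proj_point E \<kappa>}) \<and>
         (\<forall>p::nat. prime p \<and> \<not> p dvd r \<longrightarrow>
            (\<exists>m \<in> multiplicity_vectors A.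
              factors_through (milnor_fiber A f m) proj_point E \<kappa> \<and> \<not> p dvd Q_degree A m))"
proof -
  interpret arrangement_cover A f u r chi E \<kappa>
    using assms by unfold_locales
  obtain a w where aw: "\<And>m. m \<in> congruent_weights A r a \<Longrightarrow>
      m \<in> multiplicity_vectors A \<and> factors_through (milnor_fiber A f m) proj_point E \<kappa>"
    "[(\<Sum>H\<in>A. a H) = 0] (mod int r)" "[(\<Sum>H\<in>A. a H * w H) = 1] (mod int r)"
    using weights_exist by blast
  show ?thesis
  proof (intro conjI impI allI)
    assume "card A \<ge> 2"
    then have "infinite (congruent_weights A r a)"
      using infinite_congruent_weights[OF fin _ r aw(3)] by blast
    then show "infinite {m \<in> multiplicity_vectors A. factors_through (milnor_fiber A f m) proj_point E \<kappa>}"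
      by (rule infinite_super[rotated]) (use aw(1) in blast)
  next
    fix p :: nat assume p: "prime p \<and> \<not> p dvd r"
    then show "\<exists>m\<in>multiplicity_vectors A. factors_through (milnor_fiber A f m) proj_point E \<kappa> \<and> \<not> p dvd Q_degree A m"
      using congruent_weights_sum_not_dvd[OF fin nonempty r aw(3,2), of p] aw(1) unfolding Q_degree_def by blast
  qed
qed

end
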